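(* Let $u$ be a global solution of the differential inequality $$\left|u''(t)+2\delta u'(t)+Au(t)\right|\le K_0\left(|u(t)|^{1+p}+|A^{1/2}u(t)|^{1+q}\right)$$ in the sense defined in the context, where $K_0\ge 0$, $p>0$, $q>0$. Assume that the spectrum of $A$ is a finite or countable set of eigenvalues without finite accumulation points, and that $\lim_{t\to+\infty}|u(t)|_{D(A^{1/2})}=0$. Then exactly one of the following holds. (1) (Null solution) $u(t)=0$ for every $t\ge 0$. (2) (Slow solution) There exist $T_0\ge 0$ and positive constants $M_1,M_2$ such that for every $t\ge T_0$ $$|u(t)|\ge \frac{M_1}{(1+t)^{1/p}},\qquad |u'(t)|+|A^{1/2}u(t)|\le M_2|u(t)|^{1+p}.$$ (3) (Fast solution) There exist $r_0\in\mathcal{D}$ with $r_0>0$ and a nontrivial $r_0$-pure solution $v_0$ of the linear homogeneous equation $v''+2\delta v'+Av=0$ such that $$\lim_{t\to+\infty}\left(|u'(t)-v_0'(t)|+|u(t)-v_0(t)|_{D(A^{1/2})}\right)e^{\gamma t}=0$$ for every $\gamma<\min\{\beta_0,(1+p)r_0,(1+q)r_0\}$. Here $\beta_0:=\min\{r\in\mathcal{D}: r>r_0\}$ if $r_0<\max\mathcal{D}$, and $\beta_0:=+\infty$ otherwise.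
   Context: $H$ is a separable real Hilbert space with norm $|\cdot|$ and scalar product $\langle\cdot,\cdot\rangle$. $A$ is a self-adjoint nonnegative linear operator on $H$ with dense domain $D(A)$. For $\alpha\ge0$, $D(A^\alpha)$ carries the norm $|u|_{D(A^\alpha)}=(|u|^2+|A^\alpha u|^2)^{1/2}$. The constant $\delta>0$ is fixed. Assume the spectrum $\sigma(A)$ is a finite or countable set of eigenvalues without finite accumulation points. Then $H$ has an orthonormal basis $\{e_k\}_{k\in\mathcal K}$ of eigenvectors, $Ae_k=\lambda_ke_k$; eigenvalues may be repeated. **The set $\mathcal{D}$.** $\mathcal{D}:=\{\mathrm{Re}(z): z\in\mathbb{C},\ z^2-2\delta z+\lambda=0 \text{ for some }\lambda\in\sigma(A)\}$. This is a finite set, and all its elements lie in $[0,2\delta]$. **Linear solutions.** For $g\in C^0([0,\infty),H)$ and $(u_0,u_1)\in D(A^{1/2})\times H$, the equation $u''+2\delta u'+Au=g$ with $u(0)=u_0$, $u'(0)=u_1$ has a unique weak solution $u\in C^0([0,\infty),D(A^{1/2}))\cap C^1([0,\infty),H)$. Its energy $E(t)=|u'(t)|^2+|A^{1/2}u(t)|^2$ is $C^1$ with $E'=-4\delta|u'|^2+2\langle u',g\rangle$. **Decomposition of homogeneous solutions.** Let $u$ solve $u''+2\delta u'+Au=0$ and write $u_k(t)=\langle u(t),e_k\rangle$. - If $\lambda_k\ge\delta^2$, the whole mode $u_k(t)e_k$ is assigned to the exponent $r=\delta$. Such a mode has the form $e^{-\delta t}(a\cos\phi_kt+b\sin\phi_kt)$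 with $\phi_k=\sqrt{\lambda_k-\delta^2}$, or $e^{-\delta t}(a+bt)$ when $\lambda_k=\delta^2$. - If $\lambda_k<\delta^2$, then $u_k(t)=a_ke^{-r_{1,k}t}+b_ke^{-r_{2,k}t}$ with $r_{1,k}=\delta-\sqrt{\delta^2-\lambda_k}$ and $r_{2,k}=\delta+\sqrt{\delta^2-\lambda_k}$. The first term is assigned to $r_{1,k}$ and the second to $r_{2,k}$. For $r\in\mathcal D$, let $u_r$ be the sum of all pieces assigned to $r$. Then $u=\sum_{r\in\mathcal D}u_r$ is a unique finite decomposition, and each $u_r$ is a solution of the homogeneous equation. For $r_0\in\mathcal{D}$, the solution $u$ is called: - $r_0$-fast if $u_r\equiv0$ for all $r\le r_0$; - $r_0$-slow if $u_r\equiv0$ for all $r>r_0$; - $r_0$-pure if $u_r\equiv0$ for all $r\ne r_0$. A pair $(u_0,u_1)\in D(A^{1/2})\times H$ is called $r_0$-fast (respectively $r_0$-slow, $r_0$-pure) if the homogeneous solution with these initial data has that property. **Solutions of the differential inequality.** A global solution of the differential inequality is a function $u\in C^0([0,\infty),D(A^{1/2}))\cap C^1([0,\infty),H)$ for which there exists $g\in C^0([0,\infty),H)$ such that: - $u$ is the weak solution of $u''+2\delta u'+Au=g$ on $[0,\infty)$; - $|g(t)|\le K_0(|u(t)|^{1+p}+|A^{1/2}u(t)|^{1+q})$ for all $t\ge0$. *)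

theory Defs
  imports "HOL-Analysis.Analysis"
begin

text \<open>The operator A is given through an orthonormal basis of eigenvectors
  e k (k in K) with eigenvalues lam k, as in the paper's setting.\<close>

definition onb :: "'k set \<Rightarrow> ('k \<Rightarrow> 'a::{real_inner,complete_space}) \<Rightarrow> bool" where
  "onb K e \<longleftrightarrow> countable K \<and>
     (\<forall>i\<in>K. \<forall>j\<in>K. e i \<bullet> e j = (if i = j then 1 else 0)) \<and>
     (\<forall>x. ((\<lambda>k. (x \<bullet> e k) *\<^sub>R e k) has_sum x) K)"

definition spec :: "'k set \<Rightarrow> ('k \<Rightarrow> real) \<Rightarrow> real set" where
  "spec K lam = lam ` K"

text \<open>Hypotheses on A: self-adjoint nonnegative, spectrum made of eigenvalues
  without finite accumulation points.\<close>
definition admissible_op :: "'k set \<Rightarrow> ('k \<Rightarrow> 'a::{real_inner,complete_space}) \<Rightarrow> ('k \<Rightarrow> real) \<Rightarrow> bool" where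
  "admissible_op K e lam \<longleftrightarrow> onb K e \<and> (\<forall>k\<in>K. lam k \<ge> 0) \<and>
     (\<forall>M. finite (spec K lam \<inter> {..M}))"

definition domhalf :: "'k set \<Rightarrow> ('k \<Rightarrow> 'a::real_inner) \<Rightarrow> ('k \<Rightarrow> real) \<Rightarrow> 'a set" where
  "domhalf K e lam = {x. (\<lambda>k. lam k * (x \<bullet> e k)\<^sup>2) summable_on K}"

definition halfnorm :: "'k set \<Rightarrow> ('k \<Rightarrow> 'a::real_inner) \<Rightarrow> ('k \<Rightarrow> real) \<Rightarrow> 'a \<Rightarrow> real" where
  "halfnorm K e lam x = sqrt (\<Sum>\<^sub>\<infinity>k\<in>K. lam k * (x \<bullet> e k)\<^sup>2)"

definition dnorm :: "'k set \<Rightarrow> ('k \<Rightarrow> 'a::real_inner) \<Rightarrow> ('k \<Rightarrow> real) \<Rightarrow> 'a \<Rightarrow> real" where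
  "dnorm K e lam x = sqrt ((norm x)\<^sup>2 + (halfnorm K e lam x)\<^sup>2)"

text \<open>Weak solution of u'' + 2 delta u' + A u = g on [0,oo), with u' the
  (C^1) derivative of u; tested against each eigenvector.\<close>
definition weak_sol :: "'k set \<Rightarrow> ('k \<Rightarrow> 'a::{real_inner,complete_space}) \<Rightarrow> ('k \<Rightarrow> real) \<Rightarrow> real
    \<Rightarrow> (real \<Rightarrow> 'a) \<Rightarrow> (real \<Rightarrow> 'a) \<Rightarrow> (real \<Rightarrow> 'a) \<Rightarrow> bool" where
  "weak_sol K e lam \<delta> u u' g \<longleftrightarrow>
     (\<forall>t\<ge>0. u t \<in> domhalf K e lam) \<and>
     (\<forall>t\<ge>0. ((\<lambda>s. dnorm K e lam (u s - u t)) \<longlongrightarrow> 0) (at t within {0..})) \<and>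
     (\<forall>t\<ge>0. (u has_vector_derivative u' t) (at t within {0..})) \<and>
     continuous_on {0..} u' \<and>
     (\<forall>k\<in>K. \<forall>t\<ge>0. ((\<lambda>s. u' s \<bullet> e k) has_real_derivative
         (- 2 * \<delta> * (u' t \<bullet> e k) - lam k * (u t \<bullet> e k) + g t \<bullet> e k)) (at t within {0..}))"

definition diff_ineq_sol :: "'k set \<Rightarrow> ('k \<Rightarrow> 'a::{real_inner,complete_space}) \<Rightarrow> ('k \<Rightarrow> real) \<Rightarrow> real
    \<Rightarrow> real \<Rightarrow> real \<Rightarrow> real \<Rightarrow> (real \<Rightarrow> 'a) \<Rightarrow> (real \<Rightarrow> 'a) \<Rightarrow> bool" where
  "diff_ineq_sol K e lam \<delta> K0 p q u u' \<longleftrightarrow>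
     (\<exists>g. continuous_on {0..} g \<and> weak_sol K e lam \<delta> u u' g \<and>
        (\<forall>t\<ge>0. norm (g t) \<le> K0 * (norm (u t) powr (1 + p) + halfnorm K e lam (u t) powr (1 + q))))"

definition calD :: "'k set \<Rightarrow> ('k \<Rightarrow> real) \<Rightarrow> real \<Rightarrow> real set" where
  "calD K lam \<delta> = {Re z | z l. l \<in> spec K lam \<and> z\<^sup>2 - 2 * complex_of_real \<delta> * z + complex_of_real l = 0}"

definition beta0 :: "'k set \<Rightarrow> ('k \<Rightarrow> real) \<Rightarrow> real \<Rightarrow> real \<Rightarrow> ereal" where
  "beta0 K lam \<delta> r0 = (if r0 < Max (calD K lam \<delta>)
       then ereal (Min {r \<in> calD K lam \<delta>. r > r0}) else \<infinity>)"

text \<open>The piece of the k-th mode of a homogeneous solution v (with derivative v')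
  assigned to the exponent r, evaluated at time t.\<close>
definition piece :: "('k \<Rightarrow> 'a::real_inner) \<Rightarrow> ('k \<Rightarrow> real) \<Rightarrow> real
    \<Rightarrow> (real \<Rightarrow> 'a) \<Rightarrow> (real \<Rightarrow> 'a) \<Rightarrow> 'k \<Rightarrow> real \<Rightarrow> real \<Rightarrow> real" where
  "piece e lam \<delta> v v' k r t =
     (if lam k \<ge> \<delta>\<^sup>2 then (if r = \<delta> then v t \<bullet> e k else 0)
      else (let x = v 0 \<bullet> e k; y = v' 0 \<bullet> e k;
                r1 = \<delta> - sqrt (\<delta>\<^sup>2 - lam k); r2 = \<delta> + sqrt (\<delta>\<^sup>2 - lam k);
                a = (r2 * x + y) / (r2 - r1); b = - (r1 * x + y) / (r2 - r1)
            in (if r = r1 then a * exp (- r1 * t) else 0)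
             + (if r = r2 then b * exp (- r2 * t) else 0)))"

definition comp_r :: "'k set \<Rightarrow> ('k \<Rightarrow> 'a::{real_inner,complete_space}) \<Rightarrow> ('k \<Rightarrow> real) \<Rightarrow> real
    \<Rightarrow> (real \<Rightarrow> 'a) \<Rightarrow> (real \<Rightarrow> 'a) \<Rightarrow> real \<Rightarrow> real \<Rightarrow> 'a" where
  "comp_r K e lam \<delta> v v' r t = (\<Sum>\<^sub>\<infinity>k\<in>K. piece e lam \<delta> v v' k r t *\<^sub>R e k)"

definition pure :: "'k set \<Rightarrow> ('k \<Rightarrow> 'a::{real_inner,complete_space}) \<Rightarrow> ('k \<Rightarrow> real) \<Rightarrow> real
    \<Rightarrow> (real \<Rightarrow> 'a) \<Rightarrow> (real \<Rightarrow> 'a) \<Rightarrow> real \<Rightarrow> bool" where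
  "pure K e lam \<delta> v v' r0 \<longleftrightarrow>
     (\<forall>r\<in>calD K lam \<delta>. r \<noteq> r0 \<longrightarrow> (\<forall>t\<ge>0. comp_r K e lam \<delta> v v' r t = 0))"

end

theory Submission
  imports Defs
begin

text \<open>
  Split the phase space according to the exponents in \<open>calD\<close> and let \<open>y\<^sub>r(t)\<close> be the norm of the
  component of \<open>(u(t), u'(t))\<close> with exponent \<open>r\<close>. Up to an arbitrarily small loss of rate, needed only at
  the double root \<open>\<lambda> = \<delta>\<^sup>2\<close>, each \<open>y\<^sub>r\<close> obeys \<open>\<bar>y\<^sub>r' + r y\<^sub>r\<bar> \<le> C \<bar>g\<bar>\<close> in integrated form, and \<open>g\<close> is
  superlinear in \<open>u\<close>.

  If at some large time the neutral component \<open>y\<^sub>0\<close> dominates the sum \<open>Y\<close> of the others, it does so forever: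
  \<open>Y\<close> is slaved to \<open>y\<^sub>0\<close>, so that \<open>Y \<le> M y\<^sub>0\<^bsup>1+p\<^esup>\<close> and \<open>y\<^sub>0\<^bsup>-p\<^esup>\<close> grows at most linearly (slow solution).
  Otherwise \<open>u\<close> decays exponentially. Let \<open>\<gamma>\<close> be the supremum of its decay rates. Since \<open>g\<close> decays faster than
  \<open>u\<close>, integrating from infinity for \<open>r < \<gamma>\<close> and from \<open>0\<close> for \<open>r > \<gamma>\<close> improves the rate of every \<open>y\<^sub>r\<close> with
  \<open>r \<noteq> \<gamma>\<close>. Hence either \<open>\<gamma> = \<infinity>\<close>, and a weighted supremum argument gives \<open>u = 0\<close>, or \<open>\<gamma> = r\<^sub>0\<close> is an exponent,
  and the profile \<open>v\<^sub>0\<close> is obtained by carrying the \<open>r\<^sub>0\<close>-component back from infinity along the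
  homogeneous flow.
\<close>

section \<open>Scalar differential inequalities\<close>

text \<open>Differentiating \<open>y\<^sub>r\<close> would mean differentiating an infinite sum of
  modes. Differential inequalities are therefore proved for finite sets of modes, with constants
  independent of the set, and only their integrated forms are passed to all modes by taking suprema.
  This uniformity rests on the spectrum: only finitely many eigenvalues lie below
  \<open>\<delta>\<^sup>2\<close>, so the two exponentials of an overdamped mode stay uniformly
  separated. The velocity and \<open>A^(1/2) u\<close> see only the positive exponents. Hence the
  neutral component enters \<open>g\<close> through the power \<open>1 + p\<close> alone, which
  fixes both the decay \<open>t^(-1/p)\<close> and the power in the second estimate of the slow
  alternative. The assumption gives no control on \<open>u'\<close>; its decay is recovered from the
  equation. That no two alternatives coexist is a separate matter: a polynomial lower bound
  contradicts exponential decay, and a nontrivial pure solution cannot decay faster than its own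
  rate.\<close>

lemma nonpos_derivative_imp_le:
  fixes f f' :: "real \<Rightarrow> real"
  assumes "\<And>x. x \<in> {s..t} \<Longrightarrow> (f has_real_derivative f' x) (at x within {s..t})"
    and "\<And>x. x \<in> {s..t} \<Longrightarrow> f' x \<le> 0" and "s \<le> t"
  shows "f t \<le> f s"
proof (cases "s = t")
  case False
  then have st: "s < t" using assms(3) by simp
  have "\<exists>x\<in>{s<..<t}. f t - f s = (\<lambda>h. f' x * h) (t - s)"
    using assms(1) by (intro mvt_simple[OF st]) (auto simp: has_field_derivative_def)
  then obtain x where "x \<in> {s<..<t}" "f t - f s = f' x * (t - s)" by blast
  then show ?thesis using assms(2)[of x] st by (smt (verit) greaterThanLessThan_iff atLeastAtMost_iff mult_nonneg_nonneg mult_nonpos_nonneg)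
qed auto

text \<open>Dividing \<open>R'\<close> by \<open>2 * sqrt R\<close> fails where \<open>R\<close>
  vanishes. The function \<open>sqrt (R + \<eta>\<^sup>2)\<close> is differentiable, obeys the same
  inequality and exceeds \<open>sqrt R\<close> by at most \<open>\<eta>\<close>, which is then sent
  to 0.\<close>

lemma sqrt_growth_upper:
  fixes R R' h :: "real \<Rightarrow> real"
  assumes der: "\<And>x. x \<in> {s..t} \<Longrightarrow> (R has_real_derivative R' x) (at x within {s..t})"
    and nonneg: "\<And>x. x \<in> {s..t} \<Longrightarrow> 0 \<le> R x" "\<And>x. x \<in> {s..t} \<Longrightarrow> 0 \<le> h x"
    and le: "\<And>x. x \<in> {s..t} \<Longrightarrow> R' x \<le> 2 * h x * sqrt (R x)"
    and cont: "continuous_on {s..t} h" and st: "s \<le> t"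
  shows "sqrt (R t) \<le> sqrt (R s) + integral {s..t} h"
proof (rule field_le_epsilon)
  fix \<eta> :: real assume eta: "\<eta> > 0"
  define f where "f x = sqrt (R x + \<eta>\<^sup>2) - integral {s..x} h" for x
  have pos: "R x + \<eta>\<^sup>2 > 0" if "x \<in> {s..t}" for x
    using nonneg(1)[OF that] eta by (simp add: add_nonneg_pos)
  have 1: "(f has_real_derivative R' x * (inverse (sqrt (R x + \<eta>\<^sup>2)) / 2) - h x) (at x within {s..t})"
    if x: "x \<in> {s..t}" for x
  proof -
    have "((\<lambda>x. integral {s..x} h) has_real_derivative h x) (at x within {s..t})"
      using integral_has_real_derivative[OF cont x] by simp
    then show ?thesis unfolding f_def using pos[OF x]
      by (auto intro!: derivative_eq_intros der x)
  qed
  have 2: "R' x * (inverse (sqrt (R x + \<eta>\<^sup>2)) / 2) - h x \<le> 0" if x: "x \<in> {s..t}" for x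
  proof -
    have "R' x \<le> 2 * h x * sqrt (R x + \<eta>\<^sup>2)"
      using le[OF x] nonneg(2)[OF x]
      by (smt (verit, best) mult_left_mono real_sqrt_le_iff zero_le_power2)
    then show ?thesis using pos[OF x] by (simp add: field_simps)
  qed
  have "f t \<le> f s" by (rule nonpos_derivative_imp_le[OF 1 2 st])
  then have "sqrt (R t + \<eta>\<^sup>2) \<le> sqrt (R s + \<eta>\<^sup>2) + integral {s..t} h"
    by (simp add: f_def)
  moreover have "sqrt (R t) \<le> sqrt (R t + \<eta>\<^sup>2)" by simp
  moreover have "sqrt (R s + \<eta>\<^sup>2) \<le> sqrt (R s) + \<eta>"
    using sqrt_add_le_add_sqrt[of "R s" "\<eta>\<^sup>2"] nonneg(1)[of s] st eta by simp
  ultimately show "sqrt (R t) \<le> sqrt (R s) + integral {s..t} h + \<eta>" by linarith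
qed

text \<open>Reflecting the interval turns the lower bound on \<open>R'\<close> into an upper one.
  The result bounds the past by the future, which is what integration from infinity rests
  on.\<close>

lemma sqrt_growth_lower:
  fixes R R' h :: "real \<Rightarrow> real"
  assumes der: "\<And>x. x \<in> {s..t} \<Longrightarrow> (R has_real_derivative R' x) (at x within {s..t})"
    and nonneg: "\<And>x. x \<in> {s..t} \<Longrightarrow> 0 \<le> R x" "\<And>x. x \<in> {s..t} \<Longrightarrow> 0 \<le> h x"
    and le: "\<And>x. x \<in> {s..t} \<Longrightarrow> - R' x \<le> 2 * h x * sqrt (R x)"
    and cont: "continuous_on {s..t} h" and st: "s \<le> t"
  shows "sqrt (R s) \<le> sqrt (R t) + integral {s..t} h"
proof -
  let ?m = "\<lambda>x::real. s + t - x"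
  have im: "?m ` {s..t} = {s..t}"
    by (auto simp: image_iff intro!: bexI[of _ "?m _"])
  have "sqrt ((R \<circ> ?m) t) \<le> sqrt ((R \<circ> ?m) s) + integral {s..t} (h \<circ> ?m)"
  proof (rule sqrt_growth_upper[where R' = "\<lambda>x. R' (?m x) * (-1)"])
    fix x assume x: "x \<in> {s..t}"
    show "(R \<circ> ?m has_real_derivative R' (?m x) * (-1)) (at x within {s..t})"
      using x by (intro DERIV_image_chain) (auto simp: im intro!: der derivative_eq_intros)
    show "0 \<le> (R \<circ> ?m) x" "0 \<le> (h \<circ> ?m) x" "R' (?m x) * (-1) \<le> 2 * (h \<circ> ?m) x * sqrt ((R \<circ> ?m) x)"
      using x nonneg[of "?m x"] le[of "?m x"] by auto
  next
    show "continuous_on {s..t} (h \<circ> ?m)"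
      by (intro continuous_on_compose continuous_intros) (auto simp: im cont)
  qed (rule st)
  moreover have "integral {s..t} (h \<circ> ?m) = integral {s..t} h"
  proof -
    have "((\<lambda>x. h (-1 *\<^sub>R x + (s+t))) has_integral (1 / \<bar>-1::real\<bar> ^ DIM(real)) *\<^sub>R integral {s..t} h) ((\<lambda>x. (1 / (-1)) *\<^sub>R x + - ((1 / (-1)) *\<^sub>R (s+t))) ` cbox s t)"
      using cont st by (intro has_integral_affinity) (auto intro!: integrable_integral integrable_continuous_real)
    moreover have "(\<lambda>x. (1 / (-1)) *\<^sub>R x + - ((1 / (-1)) *\<^sub>R (s+t))) ` cbox s t = {s..t}"
      using im by (simp add: algebra_simps)
    ultimately show ?thesis
      by (intro integral_unique) (auto simp: o_def algebra_simps)
  qed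
  ultimately show ?thesis by (simp add: o_def)
qed

text \<open>A bootstrap without continuity: the supremum satisfies \<open>S \<le> c + S / 2\<close>.
  The bound \<open>B\<close> makes the supremum finite, so that it can be absorbed, and does not
  appear in the result.\<close>

lemma self_bound:
  fixes f :: "'b \<Rightarrow> real"
  assumes bdd: "\<And>t. t \<in> A \<Longrightarrow> f t \<le> B"
    and step: "\<And>S t. \<lbrakk>\<And>t. t \<in> A \<Longrightarrow> f t \<le> S; t \<in> A\<rbrakk> \<Longrightarrow> f t \<le> c + S / 2"
    and t: "t \<in> A"
  shows "f t \<le> 2 * c"
proof -
  define S where "S = Sup (f ` A)"
  have le: "f x \<le> S" if "x \<in> A" for x
    unfolding S_def using that bdd by (intro cSup_upper) (auto intro!: bdd_aboveI)
  have "S \<le> c + S / 2"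
    unfolding S_def using t step le by (intro cSup_least) (auto simp: S_def)
  then show ?thesis using le[OF t] by linarith
qed

text \<open>Adding the primitive \<open>M / \<kappa> * exp (- \<kappa> * t)\<close> to
  \<open>f\<close> gives a decreasing function and subtracting it an increasing one. The two enclose
  \<open>f\<close> and close up at the rate \<open>\<kappa>\<close>, so the infimum of the upper one
  is the limit.\<close>

lemma exp_rate_limit:
  fixes f f' :: "real \<Rightarrow> real"
  assumes der: "\<And>t. 0 \<le> t \<Longrightarrow> (f has_real_derivative f' t) (at t within {0..})"
    and le: "\<And>t. 0 \<le> t \<Longrightarrow> \<bar>f' t\<bar> \<le> M * exp (- \<kappa> * t)" and kappa: "0 < \<kappa>"
  shows "\<exists>\<alpha>. \<forall>t\<ge>0. \<bar>f t - \<alpha>\<bar> \<le> M / \<kappa> * exp (- \<kappa> * t)"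
proof -
  define hi lo where "hi t = f t + M / \<kappa> * exp (- \<kappa> * t)"
    and "lo t = - f t + M / \<kappa> * exp (- \<kappa> * t)" for t
  have M: "0 \<le> M" using le[of 0] by simp
  have hi: "hi t \<le> hi s" if "0 \<le> s" "s \<le> t" for s t
  proof (rule nonpos_derivative_imp_le[where f = hi and f' = "\<lambda>x. f' x - M * exp (- \<kappa> * x)"])
    fix x assume "x \<in> {s..t}"
    then have "0 \<le> x" "{s..t} \<subseteq> {0..}" using that by auto
    then show "(hi has_real_derivative f' x - M * exp (- \<kappa> * x)) (at x within {s..t})" "f' x - M * exp (- \<kappa> * x) \<le> 0"
      using le[of x] kappa unfolding hi_def
      by (auto intro!: derivative_eq_intros DERIV_subset[OF der])
  qed fact
  have lo: "lo t \<le> lo s" if "0 \<le> s" "s \<le> t" for s t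
  proof (rule nonpos_derivative_imp_le[where f = lo and f' = "\<lambda>x. - f' x - M * exp (- \<kappa> * x)"])
    fix x assume "x \<in> {s..t}"
    then have "0 \<le> x" "{s..t} \<subseteq> {0..}" using that by auto
    then show "(lo has_real_derivative - f' x - M * exp (- \<kappa> * x)) (at x within {s..t})" "- f' x - M * exp (- \<kappa> * x) \<le> 0"
      using le[of x] kappa unfolding lo_def
      by (auto intro!: derivative_eq_intros DERIV_subset[OF der])
  qed fact
  \<comment> \<open>The two times are unordered, so both are compared with the later one.\<close>
  have ge: "- lo s \<le> hi t" if "0 \<le> s" "0 \<le> t" for s t
  proof -
    have "- lo (max s t) \<le> hi (max s t)" using M kappa by (simp add: lo_def hi_def)
    then show ?thesis using hi[of t "max s t"] lo[of s "max s t"] that by simp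
  qed
  define \<alpha> where "\<alpha> = Inf (hi ` {0..})"
  have "\<bar>f t - \<alpha>\<bar> \<le> M / \<kappa> * exp (- \<kappa> * t)" if "0 \<le> t" for t
  proof -
    have "\<alpha> \<le> hi t" unfolding \<alpha>_def using that ge by (intro cInf_lower) (auto intro!: bdd_belowI[of _ "- lo 0"])
    moreover have "- lo t \<le> \<alpha>" unfolding \<alpha>_def using that ge by (intro cInf_greatest) auto
    ultimately show ?thesis by (auto simp: hi_def lo_def abs_le_iff)
  qed
  then show ?thesis by blast
qed

text \<open>The right end contributes only a nonpositive term, so the bound is uniform in
  \<open>t\<close> and survives \<open>t\<close> going to infinity.\<close>

lemma integral_exp_le:
  fixes G :: "real \<Rightarrow> real"
  assumes cont: "continuous_on {0..} G" and le: "\<And>t. 0 \<le> t \<Longrightarrow> G t \<le> M * exp (- c * t)"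
    and ac: "a < c" and st: "0 \<le> s" "s \<le> t" and M: "0 \<le> M"
  shows "integral {s..t} (\<lambda>\<tau>. exp (a * \<tau>) * G \<tau>) \<le> M / (c - a) * exp ((a - c) * s)"
proof -
  have eq: "- M / (c - a) * (z * (a - c)) = M * z" for z :: real
    using ac by (simp add: divide_simps) (simp add: algebra_simps)
  have i: "((\<lambda>\<tau>. M * exp ((a - c) * \<tau>)) has_integral
      (- M / (c - a) * exp ((a - c) * t)) - (- M / (c - a) * exp ((a - c) * s))) {s..t}"
  proof (intro fundamental_theorem_of_calculus[OF st(2)])
    fix x
    have "((\<lambda>\<tau>. - M / (c - a) * exp ((a - c) * \<tau>)) has_real_derivative
        - M / (c - a) * (exp ((a - c) * x) * (a - c))) (at x within {s..t})"
      by (rule derivative_eq_intros refl | simp)+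
    then show "((\<lambda>\<tau>. - M / (c - a) * exp ((a - c) * \<tau>)) has_vector_derivative M * exp ((a - c) * x)) (at x within {s..t})"
      unfolding eq by (simp add: has_real_derivative_iff_has_vector_derivative)
  qed
  have "integral {s..t} (\<lambda>\<tau>. exp (a * \<tau>) * G \<tau>) \<le> integral {s..t} (\<lambda>\<tau>. M * exp ((a - c) * \<tau>))"
  proof (rule integral_le)
    show "(\<lambda>\<tau>. exp (a * \<tau>) * G \<tau>) integrable_on {s..t}"
      using st by (intro integrable_continuous_real continuous_intros continuous_on_subset[OF cont]) auto
    show "(\<lambda>\<tau>. M * exp ((a - c) * \<tau>)) integrable_on {s..t}" using i by blast
    fix x assume "x \<in> {s..t}"
    then have "exp (a * x) * G x \<le> exp (a * x) * (M * exp (- c * x))"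
      using st le[of x] by (intro mult_left_mono) auto
    then show "exp (a * x) * G x \<le> M * exp ((a - c) * x)"
      by (simp add: algebra_simps exp_diff exp_minus field_simps)
  qed
  also have "\<dots> = M / (c - a) * exp ((a - c) * s) - M / (c - a) * exp ((a - c) * t)"
    using integral_unique[OF i] by linarith
  also have "\<dots> \<le> M / (c - a) * exp ((a - c) * s)" using ac M by simp
  finally show ?thesis .
qed

section \<open>The neutral component against the decaying ones\<close>

text \<open>The norm \<open>x\<close> of the component with exponent \<open>0\<close> against the norm \<open>Y\<close> of all the others.
  No regularity of \<open>x\<close> and \<open>Y\<close> is needed, since everything is
  compared at times a fixed step apart.\<close>

locale neutral_vs_decaying =
  fixes x Y G :: "real \<Rightarrow> real" and C b p q :: real
  assumes C: "1 \<le> C" and b: "0 < b" and p: "0 < p" and q: "0 < q"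
    and x_nonneg: "\<And>t. 0 \<le> t \<Longrightarrow> 0 \<le> x t" and Y_nonneg: "\<And>t. 0 \<le> t \<Longrightarrow> 0 \<le> Y t"
    and G_cont: "continuous_on {0..} G" and G_nonneg: "\<And>t. 0 \<le> t \<Longrightarrow> 0 \<le> G t"
    and x_var: "\<And>s t. \<lbrakk>0 \<le> s; s \<le> t\<rbrakk> \<Longrightarrow> \<bar>x t - x s\<bar> \<le> C * integral {s..t} G"
    and Y_dec: "\<And>s t. \<lbrakk>0 \<le> s; s \<le> t\<rbrakk> \<Longrightarrow> Y t \<le> C * (exp (- b * (t - s)) * Y s + integral {s..t} G)"
    and G_le: "\<And>t. 0 \<le> t \<Longrightarrow> G t \<le> C * ((x t + Y t) powr (1 + p) + Y t powr (1 + q))"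
    and x_lim: "(x \<longlongrightarrow> 0) at_top" and Y_lim: "(Y \<longlongrightarrow> 0) at_top"
begin

text \<open>The length of a comparison step: over it the contraction factor
  \<open>C * exp (- b * L)\<close> has dropped to 1/4, which leaves room for the forcing while
  \<open>Y\<close> still halves.\<close>

definition L :: real where "L = ln (4 * C) / b"

definition N :: "real \<Rightarrow> real" where "N t = x t + Y t"

lemma L_pos: "0 < L"
  using C b by (simp add: L_def)

lemma exp_L: "C * exp (- b * L) = 1 / 4"
  using C b by (simp add: L_def exp_minus)

lemma N_nonneg: "0 \<le> t \<Longrightarrow> 0 \<le> N t"
  using x_nonneg Y_nonneg by (simp add: N_def)

lemma integrable_G: "0 \<le> s \<Longrightarrow> G integrable_on {s..t}"
  by (rule integrable_continuous_real) (rule continuous_on_subset[OF G_cont], auto)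

lemma integral_G_nonneg: "0 \<le> s \<Longrightarrow> 0 \<le> integral {s..t} G"
  using G_nonneg by (intro integral_nonneg integrable_G) auto

lemma integral_G_mono: "\<lbrakk>0 \<le> s; t \<le> t'\<rbrakk> \<Longrightarrow> integral {s..t} G \<le> integral {s..t'} G"
  using G_nonneg by (intro integral_subset_le integrable_G) auto

lemma integral_G_le:
  assumes "0 \<le> s" "s \<le> t" "t \<le> s + L" "\<And>\<tau>. \<tau> \<in> {s..s+L} \<Longrightarrow> G \<tau> \<le> B"
  shows "integral {s..t} G \<le> L * B"
proof -
  have "integral {s..t} G \<le> integral {s..s+L} G" using assms by (intro integral_G_mono)
  also have "\<dots> \<le> integral {s..s+L} (\<lambda>_. B)"
    using assms by (intro integral_le integrable_G) auto
  also have "\<dots> = L * B" using L_pos by simp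
  finally show ?thesis .
qed

lemma Y_le: "\<lbrakk>0 \<le> s; s \<le> t\<rbrakk> \<Longrightarrow> Y t \<le> C * (Y s + integral {s..t} G)"
proof -
  assume st: "0 \<le> s" "s \<le> t"
  have "exp (- b * (t - s)) * Y s \<le> 1 * Y s"
    using st b Y_nonneg[of s] by (intro mult_right_mono) auto
  then have "C * (exp (- b * (t - s)) * Y s + integral {s..t} G) \<le> C * (Y s + integral {s..t} G)"
    using C by (intro mult_left_mono) auto
  then show "Y t \<le> C * (Y s + integral {s..t} G)" using Y_dec[OF st] by linarith
qed

lemma N_le: "\<lbrakk>0 \<le> s; s \<le> t\<rbrakk> \<Longrightarrow> N t \<le> C * N s + 2 * C * integral {s..t} G"
proof -
  assume st: "0 \<le> s" "s \<le> t"
  have "x s \<le> C * x s" using C x_nonneg[OF st(1)] by (simp add: mult_le_cancel_right1)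
  then show "N t \<le> C * N s + 2 * C * integral {s..t} G"
    using x_var[OF st] Y_le[OF st] by (simp add: N_def algebra_simps)
qed

lemma superlinear_small:
  assumes "0 < \<epsilon>"
  shows "\<exists>T\<ge>0. \<forall>t\<ge>T. Y t powr (1 + q) \<le> \<epsilon> * Y t \<and> G t \<le> \<epsilon> * N t"
proof -
  have ev: "eventually (\<lambda>t::real. 0 \<le> t) at_top" by (rule eventually_ge_at_top)
  have N: "(N \<longlongrightarrow> 0) at_top" unfolding N_def[abs_def] using tendsto_add[OF x_lim Y_lim] by simp
  have Np: "((\<lambda>t. N t powr p) \<longlongrightarrow> 0) at_top"
    by (rule tendsto_zero_powrI[OF N tendsto_const _ p]) (rule eventually_mono[OF ev N_nonneg])
  have Yq: "((\<lambda>t. Y t powr q) \<longlongrightarrow> 0) at_top"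
    by (rule tendsto_zero_powrI[OF Y_lim tendsto_const _ q]) (rule eventually_mono[OF ev Y_nonneg])
  \<comment> \<open>The first entry serves the bound on \<open>Y\<close>; the second pays for the
    factor \<open>C\<close> and for the two summands in \<open>G_le\<close>.\<close>
  define \<eta> where "\<eta> = min \<epsilon> (\<epsilon> / (2 * C))"
  have eta: "0 < \<eta>" using assms C by (simp add: \<eta>_def)
  have "eventually (\<lambda>t. 0 \<le> t \<and> N t powr p < \<eta> \<and> Y t powr q < \<eta>) at_top"
    using ev order_tendstoD(2)[OF Np eta] order_tendstoD(2)[OF Yq eta] by eventually_elim simp
  then obtain T where T: "\<And>t. T \<le> t \<Longrightarrow> 0 \<le> t \<and> N t powr p < \<eta> \<and> Y t powr q < \<eta>"
    by (auto simp: eventually_at_top_linorder)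
  have "Y t powr (1 + q) \<le> \<epsilon> * Y t \<and> G t \<le> \<epsilon> * N t" if "T \<le> t" for t
  proof
    note t = T[OF that]
    have Y0: "0 \<le> Y t" "Y t \<le> N t" using t Y_nonneg x_nonneg by (auto simp: N_def)
    have Y: "Y t powr (1 + q) \<le> \<eta> * Y t"
      using t Y0 mult_left_mono[of "Y t powr q" \<eta> "Y t"] by (simp add: powr_mult_base[symmetric] mult.commute)
    show "Y t powr (1 + q) \<le> \<epsilon> * Y t"
      using Y mult_right_mono[of \<eta> \<epsilon> "Y t"] Y0 by (simp add: \<eta>_def)
    have N: "N t powr (1 + p) \<le> \<eta> * N t"
      using t Y0 mult_left_mono[of "N t powr p" \<eta> "N t"] by (simp add: powr_mult_base[symmetric] mult.commute)
    have "\<eta> * Y t \<le> \<eta> * N t" using Y0 eta by simp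
    then have "N t powr (1 + p) + Y t powr (1 + q) \<le> 2 * \<eta> * N t" using N Y by linarith
    then have "C * (N t powr (1 + p) + Y t powr (1 + q)) \<le> C * (2 * \<eta> * N t)"
      using C by (intro mult_left_mono) auto
    also have "\<dots> = (2 * C * \<eta>) * N t" by simp
    also have "\<dots> \<le> \<epsilon> * N t"
    proof (rule mult_right_mono)
      have "2 * C * \<eta> \<le> 2 * C * (\<epsilon> / (2 * C))" using C by (intro mult_left_mono) (auto simp: \<eta>_def)
      then show "2 * C * \<eta> \<le> \<epsilon>" using C by simp
    qed (use t N_nonneg in auto)
    finally show "G t \<le> \<epsilon> * N t" using G_le[of t] t by (simp add: N_def)
  qed
  then show ?thesis by (intro exI[of _ "max T 0"]) auto
qed

text \<open>Over a step of fixed length the superlinear forcing is a small perturbation: the linear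
  behaviour, in which \<open>Y\<close> contracts and \<open>x\<close> stands still, survives up to
  an error \<open>\<kappa> * N s\<close>.\<close>

lemma one_step:
  assumes "0 < \<kappa>"
  shows "\<exists>T\<ge>0. \<forall>s\<ge>T. Y (s + L) \<le> Y s / 4 + \<kappa> * N s \<and>
     (\<forall>t\<in>{s..s+L}. N t \<le> 2 * C * N s \<and> \<bar>x t - x s\<bar> \<le> \<kappa> * N s)"
proof -
  \<comment> \<open>The first entry closes the bootstrap for \<open>N\<close> on the step; the
    second makes the accumulated forcing at most \<open>\<kappa> * N s\<close> once \<open>N\<close>
    is known to be at most \<open>2 * C * N s\<close>.\<close>
  define \<epsilon> where "\<epsilon> = min (1 / (4 * C * L)) (\<kappa> / (2 * C * C * L))"
  have CL: "0 < C * L" "0 < C" using C L_pos by auto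
  have eps: "0 < \<epsilon>" using assms CL L_pos by (simp add: \<epsilon>_def)
  have e1: "4 * C * L * \<epsilon> \<le> 1"
  proof -
    have "4 * C * L * \<epsilon> \<le> 4 * C * L * (1 / (4 * C * L))" using CL by (intro mult_left_mono) (auto simp: \<epsilon>_def)
    then show ?thesis using CL L_pos by simp
  qed
  have e2: "2 * C * C * L * \<epsilon> \<le> \<kappa>"
  proof -
    have "2 * C * C * L * \<epsilon> \<le> 2 * C * C * L * (\<kappa> / (2 * C * C * L))" using CL L_pos by (intro mult_left_mono) (auto simp: \<epsilon>_def)
    then show ?thesis using CL L_pos by simp
  qed
  obtain T where T: "0 \<le> T" "\<And>t. T \<le> t \<Longrightarrow> G t \<le> \<epsilon> * N t"
    using superlinear_small[OF eps] by blast
  have *: "Y (s + L) \<le> Y s / 4 + \<kappa> * N s \<and>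
     (\<forall>t\<in>{s..s+L}. N t \<le> 2 * C * N s \<and> \<bar>x t - x s\<bar> \<le> \<kappa> * N s)" if sT: "T \<le> s" for s
  proof -
    have s: "0 \<le> s" using sT T by simp
    have I: "integral {s..t} G \<le> L * (\<epsilon> * S)"
      if "\<And>t. t \<in> {s..s+L} \<Longrightarrow> N t \<le> S" "t \<in> {s..s+L}" for S t
    proof (rule integral_G_le)
      fix \<tau> assume t: "\<tau> \<in> {s..s+L}"
      have "\<epsilon> * N \<tau> \<le> \<epsilon> * S" using that(1)[OF t] eps by simp
      then show "G \<tau> \<le> \<epsilon> * S" using T(2)[of \<tau>] t sT by simp
    qed (use that s in auto)
    \<comment> \<open>The finite bound that \<open>self_bound\<close> requires comes from
      integrating the continuous \<open>G\<close> over the whole step; the quantitative one then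
      comes from \<open>G \<le> \<epsilon> * N\<close>.\<close>
    have N: "N t \<le> 2 * (C * N s)" if "t \<in> {s..s+L}" for t
    proof (rule self_bound[OF _ _ that])
      show "N \<tau> \<le> C * N s + 2 * C * integral {s..s+L} G" if "\<tau> \<in> {s..s+L}" for \<tau>
      proof -
        have "C * integral {s..\<tau>} G \<le> C * integral {s..s+L} G"
          using that s C by (intro mult_left_mono integral_G_mono) auto
        then show ?thesis using N_le[of s \<tau>] s that by simp
      qed
      show "N \<tau> \<le> C * N s + S / 2" if S: "\<And>t. t \<in> {s..s+L} \<Longrightarrow> N t \<le> S" and t: "\<tau> \<in> {s..s+L}" for S \<tau>
      proof -
        have "0 \<le> S" using S[of s] N_nonneg[of s] s L_pos by simp
        then have "2 * C * L * \<epsilon> * S \<le> 1/2 * S" using e1 by (intro mult_right_mono) auto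
        moreover have "2 * C * integral {s..\<tau>} G \<le> 2 * C * (L * (\<epsilon> * S))"
          using I[OF S t] C by (intro mult_left_mono) auto
        ultimately show ?thesis using N_le[of s \<tau>] s t by (simp add: mult.assoc)
      qed
    qed
    have CI: "C * integral {s..t} G \<le> \<kappa> * N s" if "t \<in> {s..s+L}" for t
    proof -
      have "C * integral {s..t} G \<le> C * (L * (\<epsilon> * (2 * (C * N s))))"
        using I[OF N that] C by (intro mult_left_mono) auto
      also have "\<dots> = (2 * C * C * L * \<epsilon>) * N s" by simp
      also have "\<dots> \<le> \<kappa> * N s" using e2 N_nonneg[OF s] by (intro mult_right_mono)
      finally show ?thesis .
    qed
    have "Y (s + L) \<le> C * (exp (- b * L) * Y s + integral {s..s+L} G)"
      using Y_dec[of s "s + L"] s L_pos by simp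
    also have "\<dots> = (C * exp (- b * L)) * Y s + C * integral {s..s+L} G" by (simp add: algebra_simps)
    also have "\<dots> \<le> Y s / 4 + \<kappa> * N s" using CI[of "s+L"] L_pos unfolding exp_L by simp
    finally have "Y (s + L) \<le> Y s / 4 + \<kappa> * N s" .
    moreover have "\<bar>x t - x s\<bar> \<le> \<kappa> * N s" if "t \<in> {s..s+L}" for t
      using x_var[of s t] CI[OF that] that s by simp
    ultimately show ?thesis using N by (simp add: mult.assoc)
  qed
  then show ?thesis using T(1) by blast
qed

lemma step_index:
  assumes "s \<le> t"
  shows "\<exists>n. t \<in> {s + real n * L .. s + real n * L + L} \<and> real n \<le> (t - s) / L"
proof -
  define n where "n = nat \<lfloor>(t - s) / L\<rfloor>"
  have nn: "0 \<le> (t - s) / L" using assms L_pos by simp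
  then have "real n \<le> (t - s) / L" "(t - s) / L < real n + 1"
    unfolding n_def by linarith+
  then show ?thesis using L_pos by (intro exI[of _ n]) (simp add: field_simps)
qed

text \<open>Halving once per step is exponential decay at the rate \<open>ln 2 / L\<close>. Inside a
  step, \<open>N\<close> is controlled by the value of \<open>Y\<close> at the left end.\<close>

lemma exp_decay_outside_cone:
  assumes T: "0 \<le> T" and half: "\<And>s. T \<le> s \<Longrightarrow> Y (s + L) \<le> Y s / 2"
    and le: "\<And>s t. \<lbrakk>T \<le> s; t \<in> {s..s+L}\<rbrakk> \<Longrightarrow> N t \<le> A * Y s" and A: "0 \<le> A"
  shows "\<exists>\<gamma>>0. \<exists>M. \<forall>t\<ge>0. N t \<le> M * exp (- \<gamma> * t)"
proof -
  define \<gamma> where "\<gamma> = ln 2 / L"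
  have g: "0 < \<gamma>" using L_pos by (simp add: \<gamma>_def)
  have seq: "Y (T + real n * L) \<le> Y T * exp (- \<gamma> * (real n * L))" for n
  proof (induction n)
    case (Suc n)
    have "Y (T + real n * L + L) \<le> Y (T + real n * L) / 2" using half[of "T + real n * L"] L_pos by simp
    also have "\<dots> \<le> Y T * exp (- \<gamma> * (real n * L)) / 2" using Suc by simp
    also have "\<dots> = Y T * exp (- \<gamma> * (real n * L)) * exp (- \<gamma> * L)"
      using L_pos by (simp add: \<gamma>_def exp_minus)
    also have "\<dots> = Y T * exp (- \<gamma> * (real (Suc n) * L))" by (simp add: algebra_simps flip: exp_add)
    finally show ?case by (simp add: algebra_simps)
  qed simp
  \<comment> \<open>A crude bound for \<open>N\<close> on \<open>{0..T}\<close>, where nothing is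
    known about halving.\<close>
  define B where "B = C * N 0 + 2 * C * integral {0..T} G"
  have B0: "0 \<le> B" using C N_nonneg[of 0] integral_G_nonneg[of 0 T] by (simp add: B_def)
  have BT: "0 \<le> A * Y T * exp (\<gamma> * (T + L))" using A Y_nonneg[OF T] by simp
  have "N t \<le> (B * exp (\<gamma> * T) + A * Y T * exp (\<gamma> * (T + L))) * exp (- \<gamma> * t)" if t: "0 \<le> t" for t
  proof (cases "t \<le> T")
    case True
    have "integral {0..t} G \<le> integral {0..T} G" using True by (intro integral_G_mono) auto
    then have "C * integral {0..t} G \<le> C * integral {0..T} G" using C by (intro mult_left_mono) auto
    then have "N t \<le> B * 1" using N_le[of 0 t] t by (simp add: B_def)
    also have "\<dots> \<le> B * (exp (\<gamma> * T) * exp (- \<gamma> * t))"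
      using B0 True g by (intro mult_left_mono) (auto simp flip: exp_add)
    also have "\<dots> \<le> (B * exp (\<gamma> * T) + A * Y T * exp (\<gamma> * (T + L))) * exp (- \<gamma> * t)"
      using mult_nonneg_nonneg[OF BT, of "exp (- \<gamma> * t)"] by (simp add: algebra_simps)
    finally show ?thesis .
  next
    case False
    obtain n where n: "t \<in> {T + real n * L .. T + real n * L + L}" using step_index[of T t] False by auto
    have "N t \<le> A * Y (T + real n * L)" using n L_pos by (intro le) auto
    also have "\<dots> \<le> A * (Y T * exp (- \<gamma> * (real n * L)))" using A seq by (intro mult_left_mono)
    also have "\<dots> \<le> A * (Y T * (exp (\<gamma> * (T + L)) * exp (- \<gamma> * t)))"
    proof (intro mult_left_mono A Y_nonneg T)
      have "\<gamma> * t \<le> \<gamma> * (T + real n * L + L)" using n g by (intro mult_left_mono) auto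
      then show "exp (- \<gamma> * (real n * L)) \<le> exp (\<gamma> * (T + L)) * exp (- \<gamma> * t)"
        by (simp add: algebra_simps flip: exp_add)
    qed
    also have "\<dots> \<le> (B * exp (\<gamma> * T) + A * Y T * exp (\<gamma> * (T + L))) * exp (- \<gamma> * t)"
      using B0 by (simp add: algebra_simps)
    finally show ?thesis .
  qed
  then show ?thesis using g by blast
qed

text \<open>Where \<open>x\<close> dominates, \<open>N\<close> is at most a multiple of
  \<open>x s\<close>. The forcing then splits into the constant \<open>P\<close>, of the order of
  \<open>x s powr (1 + p)\<close>, and a small multiple of \<open>Y\<close> that can be absorbed.
  All bounds are thus in terms of \<open>Y s\<close> and \<open>P\<close> with no linear term in
  \<open>x s\<close>, as slaving \<open>Y\<close> to \<open>x powr (1 + p)\<close> requires.\<close>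

lemma interval_bounds:
  assumes s: "0 \<le> s" and eps: "0 < \<epsilon>" "16 * C * C * C * L * \<epsilon> \<le> 1"
    and small: "\<And>t. t \<in> {s..s+L} \<Longrightarrow> Y t powr (1 + q) \<le> \<epsilon> * Y t"
    and N: "\<And>t. t \<in> {s..s+L} \<Longrightarrow> N t \<le> 4 * C * x s"
  defines "P \<equiv> C * (4 * C) powr (1 + p) * x s powr (1 + p)"
  shows "Y (s + L) \<le> 3 / 8 * Y s + 2 * C * L * P"
    and "t \<in> {s..s+L} \<Longrightarrow> Y t \<le> 2 * (C * (Y s + L * P))"
    and "t \<in> {s..s+L} \<Longrightarrow> integral {s..t} G \<le> 2 * L * P + Y s"
proof -
  have P: "0 \<le> P" "0 \<le> Y s" using C s Y_nonneg by (auto simp: P_def)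
  have G: "G t \<le> P + C * \<epsilon> * Y t" if t: "t \<in> {s..s+L}" for t
  proof -
    have t0: "0 \<le> t" using t s by simp
    have "N t powr (1 + p) \<le> (4 * C * x s) powr (1 + p)"
      using N[OF t] N_nonneg[OF t0] p by (intro powr_mono2) auto
    also have "\<dots> = (4 * C) powr (1 + p) * x s powr (1 + p)"
      using C x_nonneg[OF s] by (simp add: powr_mult)
    finally have "N t powr (1 + p) + Y t powr (1 + q) \<le> (4 * C) powr (1 + p) * x s powr (1 + p) + \<epsilon> * Y t"
      using small[OF t] by linarith
    then have "C * (N t powr (1 + p) + Y t powr (1 + q)) \<le> C * ((4 * C) powr (1 + p) * x s powr (1 + p) + \<epsilon> * Y t)"
      using C by (intro mult_left_mono) auto
    then show ?thesis using G_le[OF t0] by (simp add: P_def N_def algebra_simps)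
  qed
  have I: "integral {s..t} G \<le> L * (P + C * \<epsilon> * S)"
    if S: "\<And>t. t \<in> {s..s+L} \<Longrightarrow> Y t \<le> S" and t: "t \<in> {s..s+L}" for S t
  proof (rule integral_G_le)
    fix \<tau> assume \<tau>: "\<tau> \<in> {s..s+L}"
    have "C * \<epsilon> * Y \<tau> \<le> C * \<epsilon> * S" using S[OF \<tau>] C eps by (intro mult_left_mono) auto
    then show "G \<tau> \<le> P + C * \<epsilon> * S" using G[OF \<tau>] by linarith
  qed (use t s in auto)
  have CL: "C * C * L * \<epsilon> \<le> 1 / 2" "0 \<le> C * C * L * \<epsilon>"
  proof -
    show "0 \<le> C * C * L * \<epsilon>" using C L_pos eps by simp
    then have "1 * (C * C * L * \<epsilon>) \<le> C * (C * C * L * \<epsilon>)" using C by (intro mult_right_mono) auto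
    then show "C * C * L * \<epsilon> \<le> 1 / 2" using eps by simp
  qed
  have Y: "Y t \<le> 2 * (C * (Y s + L * P))" if "t \<in> {s..s+L}" for t
  proof (rule self_bound[OF _ _ that])
    show "Y \<tau> \<le> 4 * C * x s" if "\<tau> \<in> {s..s+L}" for \<tau>
      using N[OF that] x_nonneg[of \<tau>] that s by (simp add: N_def)
    show "Y \<tau> \<le> C * (Y s + L * P) + S / 2"
      if S: "\<And>t. t \<in> {s..s+L} \<Longrightarrow> Y t \<le> S" and t: "\<tau> \<in> {s..s+L}" for S \<tau>
    proof -
      have "0 \<le> S" using S[of s] P L_pos by simp
      then have "(C * C * L * \<epsilon>) * S \<le> 1 / 2 * S" using CL by (intro mult_right_mono)
      moreover have "C * integral {s..\<tau>} G \<le> C * (L * (P + C * \<epsilon> * S))"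
        using I[OF S t] C by (intro mult_left_mono) auto
      ultimately show ?thesis using Y_le[of s \<tau>] s t by (simp add: algebra_simps)
    qed
  qed
  then show "t \<in> {s..s+L} \<Longrightarrow> Y t \<le> 2 * (C * (Y s + L * P))" .
  have YP: "0 \<le> Y s + L * P" using P L_pos by simp
  \<comment> \<open>The smallness of \<open>\<epsilon>\<close> is tuned to the factor 1/8, so that
    the contraction over a step becomes 1/4 + 1/8 = 3/8.\<close>
  have CI: "C * integral {s..t} G \<le> C * L * P + (Y s + L * P) / 8" if "t \<in> {s..s+L}" for t
  proof -
    have "C * integral {s..t} G \<le> C * (L * (P + C * \<epsilon> * (2 * (C * (Y s + L * P)))))"
      using I[OF Y that] C by (intro mult_left_mono) auto
    also have "\<dots> = C * L * P + (16 * C * C * C * L * \<epsilon>) * ((Y s + L * P) / 8)" by (simp add: algebra_simps)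
    also have "\<dots> \<le> C * L * P + 1 * ((Y s + L * P) / 8)"
      using eps YP by (intro add_left_mono mult_right_mono) auto
    finally show ?thesis by simp
  qed
  have LP: "L * P \<le> C * L * P" using mult_right_mono[of 1 C "L * P"] C P L_pos by (simp add: mult.assoc)
  have "Y (s + L) \<le> C * (exp (- b * L) * Y s + integral {s..s+L} G)"
    using Y_dec[of s "s + L"] s L_pos by simp
  also have "\<dots> = (C * exp (- b * L)) * Y s + C * integral {s..s+L} G" by (simp add: algebra_simps)
  also have "\<dots> \<le> Y s / 4 + (C * L * P + (Y s + L * P) / 8)" using CI[of "s+L"] L_pos unfolding exp_L by simp
  also have "\<dots> \<le> 3 / 8 * Y s + 2 * C * L * P" using LP P L_pos by (simp add: add_divide_distrib)
  finally show "Y (s + L) \<le> 3 / 8 * Y s + 2 * C * L * P" .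
  show "integral {s..t} G \<le> 2 * L * P + Y s" if t: "t \<in> {s..s+L}"
  proof -
    have "C * \<epsilon> * (2 * (C * (Y s + L * P))) * L = (2 * (C * C * L * \<epsilon>)) * (Y s + L * P)" by (simp add: algebra_simps)
    also have "\<dots> \<le> 1 * (Y s + L * P)" using CL YP by (intro mult_right_mono) auto
    finally show ?thesis using I[OF Y t] by (simp add: algebra_simps)
  qed
qed

text \<open>Discrete counterpart of the fact that \<open>x' \<ge> - c * x powr (1 + p)\<close> makes
  the derivative of \<open>x powr (- p)\<close> at most \<open>p * c\<close>.\<close>

lemma inverse_power_growth:
  assumes X: "0 < X" and c: "0 \<le> c" and X': "X / 2 \<le> X'" "X - c * X powr (1 + p) \<le> X'"
  shows "X' powr (- p) \<le> X powr (- p) + 2 * p * exp p * c"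
proof -
  \<comment> \<open>The relative loss in the step. It may be capped at 1/2 because \<open>X'\<close>
    is at least \<open>X / 2\<close>; the cap gives \<open>- ln (1 - w) \<le> 2 * w\<close>.\<close>
  define w where "w = min (c * X powr p) (1 / 2)"
  have w: "0 \<le> w" "w \<le> 1 / 2" "w \<le> c * X powr p" using c by (auto simp: w_def)
  have "X * (1 - w) \<le> X'"
    using X' X by (simp add: w_def min_def algebra_simps flip: powr_mult_base)
  then have "X' powr (- p) \<le> (X * (1 - w)) powr (- p)"
    using X w p by (intro powr_mono2') auto
  also have "\<dots> = X powr (- p) * (1 - w) powr (- p)" using X w by (simp add: powr_mult)
  also have "\<dots> \<le> X powr (- p) * (1 + 2 * p * exp p * w)"
  proof (rule mult_left_mono)
    have "- ln (1 - w) = ln (1 + w / (1 - w))"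
    proof -
      have "1 + w / (1 - w) = 1 / (1 - w)" using w by (simp add: field_simps)
      then show ?thesis using w by (simp add: ln_div)
    qed
    also have "\<dots> \<le> w / (1 - w)" using w by (intro ln_add_one_self_le_self) auto
    also have "\<dots> \<le> 2 * w"
    proof -
      have "w * (2 * w) \<le> w * 1" using w by (intro mult_left_mono) auto
      then show ?thesis using w by (simp add: field_simps)
    qed
    finally have l: "- ln (1 - w) \<le> 2 * w" .
    have "(1 - w) powr (- p) = exp (p * (- ln (1 - w)))" using w by (simp add: powr_def)
    also have "\<dots> \<le> exp (p * (2 * w))" using mult_left_mono[OF l, of p] p by simp
    also have "\<dots> \<le> 1 + (p * (2 * w)) * exp p"
    proof -
      let ?v = "p * (2 * w)"
      have v: "0 \<le> ?v" "?v \<le> p" using w p by (auto simp: mult_left_le)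
      have "1 - ?v \<le> exp (- ?v)" using exp_ge_add_one_self[of "- ?v"] by simp
      then have "exp ?v * (1 - ?v) \<le> exp ?v * exp (- ?v)" by (intro mult_left_mono) auto
      then have "exp ?v \<le> 1 + ?v * exp ?v" by (simp add: exp_minus algebra_simps)
      also have "\<dots> \<le> 1 + ?v * exp p" using v by (intro add_left_mono mult_left_mono) auto
      finally show ?thesis .
    qed
    finally show "(1 - w) powr (- p) \<le> 1 + 2 * p * exp p * w" by (simp add: algebra_simps)
  qed simp
  also have "\<dots> = X powr (- p) + 2 * p * exp p * (X powr (- p) * w)" by (simp add: algebra_simps)
  also have "\<dots> \<le> X powr (- p) + 2 * p * exp p * c"
  proof -
    have "X powr (- p) * w \<le> X powr (- p) * (c * X powr p)" using w by (intro mult_left_mono) auto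
    also have "\<dots> = c" using X by (simp add: powr_minus field_simps)
    finally show ?thesis using p by (intro add_left_mono mult_left_mono) auto
  qed
  finally show ?thesis .
qed

text \<open>The threshold is the cone \<open>Y \<le> x\<close> with \<open>x\<close> positive. Its
  invariance is proved only along times \<open>L\<close> apart; the bounds valid inside a step fill
  the gaps.\<close>

lemma slow_or_exp_decay:
  "(\<exists>\<gamma>>0. \<exists>M. \<forall>t\<ge>0. N t \<le> M * exp (- \<gamma> * t)) \<or>
   (\<exists>T\<ge>0. \<exists>M>0. \<exists>c>0. \<forall>t\<ge>T. c / (1 + t) powr (1 / p) \<le> x t \<and> Y t \<le> M * x t powr (1 + p))"
proof -
  \<comment> \<open>If \<open>x\<close> shrinks at most by the ratio \<open>h\<close> in a step,
    then \<open>x powr (1 + p)\<close> loses at most a factor 2. The bound 1/16 on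
    \<open>\<kappa>\<close> gives halving of \<open>Y\<close> outside the cone and invariance inside
    it.\<close>
  define h where "h = (1 / 2 :: real) powr (1 / (1 + p))"
  define \<kappa> where "\<kappa> = min (1 / 16) ((1 - h) / 2)"
  define \<epsilon> where "\<epsilon> = 1 / (16 * C * C * C * L)"
  have half: "h < 1" using p powr_less_mono2[of "1 / (1 + p)" "1/2" 1] by (simp add: h_def)
  have kap: "0 < \<kappa>" "\<kappa> \<le> 1 / 16" "h \<le> 1 - 2 * \<kappa>"
    using half by (auto simp: \<kappa>_def min_def field_simps)
  have kap': "1 / 2 \<le> (1 - 2 * \<kappa>) powr (1 + p)"
  proof -
    have "h powr (1 + p) \<le> (1 - 2 * \<kappa>) powr (1 + p)"
      using kap p by (intro powr_mono2) (auto simp: h_def)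
    then show ?thesis using p by (simp add: powr_powr h_def)
  qed
  have eps: "0 < \<epsilon>" "16 * C * C * C * L * \<epsilon> \<le> 1" using C L_pos by (auto simp: \<epsilon>_def)
  obtain T1 where T1: "0 \<le> T1" "\<And>s. T1 \<le> s \<Longrightarrow> Y (s + L) \<le> Y s / 4 + \<kappa> * N s"
    "\<And>s t. \<lbrakk>T1 \<le> s; t \<in> {s..s+L}\<rbrakk> \<Longrightarrow> N t \<le> 2 * C * N s"
    "\<And>s t. \<lbrakk>T1 \<le> s; t \<in> {s..s+L}\<rbrakk> \<Longrightarrow> \<bar>x t - x s\<bar> \<le> \<kappa> * N s"
    using one_step[OF kap(1)] by blast
  obtain T2 where T2: "0 \<le> T2" "\<And>t. T2 \<le> t \<Longrightarrow> Y t powr (1 + q) \<le> \<epsilon> * Y t"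
    using superlinear_small[OF eps(1)] by blast
  define T where "T = max T1 T2"
  have T: "0 \<le> T" "T1 \<le> T" "T2 \<le> T" using T1 by (auto simp: T_def)
  show ?thesis
  proof (cases "\<exists>s\<ge>T. 0 < x s \<and> Y s \<le> x s")
    \<comment> \<open>Outside the cone either \<open>x\<close> vanishes or \<open>Y\<close> exceeds
      it; in both cases \<open>N \<le> 2 * Y\<close>.\<close>
    case False
    have NY: "N s \<le> 2 * Y s" if "T \<le> s" for s
    proof -
      have "\<not> (0 < x s \<and> Y s \<le> x s)" using False that by blast
      then show ?thesis using that x_nonneg[of s] Y_nonneg[of s] T unfolding N_def by linarith
    qed
    have "\<exists>\<gamma>>0. \<exists>M. \<forall>t\<ge>0. N t \<le> M * exp (- \<gamma> * t)"
    proof (rule exp_decay_outside_cone[OF T(1)])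
      fix s assume s: "T \<le> s"
      have "\<kappa> * N s \<le> 1 / 16 * (2 * Y s)" using NY[OF s] kap N_nonneg[of s] s T by (intro mult_mono) auto
      then show "Y (s + L) \<le> Y s / 2" using T1(2)[of s] s T Y_nonneg[of s] by auto
      fix t assume t: "t \<in> {s..s+L}"
      have "2 * C * N s \<le> 2 * C * (2 * Y s)" using NY[OF s] C by (intro mult_left_mono) auto
      then show "N t \<le> 4 * C * Y s" using T1(3)[of s t] s t T by auto
    qed (use C in auto)
    then show ?thesis ..
  next
    case True
    then obtain s0 where s0: "T \<le> s0" "0 < x s0" "Y s0 \<le> x s0" by blast
    define z where "z n = s0 + real n * L" for n
    have zS: "z (Suc n) = z n + L" for n by (simp add: z_def algebra_simps)
    have zT: "T \<le> z n" "T1 \<le> z n" "0 \<le> z n" for n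
    proof -
      have "s0 \<le> z n" using L_pos by (simp add: z_def)
      then show "T \<le> z n" "T1 \<le> z n" "0 \<le> z n" using s0 T by linarith+
    qed
    have near: "\<bar>x t - x s\<bar> \<le> 2 * \<kappa> * x s" if "T1 \<le> s" "Y s \<le> x s" "t \<in> {s..s+L}" for s t
    proof -
      have "\<kappa> * N s \<le> \<kappa> * (2 * x s)" using that kap by (intro mult_left_mono) (auto simp: N_def)
      then show ?thesis using T1(4)[OF that(1,3)] by simp
    qed
    have near8: "\<bar>x t - x s\<bar> \<le> x s / 8" if "T1 \<le> s" "Y s \<le> x s" "t \<in> {s..s+L}" "0 < x s" for s t
    proof -
      have "2 * \<kappa> * x s \<le> 1 / 8 * x s" using kap that by (intro mult_right_mono) auto
      then show ?thesis using near[OF that(1-3)] by linarith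
    qed
    \<comment> \<open>In one step \<open>Y\<close> falls to at most 3/8 of \<open>x (z n)\<close>,
      while \<open>x\<close> keeps at least 7/8 of it.\<close>
    have cone: "0 < x (z n) \<and> Y (z n) \<le> x (z n)" for n
    proof (induction n)
      case (Suc n)
      have Nn: "N (z n) \<le> 2 * x (z n)" using Suc by (simp add: N_def)
      have "\<kappa> * N (z n) \<le> 1/16 * (2 * x (z n))" using Nn kap N_nonneg[of "z n"] zT[of n] by (intro mult_mono) auto
      then show ?case
        using near8[of "z n" "z n + L"] Suc zT[of n] L_pos T1(2)[of "z n"] unfolding zS abs_le_iff by auto
    qed (use s0 in \<open>auto simp: z_def\<close>)
    have Nle: "N t \<le> 4 * C * x (z n)" if "t \<in> {z n..z n + L}" for n t
    proof -
      have "2 * C * N (z n) \<le> 2 * C * (2 * x (z n))" using cone[of n] C by (intro mult_left_mono) (auto simp: N_def)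
      then show ?thesis using T1(3)[of "z n" t] zT[of n] that by auto
    qed
    have xlow: "(1 - 2 * \<kappa>) * x (z n) \<le> x t" "x (z n) / 2 \<le> x t" if "t \<in> {z n..z n + L}" for n t
      using near[of "z n" t] near8[of "z n" t] cone[of n] zT[of n] that
      unfolding abs_le_iff by (auto simp: algebra_simps)
    define C1 where "C1 = C * (4 * C) powr (1 + p)"
    have C1: "0 < C1" using C by (simp add: C1_def)
    define X where "X n = x (z n) powr (1 + p)" for n
    have X: "0 < X n" for n using cone[of n] by (simp add: X_def)
    have small: "Y t powr (1 + q) \<le> \<epsilon> * Y t" if "t \<in> {z n..z n + L}" for n t
      using T2(2)[of t] that zT[of n] T by auto
    have ib1: "Y (z n + L) \<le> 3 / 8 * Y (z n) + 2 * C * L * (C1 * X n)" for n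
      using interval_bounds(1)[OF zT(3) eps small Nle, of n] by (simp add: C1_def X_def)
    have ib2: "Y t \<le> 2 * (C * (Y (z n) + L * (C1 * X n)))" if "t \<in> {z n..z n + L}" for n t
      using interval_bounds(2)[OF zT(3) eps small Nle that] by (simp add: C1_def X_def)
    have ib3: "integral {z n..t} G \<le> 2 * L * (C1 * X n) + Y (z n)" if "t \<in> {z n..z n + L}" for n t
      using interval_bounds(3)[OF zT(3) eps small Nle that] by (simp add: C1_def X_def)
    \<comment> \<open>The first summand starts the induction for \<open>YM\<close> at
      \<open>z 0 = s0\<close>. The second makes \<open>2 * C * L * C1\<close> at most
      \<open>M / 8\<close>, and 3/8 + 1/8 = 1/2 is the factor that \<open>X\<close> may lose in a
      step.\<close>
    define M where "M = Y s0 / X 0 + 16 * C * L * C1"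
    have M: "0 < M" "16 * C * L * C1 \<le> M" "Y s0 / X 0 \<le> M"
      using C L_pos C1 X[of 0] Y_nonneg[of s0] s0 T by (auto simp: M_def intro!: add_nonneg_pos)
    have XS: "X n / 2 \<le> X (Suc n)" for n
    proof -
      have "X n / 2 \<le> (1 - 2 * \<kappa>) powr (1 + p) * X n" using kap' X[of n] by simp
      also have "\<dots> = ((1 - 2 * \<kappa>) * x (z n)) powr (1 + p)" using kap cone[of n] by (simp add: X_def powr_mult)
      also have "\<dots> \<le> X (Suc n)" unfolding X_def zS
        using kap cone[of n] p xlow(1)[of "z n + L" n] L_pos by (intro powr_mono2) auto
      finally show ?thesis .
    qed
    have YM: "Y (z n) \<le> M * X n" for n
    proof (induction n)
      case 0
      show ?case using M(3) X[of 0] by (simp add: z_def field_simps)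
    next
      case (Suc n)
      have "(16 * C * L * C1) * X n \<le> M * X n" using M X[of n] by (intro mult_right_mono) auto
      then have "Y (z (Suc n)) \<le> M * (X n / 2)" using ib1[of n] Suc by (simp add: zS)
      also have "\<dots> \<le> M * X (Suc n)" using XS M by (intro mult_left_mono) auto
      finally show ?case .
    qed
    \<comment> \<open>The power of 2 converts \<open>x (z n)\<close> into \<open>x t\<close>, since
      \<open>x (z n) \<le> 2 * x t\<close> inside the step.\<close>
    define M' where "M' = 2 * C * (M + L * C1) * 2 powr (1 + p)"
    have M': "0 < M'" using M C L_pos C1 by (simp add: M'_def add_pos_pos)
    have Yt: "Y t \<le> M' * x t powr (1 + p)" if t: "t \<in> {z n..z n + L}" for n t
    proof -
      have "Y t \<le> 2 * (C * (M * X n + L * (C1 * X n)))"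
        using ib2[OF t] YM[of n] C by (smt (verit, best) mult_left_mono)
      also have "\<dots> = 2 * C * (M + L * C1) * X n" by (simp add: algebra_simps)
      also have "\<dots> \<le> 2 * C * (M + L * C1) * (2 * x t) powr (1 + p)"
        unfolding X_def using xlow(2)[OF t] cone[of n] p C M L_pos C1
        by (intro mult_left_mono powr_mono2) auto
      also have "\<dots> = M' * x t powr (1 + p)"
        using xlow(2)[OF t] cone[of n] by (simp add: M'_def powr_mult)
      finally show ?thesis .
    qed
    define c where "c = C * (2 * L * C1 + M)"
    have c: "0 \<le> c" using C L_pos C1 M by (simp add: c_def)
    have xS: "x (z n) - c * X n \<le> x (z (Suc n))" for n
    proof -
      have "C * integral {z n..z n + L} G \<le> C * (2 * L * (C1 * X n) + M * X n)"
        using ib3[of "z n + L" n] YM[of n] C L_pos by (intro mult_left_mono) auto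
      then show ?thesis using x_var[of "z n" "z n + L"] zT[of n] L_pos unfolding zS abs_le_iff
        by (simp add: c_def algebra_simps)
    qed
    define d where "d = 2 * p * exp p * c"
    have d: "0 \<le> d" using p c by (simp add: d_def)
    have grow: "x (z n) powr (- p) \<le> x s0 powr (- p) + real n * d" for n
    proof (induction n)
      case (Suc n)
      have "x (z (Suc n)) powr (- p) \<le> x (z n) powr (- p) + d" unfolding d_def
        using xS[of n] xlow(2)[of "z n + L" n] L_pos cone[of n]
        by (intro inverse_power_growth c) (auto simp: X_def zS)
      then show ?case using Suc by (simp add: algebra_simps)
    qed (simp add: z_def)
    \<comment> \<open>At most \<open>t / L\<close> steps fit before time \<open>t\<close>, each
      adding at most \<open>d\<close> to \<open>x powr (- p)\<close>; hence the bound
      \<open>B * (1 + t)\<close>.\<close>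
    define B where "B = x s0 powr (- p) + d / L"
    have B: "0 < B" "x s0 powr (- p) \<le> B" "d / L \<le> B" using s0 d L_pos by (auto simp: B_def intro!: add_pos_nonneg)
    \<comment> \<open>The division by 2 again pays for passing from \<open>x (z n)\<close> to
      \<open>x t\<close>.\<close>
    define m where "m = B powr (- 1 / p) / 2"
    have m: "0 < m" using B by (simp add: m_def)
    have "m / (1 + t) powr (1 / p) \<le> x t \<and> Y t \<le> M' * x t powr (1 + p)" if t: "s0 \<le> t" for t
    proof
      obtain n where n: "t \<in> {z n..z n + L}" "real n \<le> (t - s0) / L"
        using step_index[OF t] by (auto simp: z_def)
      show "Y t \<le> M' * x t powr (1 + p)" by (rule Yt[OF n(1)])
      have t0: "0 \<le> t" using t s0 T by simp
      have "real n * d \<le> (t / L) * d"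
      proof (rule mult_right_mono[OF _ d])
        have "(t - s0) / L \<le> t / L" using L_pos s0 T by (intro divide_right_mono) auto
        then show "real n \<le> t / L" using n by linarith
      qed
      also have "\<dots> = (d / L) * t" by simp
      also have "\<dots> \<le> B * t" using B t0 by (intro mult_right_mono) auto
      finally have "x (z n) powr (- p) \<le> B * (1 + t)" using grow[of n] B by (simp add: algebra_simps)
      then have "(B * (1 + t)) powr (- 1 / p) \<le> (x (z n) powr (- p)) powr (- 1 / p)"
        using cone[of n] p by (intro powr_mono2') auto
      also have "\<dots> = x (z n)" using cone[of n] p by (simp add: powr_powr)
      finally have "(B * (1 + t)) powr (- 1 / p) \<le> x (z n)" .
      moreover have "(B * (1 + t)) powr (- 1 / p) = 2 * (m / (1 + t) powr (1 / p))"
      proof -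
        have "(1 + t) powr (- 1 / p) = 1 / (1 + t) powr (1 / p)"
          unfolding minus_divide_left[symmetric] by (simp only: powr_minus inverse_eq_divide)
        moreover have "(B * (1 + t)) powr (- 1 / p) = B powr (- 1 / p) * (1 + t) powr (- 1 / p)"
          by (rule powr_mult)
        ultimately show ?thesis unfolding m_def by simp
      qed
      ultimately show "m / (1 + t) powr (1 / p) \<le> x t" using xlow(2)[OF n(1)] by linarith
    qed
    then show ?thesis using M' m s0 T by (intro disjI2) (meson order_trans)
  qed
qed

end

section \<open>Sharp exponential rates\<close>

lemma exp_weight_le_iff: "exp (b * t) * z \<le> A \<longleftrightarrow> z \<le> A * exp (- b * t)" for b t z A :: real
  by (simp add: exp_minus field_simps)

text \<open>Only an upper bound, and for any real rate: rate 0 is boundedness from above, and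
  negative rates allow growth.\<close>

definition exp_decay :: "(real \<Rightarrow> real) \<Rightarrow> real \<Rightarrow> bool" where
  "exp_decay f \<gamma> \<longleftrightarrow> (\<exists>M\<ge>0. \<forall>t\<ge>0. f t \<le> M * exp (- \<gamma> * t))"

lemma exp_decayI:
  assumes "\<And>t. 0 \<le> t \<Longrightarrow> f t \<le> M * exp (- \<gamma> * t)"
  shows "exp_decay f \<gamma>"
  unfolding exp_decay_def
proof (intro exI[of _ "\<bar>M\<bar>"] conjI allI impI)
  fix t :: real assume "0 \<le> t"
  then have "f t \<le> M * exp (- \<gamma> * t)" by (rule assms)
  also have "\<dots> \<le> \<bar>M\<bar> * exp (- \<gamma> * t)" by (intro mult_right_mono) auto
  finally show "f t \<le> \<bar>M\<bar> * exp (- \<gamma> * t)" .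
qed simp

lemma exp_decayE:
  assumes "exp_decay f \<gamma>"
  obtains M where "0 \<le> M" "\<And>t. 0 \<le> t \<Longrightarrow> f t \<le> M * exp (- \<gamma> * t)"
  using assms unfolding exp_decay_def by blast

lemma exp_decay_rate_mono:
  assumes "exp_decay f \<gamma>" "\<gamma>' \<le> \<gamma>"
  shows "exp_decay f \<gamma>'"
proof -
  obtain M where M: "0 \<le> M" "\<And>t. 0 \<le> t \<Longrightarrow> f t \<le> M * exp (- \<gamma> * t)"
    by (rule exp_decayE[OF assms(1)]) blast
  show ?thesis
  proof (rule exp_decayI[where M = M])
    fix t :: real assume t: "0 \<le> t"
    have "M * exp (- \<gamma> * t) \<le> M * exp (- \<gamma>' * t)"
      using M t assms(2) by (intro mult_left_mono) (auto intro: mult_right_mono)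
    then show "f t \<le> M * exp (- \<gamma>' * t)" using M(2)[OF t] by linarith
  qed
qed

lemma exp_decay_le:
  assumes "exp_decay f \<gamma>" "\<And>t. 0 \<le> t \<Longrightarrow> h t \<le> c * f t" "0 \<le> c"
  shows "exp_decay h \<gamma>"
proof -
  obtain M where M: "0 \<le> M" "\<And>t. 0 \<le> t \<Longrightarrow> f t \<le> M * exp (- \<gamma> * t)"
    by (rule exp_decayE[OF assms(1)]) blast
  show ?thesis
  proof (rule exp_decayI[where M = "c * M"])
    fix t :: real assume t: "0 \<le> t"
    show "h t \<le> c * M * exp (- \<gamma> * t)"
      using assms(2)[OF t] mult_left_mono[OF M(2)[OF t] assms(3)] by (simp add: mult.assoc)
  qed
qed

lemma exp_decay_add:
  assumes "exp_decay f \<gamma>" "exp_decay h \<gamma>"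
  shows "exp_decay (\<lambda>t. f t + h t) \<gamma>"
proof -
  obtain M M' where "\<And>t. 0 \<le> t \<Longrightarrow> f t \<le> M * exp (- \<gamma> * t)" "\<And>t. 0 \<le> t \<Longrightarrow> h t \<le> M' * exp (- \<gamma> * t)"
    using assms by (meson exp_decayE)
  then show ?thesis by (intro exp_decayI[where M = "M + M'"]) (auto simp: distrib_right intro: add_mono)
qed

lemma exp_decay_sum:
  assumes "finite D" "\<And>r. r \<in> D \<Longrightarrow> exp_decay (y r) \<gamma>"
  shows "exp_decay (\<lambda>t. \<Sum>r\<in>D. y r t) \<gamma>"
  using assms
proof (induction D rule: finite_induct)
  case empty
  then show ?case by (intro exp_decayI[where M = 0]) simp
qed (simp add: exp_decay_add)

lemma exp_decay_tendsto:
  assumes "exp_decay f \<gamma>" "a < \<gamma>" "\<And>t. 0 \<le> t \<Longrightarrow> 0 \<le> f t"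
  shows "((\<lambda>t. exp (a * t) * f t) \<longlongrightarrow> 0) at_top"
proof -
  obtain M where M: "0 \<le> M" "\<And>t. 0 \<le> t \<Longrightarrow> f t \<le> M * exp (- \<gamma> * t)"
    by (rule exp_decayE[OF assms(1)]) blast
  have "((\<lambda>t. M * exp (- ((\<gamma> - a) * t))) \<longlongrightarrow> M * 0) at_top"
    using assms(2)
    by (intro tendsto_mult tendsto_const filterlim_compose[OF exp_at_bot]
        filterlim_compose[OF filterlim_uminus_at_bot_at_top]
        filterlim_tendsto_pos_mult_at_top[OF tendsto_const _ filterlim_ident]) auto
  then have lim: "((\<lambda>t. M * exp (- ((\<gamma> - a) * t))) \<longlongrightarrow> 0) at_top" by simp
  show ?thesis
  proof (rule tendsto_sandwich[OF _ _ tendsto_const lim])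
    show "eventually (\<lambda>t. 0 \<le> exp (a * t) * f t) at_top"
      using eventually_ge_at_top[of 0] by eventually_elim (simp add: assms(3))
    show "eventually (\<lambda>t. exp (a * t) * f t \<le> M * exp (- ((\<gamma> - a) * t))) at_top"
      using eventually_ge_at_top[of 0]
    proof eventually_elim
      case (elim t)
      have "exp (a * t) * f t \<le> exp (a * t) * (M * exp (- \<gamma> * t))" using M(2)[OF elim] by (intro mult_left_mono) auto
      also have "\<dots> = M * exp (- ((\<gamma> - a) * t))" by (simp add: algebra_simps flip: exp_add)
      finally show ?case .
    qed
  qed
qed

text \<open>Integration from infinity: as \<open>t\<close> tends to infinity the boundary term
  disappears, and \<open>f\<close> inherits the full rate \<open>c\<close> of the forcing, even if
  it was known to decay only slightly faster than \<open>exp (- a * t)\<close>.\<close>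

lemma exp_bound_of_lower_estimate:
  fixes f G :: "real \<Rightarrow> real" and a c s :: real
  assumes lower: "\<And>s t. \<lbrakk>0 \<le> s; s \<le> t\<rbrakk> \<Longrightarrow>
      exp (a * s) * f s \<le> C * (exp (a * t) * f t + integral {s..t} (\<lambda>\<tau>. exp (a * \<tau>) * G \<tau>))"
    and C: "0 \<le> C" and lim: "((\<lambda>t. exp (a * t) * f t) \<longlongrightarrow> 0) at_top"
    and cont: "continuous_on {0..} G" and M: "0 \<le> M" "\<And>t. 0 \<le> t \<Longrightarrow> G t \<le> M * exp (- c * t)"
    and ac: "a < c" and s: "0 \<le> s"
  shows "f s \<le> C * (M / (c - a)) * exp (- c * s)"
proof -
  have "exp (a * s) * f s \<le> C * (0 + M / (c - a) * exp ((a - c) * s))"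
  proof (rule tendsto_lowerbound[where F = "at_top :: real filter"])
    show "((\<lambda>t. C * (exp (a * t) * f t + M / (c - a) * exp ((a - c) * s))) \<longlongrightarrow> C * (0 + M / (c - a) * exp ((a - c) * s))) at_top"
      by (intro tendsto_intros lim)
    show "eventually (\<lambda>t. exp (a * s) * f s \<le> C * (exp (a * t) * f t + M / (c - a) * exp ((a - c) * s))) at_top"
      using eventually_ge_at_top[of s]
    proof eventually_elim
      case (elim t)
      have "C * (exp (a * t) * f t + integral {s..t} (\<lambda>\<tau>. exp (a * \<tau>) * G \<tau>))
          \<le> C * (exp (a * t) * f t + M / (c - a) * exp ((a - c) * s))"
        using integral_exp_le[OF cont M(2) ac s elim M(1)] C by (intro mult_left_mono) auto
      then show ?case using lower[OF s elim] by linarith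
    qed
  qed simp
  then have "exp (- a * s) * (exp (a * s) * f s) \<le> exp (- a * s) * (C * (M / (c - a) * exp ((a - c) * s)))"
    by (intro mult_left_mono) auto
  moreover have "exp (- a * s) * (exp (a * s) * f s) = f s" by (simp add: mult.assoc[symmetric] flip: exp_add)
  moreover have "exp (- a * s) * (C * (M / (c - a) * exp ((a - c) * s))) = C * (M / (c - a)) * exp (- c * s)"
  proof -
    have "exp (- a * s) * exp ((a - c) * s) = exp (- c * s)" by (simp add: algebra_simps flip: exp_add)
    then show ?thesis by (metis (no_types, lifting) mult.assoc mult.left_commute)
  qed
  ultimately show ?thesis by (simp only:)
qed

text \<open>Integration from 0: the forcing decays faster than the weight grows, so the integral
  stays bounded and the rate is limited only by that of the component itself.\<close>

lemma exp_decay_of_upper_estimate: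
  assumes upper: "\<And>t. 0 \<le> t \<Longrightarrow>
      exp (b * t) * f t \<le> C * (f 0 + integral {0..t} (\<lambda>\<tau>. exp (b * \<tau>) * G \<tau>))"
    and C: "0 \<le> C" and cont: "continuous_on {0..} G" and G: "exp_decay G c" and bc: "b < c"
  shows "exp_decay f b"
proof -
  obtain M where M: "0 \<le> M" "\<And>t. 0 \<le> t \<Longrightarrow> G t \<le> M * exp (- c * t)"
    by (rule exp_decayE[OF G]) blast
  show ?thesis
  proof (rule exp_decayI[where M = "C * (f 0 + M / (c - b))"])
    fix t :: real assume t: "0 \<le> t"
    have "integral {0..t} (\<lambda>\<tau>. exp (b * \<tau>) * G \<tau>) \<le> M / (c - b) * exp ((b - c) * 0)"
      by (rule integral_exp_le[OF cont M(2) bc order_refl t M(1)])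
    then have "C * (f 0 + integral {0..t} (\<lambda>\<tau>. exp (b * \<tau>) * G \<tau>)) \<le> C * (f 0 + M / (c - b))"
      using C by (intro mult_left_mono) auto
    then have "exp (b * t) * f t \<le> C * (f 0 + M / (c - b))" using upper[OF t] by linarith
    then show "f t \<le> C * (f 0 + M / (c - b)) * exp (- b * t)" by (simp add: exp_minus field_simps)
  qed
qed

text \<open>The constants in \<open>upper\<close> and \<open>lower\<close> may depend on
  \<open>r\<close> and on the weight and may blow up as the weight approaches \<open>r\<close>. This
  is the trace left by the double root, and the reason why only strict inequalities between rates
  are used.\<close>

locale exponent_system =
  fixes D :: "real set" and y :: "real \<Rightarrow> real \<Rightarrow> real" and G :: "real \<Rightarrow> real" and C p q :: real
  assumes D: "finite D" and y_nonneg: "\<And>r t. \<lbrakk>r \<in> D; 0 \<le> t\<rbrakk> \<Longrightarrow> 0 \<le> y r t"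
    and G_cont: "continuous_on {0..} G" and G_nonneg: "\<And>t. 0 \<le> t \<Longrightarrow> 0 \<le> G t"
    and upper: "\<And>r b. \<lbrakk>r \<in> D; b < r\<rbrakk> \<Longrightarrow> \<exists>C\<ge>0. \<forall>s t. 0 \<le> s \<longrightarrow> s \<le> t \<longrightarrow>
      exp (b * t) * y r t \<le> C * (exp (b * s) * y r s + integral {s..t} (\<lambda>\<tau>. exp (b * \<tau>) * G \<tau>))"
    and lower: "\<And>r a. \<lbrakk>r \<in> D; r < a\<rbrakk> \<Longrightarrow> \<exists>C\<ge>0. \<forall>s t. 0 \<le> s \<longrightarrow> s \<le> t \<longrightarrow>
      exp (a * s) * y r s \<le> C * (exp (a * t) * y r t + integral {s..t} (\<lambda>\<tau>. exp (a * \<tau>) * G \<tau>))"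
    and C: "0 \<le> C" and p: "0 < p" and q: "0 < q"
    and G_le: "\<And>t. 0 \<le> t \<Longrightarrow> G t \<le> C * ((\<Sum>r\<in>D. y r t) powr (1 + p) + (\<Sum>r\<in>D. y r t) powr (1 + q))"
    and decay: "\<exists>\<gamma>>0. exp_decay (\<lambda>t. \<Sum>r\<in>D. y r t) \<gamma>"
begin

definition N :: "real \<Rightarrow> real" where "N t = (\<Sum>r\<in>D. y r t)"

lemma N_nonneg: "0 \<le> t \<Longrightarrow> 0 \<le> N t"
  unfolding N_def by (intro sum_nonneg y_nonneg)

lemma y_le_N: "\<lbrakk>r \<in> D; 0 \<le> t\<rbrakk> \<Longrightarrow> y r t \<le> N t"
  unfolding N_def using D y_nonneg by (intro member_le_sum) auto

text \<open>Superlinearity multiplies the rate; this gain is what improves the rates of all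
  components away from the critical one.\<close>

lemma G_decay:
  assumes N: "exp_decay N \<gamma>" and g: "0 \<le> \<gamma>"
  shows "exp_decay G ((1 + min p q) * \<gamma>)"
proof -
  obtain M where M: "0 \<le> M" "\<And>t. 0 \<le> t \<Longrightarrow> N t \<le> M * exp (- \<gamma> * t)" by (rule exp_decayE[OF N]) blast
  show ?thesis
  proof (rule exp_decayI[where M = "C * (M powr (1 + p) + M powr (1 + q))"])
    fix t :: real assume t: "0 \<le> t"
    have *: "N t powr (1 + m) \<le> M powr (1 + m) * exp (- ((1 + min p q) * \<gamma>) * t)" if m: "min p q \<le> m" "0 < m" for m
    proof -
      have "N t powr (1 + m) \<le> (M * exp (- \<gamma> * t)) powr (1 + m)"
        using M(2)[OF t] N_nonneg[OF t] m by (intro powr_mono2) auto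
      also have "\<dots> = M powr (1 + m) * exp (- ((1 + m) * (\<gamma> * t)))"
        using M by (simp add: powr_mult exp_powr_real algebra_simps)
      also have "\<dots> \<le> M powr (1 + m) * exp (- ((1 + min p q) * (\<gamma> * t)))"
        using m g t by (intro mult_left_mono) (auto intro!: mult_right_mono)
      finally show ?thesis by (simp add: mult.assoc)
    qed
    have "G t \<le> C * (N t powr (1 + p) + N t powr (1 + q))" using G_le[OF t] by (simp add: N_def)
    also have "\<dots> \<le> C * (M powr (1 + p) * exp (- ((1 + min p q) * \<gamma>) * t) + M powr (1 + q) * exp (- ((1 + min p q) * \<gamma>) * t))"
      using *[of p] *[of q] p q C by (intro mult_left_mono add_mono) auto
    finally show "G t \<le> C * (M powr (1 + p) + M powr (1 + q)) * exp (- ((1 + min p q) * \<gamma>) * t)"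
      by (simp add: algebra_simps)
  qed
qed

text \<open>With a weight above every exponent all components can be integrated from infinity. A
  boundedly decaying \<open>N\<close> makes \<open>G\<close> at most linear in \<open>N\<close>, and
  integrating against \<open>exp (b * t)\<close> gains \<open>1 / (b - a)\<close>; for large
  \<open>b\<close> the weighted supremum is at most half of itself, hence 0.\<close>

lemma N_zero_if_superexponential:
  assumes all: "\<And>\<gamma>. exp_decay N \<gamma>" and s: "0 \<le> s"
  shows "N s = 0"
proof -
  obtain B where B: "0 \<le> B" "\<And>t. 0 \<le> t \<Longrightarrow> N t \<le> B" using exp_decayE[OF all[of 0]] by auto
  define C1 where "C1 = C * (B powr p + B powr q)"
  have C1: "0 \<le> C1" using C by (simp add: C1_def)
  have GN: "G t \<le> C1 * N t" if t: "0 \<le> t" for t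
  proof -
    have *: "N t powr (1 + m) \<le> B powr m * N t" if "0 < m" for m
    proof -
      have "N t * N t powr m \<le> N t * B powr m"
        using B(2)[OF t] N_nonneg[OF t] that by (intro mult_left_mono powr_mono2) auto
      then show ?thesis using N_nonneg[OF t] by (simp add: powr_mult_base mult.commute)
    qed
    have "G t \<le> C * (N t powr (1 + p) + N t powr (1 + q))" using G_le[OF t] by (simp add: N_def)
    also have "\<dots> \<le> C * (B powr p * N t + B powr q * N t)" using * p q C by (intro mult_left_mono add_mono) auto
    finally show ?thesis by (simp add: C1_def algebra_simps)
  qed
  \<comment> \<open>Larger than every exponent; inserting 0 covers an empty
    \<open>D\<close>.\<close>
  define a where "a = Max (insert 0 D) + 1"
  have "r < a" if "r \<in> D" for r
  proof -
    have "r \<le> Max (insert 0 D)" using D that by (intro Max_ge) auto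
    then show ?thesis by (simp add: a_def)
  qed
  then have "\<forall>r\<in>D. \<exists>C\<ge>0. \<forall>s t. 0 \<le> s \<longrightarrow> s \<le> t \<longrightarrow>
      exp (a * s) * y r s \<le> C * (exp (a * t) * y r t + integral {s..t} (\<lambda>\<tau>. exp (a * \<tau>) * G \<tau>))"
    using lower by blast
  then obtain Cr where Cr: "\<And>r. r \<in> D \<Longrightarrow> 0 \<le> Cr r"
    "\<And>r s t. \<lbrakk>r \<in> D; 0 \<le> s; s \<le> t\<rbrakk> \<Longrightarrow>
      exp (a * s) * y r s \<le> Cr r * (exp (a * t) * y r t + integral {s..t} (\<lambda>\<tau>. exp (a * \<tau>) * G \<tau>))"
    by metis
  define Cm where "Cm = (\<Sum>r\<in>D. Cr r)"
  have Cm: "0 \<le> Cm" unfolding Cm_def using Cr by (intro sum_nonneg)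
  have low: "exp (a * s) * N s \<le> Cm * (exp (a * t) * N t + integral {s..t} (\<lambda>\<tau>. exp (a * \<tau>) * G \<tau>))"
    if st: "0 \<le> s" "s \<le> t" for s t
  proof -
    have "exp (a * s) * N s = (\<Sum>r\<in>D. exp (a * s) * y r s)" by (simp add: N_def sum_distrib_left)
    also have "\<dots> \<le> (\<Sum>r\<in>D. Cr r * (exp (a * t) * N t + integral {s..t} (\<lambda>\<tau>. exp (a * \<tau>) * G \<tau>)))"
    proof (rule sum_mono)
      fix r assume r: "r \<in> D"
      have "Cr r * (exp (a * t) * y r t + integral {s..t} (\<lambda>\<tau>. exp (a * \<tau>) * G \<tau>))
          \<le> Cr r * (exp (a * t) * N t + integral {s..t} (\<lambda>\<tau>. exp (a * \<tau>) * G \<tau>))"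
        using Cr(1)[OF r] y_le_N[OF r, of t] st by (intro mult_left_mono add_right_mono) auto
      then show "exp (a * s) * y r s \<le> Cr r * (exp (a * t) * N t + integral {s..t} (\<lambda>\<tau>. exp (a * \<tau>) * G \<tau>))"
        using Cr(2)[OF r st] by linarith
    qed
    finally show ?thesis by (simp add: Cm_def sum_distrib_right)
  qed
  \<comment> \<open>Chosen so that \<open>Cm * C1 / (b - a) \<le> 1 / 2\<close>. Any such
    \<open>b\<close> is available because \<open>N\<close> decays at every rate.\<close>
  define b where "b = a + 2 * (Cm * C1) + 1"
  have CC: "0 \<le> Cm * C1" using Cm C1 by simp
  then have ba: "a < b" by (simp add: b_def)
  have "Cm * C1 \<le> (1 / 2) * (b - a)" by (simp add: b_def)
  then have ba2: "Cm * C1 / (b - a) \<le> 1 / 2" using ba by (simp only: pos_divide_le_eq diff_gt_0_iff_gt)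
  obtain M where M: "0 \<le> M" "\<And>t. 0 \<le> t \<Longrightarrow> N t \<le> M * exp (- b * t)" using exp_decayE[OF all] by metis
  have "exp (b * s) * N s \<le> 2 * 0"
  proof (rule self_bound[where A = "{0..}" and f = "\<lambda>s. exp (b * s) * N s"])
    show "exp (b * t) * N t \<le> M" if "t \<in> {0..}" for t
      using M(2)[of t] that by (simp add: exp_minus field_simps)
    show "exp (b * t) * N t \<le> 0 + S / 2"
      if S: "\<And>t. t \<in> {0..} \<Longrightarrow> exp (b * t) * N t \<le> S" and t: "t \<in> {0..}" for S t
    proof -
      have S0: "0 \<le> S" using S[of 0] N_nonneg[of 0] by simp
      have "N t \<le> Cm * ((C1 * S) / (b - a)) * exp (- b * t)"
      proof (rule exp_bound_of_lower_estimate[OF low Cm _ G_cont _ _ ba])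
        show "((\<lambda>t. exp (a * t) * N t) \<longlongrightarrow> 0) at_top"
          by (rule exp_decay_tendsto[OF all[of b] ba N_nonneg])
        fix \<tau> :: real assume tau: "0 \<le> \<tau>"
        have "N \<tau> \<le> S * exp (- b * \<tau>)" using S[of \<tau>] tau by (simp add: exp_minus field_simps)
        then have "C1 * N \<tau> \<le> C1 * (S * exp (- b * \<tau>))" using C1 by (intro mult_left_mono)
        then show "G \<tau> \<le> C1 * S * exp (- b * \<tau>)" using GN[OF tau] by simp
      qed (use t C1 S0 in auto)
      then have "exp (b * t) * N t \<le> Cm * ((C1 * S) / (b - a))" unfolding exp_weight_le_iff .
      also have "\<dots> = (Cm * C1 / (b - a)) * S" by simp
      also have "\<dots> \<le> 1 / 2 * S" using ba2 S0 by (intro mult_right_mono)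
      finally show ?thesis by simp
    qed
  qed (use s in auto)
  then show ?thesis using N_nonneg[OF s] by (simp add: mult_le_0_iff)
qed

text \<open>Besides the sharp rate \<open>r0\<close>, the statement exports the improved rates of
  the forcing and of the components with \<open>r \<noteq> r0\<close>: the former yields the
  profile, the latter show that the profile is all that remains at order \<open>r0\<close>.\<close>

lemma null_or_sharp_rate:
  "(\<forall>t\<ge>0. N t = 0) \<or>
   (\<exists>r0\<in>D. 0 < r0 \<and> (\<forall>b>r0. \<not> exp_decay N b) \<and>
      (\<forall>c<(1 + min p q) * r0. exp_decay G c) \<and>
      (\<forall>r\<in>D. \<forall>b<(1 + min p q) * r0. r \<noteq> r0 \<longrightarrow> (r0 < r \<longrightarrow> b < r) \<longrightarrow> exp_decay (y r) b))"
proof (cases "\<forall>\<gamma>. exp_decay N \<gamma>")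
  case True
  then show ?thesis using N_zero_if_superexponential by blast
next
  case False
  then obtain \<gamma>1 where g1: "\<not> exp_decay N \<gamma>1" by blast
  define \<Gamma> where "\<Gamma> = {\<gamma>. exp_decay N \<gamma>}"
  have bdd: "bdd_above \<Gamma>"
    using g1 exp_decay_rate_mono[of N _ \<gamma>1] unfolding \<Gamma>_def by (intro bdd_aboveI[of _ \<gamma>1]) (auto intro: leI dest: less_imp_le)
  obtain \<gamma>0 where g0: "0 < \<gamma>0" "\<gamma>0 \<in> \<Gamma>" using decay unfolding \<Gamma>_def N_def[abs_def] by blast
  define g where "g = Sup \<Gamma>"
  have gpos: "0 < g" using g0 cSup_upper[OF g0(2) bdd] by (simp add: g_def)
  have below: "exp_decay N \<gamma>" if lt: "\<gamma> < g" for \<gamma>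
  proof -
    obtain \<gamma>' where "\<gamma>' \<in> \<Gamma>" "\<gamma> < \<gamma>'" using less_cSupD[of \<Gamma> \<gamma>] lt g0 by (auto simp: g_def)
    then show ?thesis using exp_decay_rate_mono[of N \<gamma>' \<gamma>] by (simp add: \<Gamma>_def)
  qed
  have above: "\<not> exp_decay N b" if "g < b" for b
    using cSup_upper[OF _ bdd, of b] that by (auto simp: g_def \<Gamma>_def)
  define m where "m = min p q"
  have m: "0 < m" using p q by (simp add: m_def)
  \<comment> \<open>The supremum \<open>g\<close> need not be attained, so a rate strictly below it
    is used, yet large enough that multiplication by \<open>1 + m\<close> reaches \<open>c\<close>.
    The maximum with 0 meets the sign condition of \<open>G_decay\<close>.\<close>
  have Gd: "exp_decay G c" if c: "c < (1 + m) * g" for c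
  proof -
    define d where "d = c / (1 + m)"
    define \<gamma> where "\<gamma> = max 0 ((d + g) / 2)"
    have cg: "d < g" using c m by (simp add: d_def field_simps)
    have "\<gamma> < g" using cg gpos by (simp add: \<gamma>_def)
    moreover have "d \<le> \<gamma>" using cg by (simp add: \<gamma>_def le_max_iff_disj)
    then have "c \<le> (1 + m) * \<gamma>" using m by (simp add: d_def field_simps)
    moreover have "0 \<le> \<gamma>" by (simp add: \<gamma>_def)
    ultimately show ?thesis using exp_decay_rate_mono[OF G_decay[OF below]] by (simp add: m_def)
  qed
  have yd: "exp_decay (y r) b" if r: "r \<in> D" "r \<noteq> g" and b: "b < (1 + m) * g" "g < r \<longrightarrow> b < r" for r b
  proof (cases "g < r")
    case True
    then have br: "b < r" using b by simp
    obtain c where c: "b < c" "c < (1 + m) * g" using dense[OF b(1)] by blast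
    obtain C' where C': "0 \<le> C'" "\<And>s t. \<lbrakk>0 \<le> s; s \<le> t\<rbrakk> \<Longrightarrow> exp (b * t) * y r t \<le> C' * (exp (b * s) * y r s + integral {s..t} (\<lambda>\<tau>. exp (b * \<tau>) * G \<tau>))"
      using upper[OF r(1) br] by blast
    show ?thesis using C'(2)[of 0] by (intro exp_decay_of_upper_estimate[OF _ C'(1) G_cont Gd[OF c(2)] c(1)]) simp
  next
    case False
    then have rg: "r < g" using r by simp
    \<comment> \<open>The weight lies above \<open>r\<close>, which permits integrating from
      infinity, and below \<open>g\<close>, where the boundary term is known to vanish. The rate
      \<open>c\<close> is raised to at least \<open>g\<close> so that it exceeds
      \<open>a\<close>.\<close>
    define a where "a = (r + g) / 2"
    define c where "c = max b g"
    have a: "r < a" "a < g" using rg by (auto simp: a_def)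
    have c: "c < (1 + m) * g" "a < c" "b \<le> c" using b m gpos a by (auto simp: c_def)
    obtain M where M: "0 \<le> M" "\<And>t. 0 \<le> t \<Longrightarrow> G t \<le> M * exp (- c * t)" by (rule exp_decayE[OF Gd[OF c(1)]]) blast
    obtain C' where C': "0 \<le> C'" "\<And>s t. \<lbrakk>0 \<le> s; s \<le> t\<rbrakk> \<Longrightarrow> exp (a * s) * y r s \<le> C' * (exp (a * t) * y r t + integral {s..t} (\<lambda>\<tau>. exp (a * \<tau>) * G \<tau>))"
      using lower[OF r(1) a(1)] by blast
    obtain \<gamma> where \<gamma>: "a < \<gamma>" "\<gamma> < g" using dense[OF a(2)] by blast
    have "exp_decay (y r) \<gamma>" by (rule exp_decay_le[OF below[OF \<gamma>(2)], of _ 1]) (use r y_le_N in auto)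
    then have "((\<lambda>t. exp (a * t) * y r t) \<longlongrightarrow> 0) at_top"
      by (rule exp_decay_tendsto[OF _ \<gamma>(1)]) (use r y_nonneg in auto)
    note lim = this
    have "exp_decay (y r) c"
      by (rule exp_decayI[OF exp_bound_of_lower_estimate[OF C'(2) C'(1) lim G_cont M c(2)]])
    then show ?thesis using c(3) by (rule exp_decay_rate_mono)
  qed
  \<comment> \<open>Otherwise every component improves, and \<open>N\<close> would decay at a rate
    strictly between \<open>g\<close> and the next obstruction, which is either an exponent above
    \<open>g\<close> or \<open>(1 + m) * g\<close>.\<close>
  have "g \<in> D"
  proof (rule ccontr)
    assume gD: "g \<notin> D"
    define u where "u = Min (insert ((1 + m) * g) {r \<in> D. g < r})"
    have fin: "finite (insert ((1 + m) * g) {r \<in> D. g < r})" using D by simp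
    have "g < u" unfolding u_def using fin m gpos by (subst Min_gr_iff) auto
    then obtain b where b: "g < b" "b < u" using dense by blast
    have "b < (1 + m) * g" "\<And>r. \<lbrakk>r \<in> D; g < r\<rbrakk> \<Longrightarrow> b < r"
      using b(2) fin unfolding u_def by (auto simp: Min_gr_iff)
    then have "exp_decay (\<lambda>t. \<Sum>r\<in>D. y r t) b" using gD by (intro exp_decay_sum D yd) auto
    then show False using above[OF b(1)] by (simp add: N_def[abs_def])
  qed
  then show ?thesis using gpos above Gd yd unfolding m_def by blast
qed

end

section \<open>Single modes\<close>

definition slow_rate :: "real \<Rightarrow> real \<Rightarrow> real" where
  "slow_rate \<delta> l = \<delta> - sqrt (\<delta>\<^sup>2 - l)"

definition fast_rate :: "real \<Rightarrow> real \<Rightarrow> real" where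
  "fast_rate \<delta> l = \<delta> + sqrt (\<delta>\<^sup>2 - l)"

text \<open>Together with \<open>fast_coeff\<close>, the solution \<open>a\<close>, \<open>b\<close>
  of \<open>x = a + b\<close> and \<open>y = - r * a - R * b\<close>, where \<open>r\<close> and
  \<open>R\<close> are the slow and the fast rate.\<close>

definition slow_coeff :: "real \<Rightarrow> real \<Rightarrow> real \<Rightarrow> real \<Rightarrow> real" where
  "slow_coeff \<delta> l x y = (fast_rate \<delta> l * x + y) / (fast_rate \<delta> l - slow_rate \<delta> l)"

definition fast_coeff :: "real \<Rightarrow> real \<Rightarrow> real \<Rightarrow> real \<Rightarrow> real" where
  "fast_coeff \<delta> l x y = - (slow_rate \<delta> l * x + y) / (fast_rate \<delta> l - slow_rate \<delta> l)"

text \<open>The energy that a mode with eigenvalue \<open>l\<close>, position \<open>x\<close> and velocity \<open>y\<close> puts into the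
  exponent \<open>r\<close>. The regularisation \<open>\<epsilon>\<close> makes the form definite at the double
  root \<open>l = \<delta>\<^sup>2\<close>, at the price of a loss \<open>\<epsilon>\<close> in the rate \<open>\<delta>\<close>.\<close>

definition mode_form :: "real \<Rightarrow> real \<Rightarrow> real \<Rightarrow> real \<Rightarrow> real \<Rightarrow> real \<Rightarrow> real" where
  "mode_form \<delta> \<epsilon> r l x y =
     (if \<delta>\<^sup>2 \<le> l then (if r = \<delta> then (y + \<delta> * x)\<^sup>2 + (l - \<delta>\<^sup>2 + \<epsilon>\<^sup>2) * x\<^sup>2 else 0)
      else (if r = slow_rate \<delta> l then (slow_coeff \<delta> l x y)\<^sup>2 else 0)
         + (if r = fast_rate \<delta> l then (fast_coeff \<delta> l x y)\<^sup>2 else 0))"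

definition mode_sol :: "real \<Rightarrow> real \<Rightarrow> (real \<Rightarrow> real) \<Rightarrow> (real \<Rightarrow> real) \<Rightarrow> (real \<Rightarrow> real) \<Rightarrow> bool" where
  "mode_sol \<delta> l x y g \<longleftrightarrow> (\<forall>t\<ge>0. (x has_real_derivative y t) (at t within {0..}) \<and>
     (y has_real_derivative - 2 * \<delta> * y t - l * x t + g t) (at t within {0..}))"

lemma mode_form_nonneg: "0 \<le> mode_form \<delta> \<epsilon> r l x y"
  by (auto simp: mode_form_def intro!: add_nonneg_nonneg mult_nonneg_nonneg)

lemma rates:
  assumes "l < \<delta>\<^sup>2"
  shows "fast_rate \<delta> l - slow_rate \<delta> l = 2 * sqrt (\<delta>\<^sup>2 - l)" "0 < sqrt (\<delta>\<^sup>2 - l)"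
    "slow_rate \<delta> l * fast_rate \<delta> l = l" "slow_rate \<delta> l + fast_rate \<delta> l = 2 * \<delta>"
    "slow_rate \<delta> l < fast_rate \<delta> l" "slow_rate \<delta> l < \<delta>" "\<delta> < fast_rate \<delta> l"
proof -
  have s: "0 < sqrt (\<delta>\<^sup>2 - l)" "(sqrt (\<delta>\<^sup>2 - l))\<^sup>2 = \<delta>\<^sup>2 - l" using assms by auto
  have "slow_rate \<delta> l * fast_rate \<delta> l = \<delta>\<^sup>2 - (sqrt (\<delta>\<^sup>2 - l))\<^sup>2"
    unfolding slow_rate_def fast_rate_def by (simp only: power2_eq_square) (simp add: algebra_simps)
  then show "slow_rate \<delta> l * fast_rate \<delta> l = l" using s by simp
qed (use assms in \<open>auto simp: slow_rate_def fast_rate_def\<close>)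

lemma slow_rate_nonneg:
  assumes "0 \<le> l" "0 \<le> \<delta>"
  shows "0 \<le> slow_rate \<delta> l"
  using assms real_sqrt_le_mono[of "\<delta>\<^sup>2 - l" "\<delta>\<^sup>2"] by (simp add: slow_rate_def)

lemma mode_of_coeffs:
  assumes "l < \<delta>\<^sup>2"
  shows "x = slow_coeff \<delta> l x y + fast_coeff \<delta> l x y"
    "y = - slow_rate \<delta> l * slow_coeff \<delta> l x y - fast_rate \<delta> l * fast_coeff \<delta> l x y"
proof -
  let ?d = "fast_rate \<delta> l - slow_rate \<delta> l"
  have d: "?d \<noteq> 0" using rates(5)[OF assms] by simp
  have "slow_coeff \<delta> l x y + fast_coeff \<delta> l x y = (?d * x) / ?d"
    unfolding slow_coeff_def fast_coeff_def by (simp add: algebra_simps flip: add_divide_distrib)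
  then show "x = slow_coeff \<delta> l x y + fast_coeff \<delta> l x y" using d by simp
  have "- slow_rate \<delta> l * slow_coeff \<delta> l x y - fast_rate \<delta> l * fast_coeff \<delta> l x y = (?d * y) / ?d"
    unfolding slow_coeff_def fast_coeff_def by (simp add: algebra_simps flip: add_divide_distrib diff_divide_distrib)
  then show "y = - slow_rate \<delta> l * slow_coeff \<delta> l x y - fast_rate \<delta> l * fast_coeff \<delta> l x y" using d by simp
qed

text \<open>The two coefficients diagonalise the first order system. The forcing is divided by the
  difference of the rates, which degenerates near the double root; hence the need for a gap below
  \<open>\<delta>\<^sup>2\<close>.\<close>

lemma coeff_deriv:
  assumes sol: "mode_sol \<delta> l x y g" and l: "l < \<delta>\<^sup>2" and t: "0 \<le> t"
  shows "((\<lambda>t. slow_coeff \<delta> l (x t) (y t)) has_real_derivative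
        - slow_rate \<delta> l * slow_coeff \<delta> l (x t) (y t) + g t / (2 * sqrt (\<delta>\<^sup>2 - l))) (at t within {0..})"
    and "((\<lambda>t. fast_coeff \<delta> l (x t) (y t)) has_real_derivative
        - fast_rate \<delta> l * fast_coeff \<delta> l (x t) (y t) - g t / (2 * sqrt (\<delta>\<^sup>2 - l))) (at t within {0..})"
proof -
  let ?r = "slow_rate \<delta> l" and ?R = "fast_rate \<delta> l"
  note r = rates[OF l]
  have dx: "(x has_real_derivative y t) (at t within {0..})"
    and dy: "(y has_real_derivative - 2 * \<delta> * y t - l * x t + g t) (at t within {0..})"
    using sol t by (auto simp: mode_sol_def)
  have e: "- 2 * \<delta> * y t - l * x t + g t = - (?r + ?R) * y t - ?r * ?R * x t + g t"
    by (simp only: r(3,4))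
  have "((\<lambda>t. slow_coeff \<delta> l (x t) (y t)) has_real_derivative
      (?R * y t + (- 2 * \<delta> * y t - l * x t + g t)) / (?R - ?r)) (at t within {0..})"
    unfolding slow_coeff_def using r(5) by (auto intro!: derivative_eq_intros dx dy)
  moreover have "(?R * y t + (- 2 * \<delta> * y t - l * x t + g t)) / (?R - ?r) =
      - ?r * slow_coeff \<delta> l (x t) (y t) + g t / (2 * sqrt (\<delta>\<^sup>2 - l))"
    unfolding e slow_coeff_def r(1)[symmetric] by (simp add: algebra_simps flip: add_divide_distrib diff_divide_distrib)
  ultimately show "((\<lambda>t. slow_coeff \<delta> l (x t) (y t)) has_real_derivative
      - ?r * slow_coeff \<delta> l (x t) (y t) + g t / (2 * sqrt (\<delta>\<^sup>2 - l))) (at t within {0..})" by simp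
  have "((\<lambda>t. fast_coeff \<delta> l (x t) (y t)) has_real_derivative
      - (?r * y t + (- 2 * \<delta> * y t - l * x t + g t)) / (?R - ?r)) (at t within {0..})"
    unfolding fast_coeff_def using r(5) by (auto intro!: derivative_eq_intros dx dy)
  moreover have "- (?r * y t + (- 2 * \<delta> * y t - l * x t + g t)) / (?R - ?r) =
      - ?R * fast_coeff \<delta> l (x t) (y t) - g t / (2 * sqrt (\<delta>\<^sup>2 - l))"
    unfolding e fast_coeff_def r(1)[symmetric] by (simp add: algebra_simps flip: add_divide_distrib diff_divide_distrib)
  ultimately show "((\<lambda>t. fast_coeff \<delta> l (x t) (y t)) has_real_derivative
      - ?R * fast_coeff \<delta> l (x t) (y t) - g t / (2 * sqrt (\<delta>\<^sup>2 - l))) (at t within {0..})" by simp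
qed

text \<open>The eigenvalue enters the inequality only through the form itself, and \<open>c\<close>
  bounds the weight of the forcing. It can therefore be summed over modes without losing
  uniformity.\<close>

lemma mode_form_deriv:
  fixes r :: real
  assumes sol: "mode_sol \<delta> l x y g" and t: "0 \<le> t" and eps: "0 < \<epsilon>"
    and c: "1 \<le> c" "l < \<delta>\<^sup>2 \<Longrightarrow> 1 \<le> c * (2 * sqrt (\<delta>\<^sup>2 - l))"
  defines "Q \<equiv> \<lambda>t. mode_form \<delta> \<epsilon> r l (x t) (y t)"
  shows "\<exists>Q'. (Q has_real_derivative Q') (at t within {0..}) \<and>
    \<bar>Q' + 2 * r * Q t\<bar> \<le> 2 * (if r = \<delta> then \<epsilon> else 0) * Q t + 2 * c * (sqrt (Q t) * \<bar>g t\<bar>)"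
proof (cases "\<delta>\<^sup>2 \<le> l")
  case l: True
  show ?thesis
  proof (cases "r = \<delta>")
    case r: True
    have dx: "(x has_real_derivative y t) (at t within {0..})"
      and dy: "(y has_real_derivative - 2 * \<delta> * y t - l * x t + g t) (at t within {0..})"
      using sol t by (auto simp: mode_sol_def)
    define w where "w = y t + \<delta> * x t"
    have Q: "Q = (\<lambda>t. (y t + \<delta> * x t)\<^sup>2 + (l - \<delta>\<^sup>2 + \<epsilon>\<^sup>2) * (x t)\<^sup>2)"
      using l r by (simp add: Q_def mode_form_def)
    let ?Q' = "2 * (y t + \<delta> * x t) * ((- 2 * \<delta> * y t - l * x t + g t) + \<delta> * y t) + (l - \<delta>\<^sup>2 + \<epsilon>\<^sup>2) * (2 * x t * y t)"
    have 1: "(Q has_real_derivative ?Q') (at t within {0..})"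
      unfolding Q by (auto intro!: derivative_eq_intros dx dy simp: algebra_simps)
    \<comment> \<open>In the variable \<open>w = y + \<delta> * x\<close> the contributions of
      \<open>l - \<delta>\<^sup>2\<close> cancel; only the regularising term leaves a cross
      product.\<close>
    have 2: "?Q' + 2 * \<delta> * Q t = 2 * \<epsilon>\<^sup>2 * x t * w + 2 * w * g t"
      unfolding Q w_def by (simp add: algebra_simps power2_eq_square)
    have Qw: "w\<^sup>2 + (\<epsilon> * x t)\<^sup>2 \<le> Q t"
      using l by (simp add: Q w_def power_mult_distrib algebra_simps mult_right_mono)
    have "\<bar>2 * \<epsilon>\<^sup>2 * x t * w\<bar> \<le> \<epsilon> * Q t"
    proof -
      have "2 * \<bar>w\<bar> * \<bar>\<epsilon> * x t\<bar> \<le> w\<^sup>2 + (\<epsilon> * x t)\<^sup>2"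
        using sum_squares_bound[of "\<bar>w\<bar>" "\<bar>\<epsilon> * x t\<bar>"] by simp
      then have "\<epsilon> * (2 * \<bar>w\<bar> * \<bar>\<epsilon> * x t\<bar>) \<le> \<epsilon> * Q t" using Qw eps by (intro mult_left_mono) auto
      then show ?thesis using eps by (simp add: abs_mult power2_eq_square mult_ac)
    qed
    moreover have "\<epsilon> * Q t \<le> 2 * \<epsilon> * Q t" using eps mode_form_nonneg by (simp add: Q_def)
    moreover have "\<bar>2 * w * g t\<bar> \<le> 2 * c * (sqrt (Q t) * \<bar>g t\<bar>)"
    proof -
      have "\<bar>w\<bar> \<le> sqrt (Q t)" using Qw by (intro real_le_rsqrt) (simp, smt (verit) zero_le_power2)
      then have "1 * (\<bar>w\<bar> * \<bar>g t\<bar>) \<le> c * (sqrt (Q t) * \<bar>g t\<bar>)"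
        using c mode_form_nonneg[of \<delta> \<epsilon> r l "x t" "y t"] by (intro mult_mono) (auto simp: Q_def)
      then show ?thesis by (simp add: abs_mult)
    qed
    ultimately have "\<bar>?Q' + 2 * r * Q t\<bar> \<le> 2 * (if r = \<delta> then \<epsilon> else 0) * Q t + 2 * c * (sqrt (Q t) * \<bar>g t\<bar>)"
      unfolding r 2 by (simp only: if_True refl)
    with 1 show ?thesis by blast
  next
    case False
    then have "Q = (\<lambda>_. 0)" using l by (simp add: Q_def mode_form_def)
    then show ?thesis by (intro exI[of _ 0]) simp
  qed
next
  case False
  then have l: "l < \<delta>\<^sup>2" by simp
  let ?w = "2 * sqrt (\<delta>\<^sup>2 - l)"
  note r = rates[OF l]
  have w: "0 < ?w" "1 / ?w \<le> c" using r(2) c(2)[OF l] by (auto simp: field_simps)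
  \<comment> \<open>Both coefficients satisfy the same scalar equation up to the sign
    \<open>\<sigma>\<close> of the forcing.\<close>
  have key: "\<exists>Q'. ((\<lambda>t. (a t)\<^sup>2) has_real_derivative Q') (at t within {0..}) \<and>
      \<bar>Q' + 2 * r * (a t)\<^sup>2\<bar> \<le> 2 * 0 * (a t)\<^sup>2 + 2 * c * (sqrt ((a t)\<^sup>2) * \<bar>g t\<bar>)"
    if a: "(a has_real_derivative - r * a t + \<sigma> * (g t / ?w)) (at t within {0..})" and s: "\<bar>\<sigma>\<bar> = 1" for a \<sigma>
  proof (intro exI conjI)
    show "((\<lambda>t. (a t)\<^sup>2) has_real_derivative 2 * a t * (- r * a t + \<sigma> * (g t / ?w))) (at t within {0..})"
      by (auto intro!: derivative_eq_intros a)
    have "2 * a t * (- r * a t + \<sigma> * (g t / ?w)) + 2 * r * (a t)\<^sup>2 = 2 * a t * (\<sigma> * (g t / ?w))"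
      by (simp add: algebra_simps power2_eq_square)
    also have "\<bar>\<dots>\<bar> = 2 * ((1 / ?w) * (\<bar>a t\<bar> * \<bar>g t\<bar>))" using w s by (simp add: abs_mult)
    also have "\<dots> \<le> 2 * (c * (\<bar>a t\<bar> * \<bar>g t\<bar>))" using w by (intro mult_left_mono mult_right_mono) auto
    finally show "\<bar>2 * a t * (- r * a t + \<sigma> * (g t / ?w)) + 2 * r * (a t)\<^sup>2\<bar>
        \<le> 2 * 0 * (a t)\<^sup>2 + 2 * c * (sqrt ((a t)\<^sup>2) * \<bar>g t\<bar>)" by simp
  qed
  consider "r = slow_rate \<delta> l" | "r = fast_rate \<delta> l" | "r \<noteq> slow_rate \<delta> l" "r \<noteq> fast_rate \<delta> l" by blast
  then show ?thesis
  proof cases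
    case 1
    then have "Q = (\<lambda>t. (slow_coeff \<delta> l (x t) (y t))\<^sup>2)" "r \<noteq> \<delta>" using l r by (auto simp: Q_def mode_form_def)
    then show ?thesis using key[of "\<lambda>t. slow_coeff \<delta> l (x t) (y t)" 1] coeff_deriv(1)[OF sol l t] 1 by simp
  next
    case 2
    then have "Q = (\<lambda>t. (fast_coeff \<delta> l (x t) (y t))\<^sup>2)" "r \<noteq> \<delta>" using l r by (auto simp: Q_def mode_form_def)
    then show ?thesis using key[of "\<lambda>t. fast_coeff \<delta> l (x t) (y t)" "-1"] coeff_deriv(2)[OF sol l t] 2 by simp
  next
    case 3
    then have "Q = (\<lambda>_. 0)" using l by (simp add: Q_def mode_form_def)
    then show ?thesis by (intro exI[of _ 0]) simp
  qed
qed

text \<open>Forms with different regularisations are equivalent with constants independent of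
  \<open>l\<close>. Norms can thus be fixed at \<open>\<epsilon> = 1\<close> while rates are
  estimated with a small \<open>\<epsilon>\<close>.\<close>

lemma mode_form_regularisation:
  assumes "0 < \<epsilon>" "0 < \<epsilon>'"
  shows "mode_form \<delta> \<epsilon> r l x y \<le> (1 + (\<epsilon> / \<epsilon>')\<^sup>2) * mode_form \<delta> \<epsilon>' r l x y"
proof (cases "\<delta>\<^sup>2 \<le> l \<and> r = \<delta>")
  case True
  let ?k = "1 + (\<epsilon> / \<epsilon>')\<^sup>2"
  have k: "1 \<le> ?k" by simp
  have "?k * (l - \<delta>\<^sup>2 + \<epsilon>'\<^sup>2) = (l - \<delta>\<^sup>2) + \<epsilon>\<^sup>2 + (\<epsilon>'\<^sup>2 + (\<epsilon> / \<epsilon>')\<^sup>2 * (l - \<delta>\<^sup>2))"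
  proof -
    have "(\<epsilon> / \<epsilon>')\<^sup>2 * \<epsilon>'\<^sup>2 = \<epsilon>\<^sup>2" using assms by (simp add: power_divide)
    then show ?thesis by (simp only: distrib_right distrib_left) simp
  qed
  then have "l - \<delta>\<^sup>2 + \<epsilon>\<^sup>2 \<le> ?k * (l - \<delta>\<^sup>2 + \<epsilon>'\<^sup>2)" using True by simp
  then have "(l - \<delta>\<^sup>2 + \<epsilon>\<^sup>2) * x\<^sup>2 \<le> ?k * (l - \<delta>\<^sup>2 + \<epsilon>'\<^sup>2) * x\<^sup>2" by (intro mult_right_mono) auto
  moreover have "1 * (y + \<delta> * x)\<^sup>2 \<le> ?k * (y + \<delta> * x)\<^sup>2" using k by (intro mult_right_mono) auto
  moreover have "mode_form \<delta> \<epsilon> r l x y = 1 * (y + \<delta> * x)\<^sup>2 + (l - \<delta>\<^sup>2 + \<epsilon>\<^sup>2) * x\<^sup>2"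
    "mode_form \<delta> \<epsilon>' r l x y = (y + \<delta> * x)\<^sup>2 + (l - \<delta>\<^sup>2 + \<epsilon>'\<^sup>2) * x\<^sup>2"
    using True by (auto simp: mode_form_def)
  moreover have "?k * (A + B * x\<^sup>2) = ?k * A + ?k * B * x\<^sup>2" for A B by (simp only: distrib_left mult.assoc)
  ultimately show ?thesis by (metis add_mono)
next
  case False
  then have "mode_form \<delta> \<epsilon> r l x y = mode_form \<delta> \<epsilon>' r l x y" by (auto simp: mode_form_def)
  then show ?thesis using mult_right_mono[of 1 "1 + (\<epsilon> / \<epsilon>')\<^sup>2" "mode_form \<delta> \<epsilon>' r l x y"] mode_form_nonneg[of \<delta> \<epsilon>' r l x y] by simp
qed

text \<open>The form is definite on the part of the data assigned to \<open>r\<close>, so its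
  vanishing means that this part is zero. Subtracting a pure profile therefore leaves the other
  components untouched.\<close>

lemma mode_form_diff_eq:
  assumes "mode_form \<delta> 1 r l x' y' = 0"
  shows "mode_form \<delta> 1 r l (x - x') (y - y') = mode_form \<delta> 1 r l x y"
proof (cases "\<delta>\<^sup>2 \<le> l")
  case True
  then have "x' = 0 \<and> y' = 0" if "r = \<delta>"
  proof -
    have "0 \<le> (y' + \<delta> * x')\<^sup>2" "0 \<le> (l - \<delta>\<^sup>2) * x'\<^sup>2" using True by auto
    moreover have "(y' + \<delta> * x')\<^sup>2 + ((l - \<delta>\<^sup>2) * x'\<^sup>2 + x'\<^sup>2) = 0"
      using assms True that by (simp add: mode_form_def distrib_right)
    ultimately have "x'\<^sup>2 = 0" "(y' + \<delta> * x')\<^sup>2 = 0"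
      using zero_le_power2[of x'] by linarith+
    then show ?thesis by simp
  qed
  then show ?thesis using True by (auto simp: mode_form_def)
next
  case False
  have *: "slow_coeff \<delta> l (x - x') (y - y') = slow_coeff \<delta> l x y - slow_coeff \<delta> l x' y'"
     "fast_coeff \<delta> l (x - x') (y - y') = fast_coeff \<delta> l x y - fast_coeff \<delta> l x' y'"
    by (simp_all add: slow_coeff_def fast_coeff_def algebra_simps flip: add_divide_distrib diff_divide_distrib)
  show ?thesis using False assms rates(5)[of l \<delta>] by (auto simp: mode_form_def * split: if_splits)
qed

lemma square_diff_le: "(a - b)\<^sup>2 \<le> 2 * a\<^sup>2 + 2 * b\<^sup>2" for a b :: real
  using sum_squares_bound[of a "- b"] by (simp add: power2_diff)

lemma mode_form_diff_le:
  "mode_form \<delta> 1 r l (x - x') (y - y') \<le> 2 * mode_form \<delta> 1 r l x y + 2 * mode_form \<delta> 1 r l x' y'"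
proof (cases "\<delta>\<^sup>2 \<le> l")
  case True
  have "(l - \<delta>\<^sup>2 + 1) * (x - x')\<^sup>2 \<le> (l - \<delta>\<^sup>2 + 1) * (2 * x\<^sup>2 + 2 * x'\<^sup>2)"
    using True by (intro mult_left_mono square_diff_le) auto
  moreover have "(y - y' + \<delta> * (x - x'))\<^sup>2 \<le> 2 * (y + \<delta> * x)\<^sup>2 + 2 * (y' + \<delta> * x')\<^sup>2"
    using square_diff_le[of "y + \<delta> * x" "y' + \<delta> * x'"] by (simp add: algebra_simps)
  ultimately show ?thesis using True by (simp add: mode_form_def algebra_simps)
next
  case False
  have *: "slow_coeff \<delta> l (x - x') (y - y') = slow_coeff \<delta> l x y - slow_coeff \<delta> l x' y'"
     "fast_coeff \<delta> l (x - x') (y - y') = fast_coeff \<delta> l x y - fast_coeff \<delta> l x' y'"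
    by (simp_all add: slow_coeff_def fast_coeff_def algebra_simps flip: add_divide_distrib diff_divide_distrib)
  show ?thesis using False rates(5)[of l \<delta>] square_diff_le by (auto simp: mode_form_def * )
qed

section \<open>Weighted growth estimates for finite systems of forced modes\<close>

locale damped_modes =
  fixes K :: "'k set" and lam :: "'k \<Rightarrow> real" and \<delta> c :: real
  assumes delta: "0 < \<delta>" and c: "1 \<le> c" and lam: "\<And>k. k \<in> K \<Longrightarrow> 0 \<le> lam k"
    and gap: "\<And>k. \<lbrakk>k \<in> K; lam k < \<delta>\<^sup>2\<rbrakk> \<Longrightarrow> 1 \<le> c * (2 * sqrt (\<delta>\<^sup>2 - lam k))"
    and finite_exps: "finite (calD K lam \<delta>)"
begin

definition total_form :: "real \<Rightarrow> real \<Rightarrow> 'k set \<Rightarrow> ('k \<Rightarrow> real \<Rightarrow> real) \<Rightarrow> ('k \<Rightarrow> real \<Rightarrow> real) \<Rightarrow> real \<Rightarrow> real" where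
  "total_form \<epsilon> r F x y t = (\<Sum>k\<in>F. mode_form \<delta> \<epsilon> r (lam k) (x k t) (y k t))"

text \<open>The forcing enters only through a scalar majorant \<open>G\<close> of its Euclidean norm
  over \<open>F\<close>, so that the resulting constants do not depend on \<open>F\<close>.\<close>

definition forced_modes :: "'k set \<Rightarrow> ('k \<Rightarrow> real \<Rightarrow> real) \<Rightarrow> ('k \<Rightarrow> real \<Rightarrow> real) \<Rightarrow> (real \<Rightarrow> real) \<Rightarrow> bool" where
  "forced_modes F x y G \<longleftrightarrow> finite F \<and> F \<subseteq> K \<and> continuous_on {0..} G \<and> (\<forall>t\<ge>0. 0 \<le> G t) \<and>
     (\<exists>g. (\<forall>k\<in>F. mode_sol \<delta> (lam k) (x k) (y k) (g k)) \<and> (\<forall>t\<ge>0. (\<Sum>k\<in>F. (g k t)\<^sup>2) \<le> (G t)\<^sup>2))"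

lemma total_form_nonneg: "0 \<le> total_form \<epsilon> r F x y t"
  unfolding total_form_def by (intro sum_nonneg mode_form_nonneg)

lemma total_form_deriv:
  assumes fm: "forced_modes F x y G" and t: "0 \<le> t" and eps: "0 < \<epsilon>"
  shows "\<exists>Q'. (total_form \<epsilon> r F x y has_real_derivative Q') (at t within {0..}) \<and>
    \<bar>Q' + 2 * r * total_form \<epsilon> r F x y t\<bar> \<le>
      2 * (if r = \<delta> then \<epsilon> else 0) * total_form \<epsilon> r F x y t + 2 * (c * G t) * sqrt (total_form \<epsilon> r F x y t)"
proof -
  obtain g where F: "finite F" "F \<subseteq> K" and G: "0 \<le> G t" "(\<Sum>k\<in>F. (g k t)\<^sup>2) \<le> (G t)\<^sup>2"
    and sol: "\<And>k. k \<in> F \<Longrightarrow> mode_sol \<delta> (lam k) (x k) (y k) (g k)"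
    using fm t unfolding forced_modes_def by blast
  define Q where "Q k t = mode_form \<delta> \<epsilon> r (lam k) (x k t) (y k t)" for k t
  have Q0: "0 \<le> Q k t" for k by (simp add: Q_def mode_form_nonneg)
  define e where "e = (if r = \<delta> then \<epsilon> else 0)"
  have "\<forall>k\<in>F. \<exists>Q'. (Q k has_real_derivative Q') (at t within {0..}) \<and>
    \<bar>Q' + 2 * r * Q k t\<bar> \<le> 2 * e * Q k t + 2 * c * (sqrt (Q k t) * \<bar>g k t\<bar>)"
    unfolding Q_def e_def using mode_form_deriv[OF sol t eps c] gap F by blast
  then obtain Q' where Q': "\<And>k. k \<in> F \<Longrightarrow> (Q k has_real_derivative Q' k) (at t within {0..})"
    "\<And>k. k \<in> F \<Longrightarrow> \<bar>Q' k + 2 * r * Q k t\<bar> \<le> 2 * e * Q k t + 2 * c * (sqrt (Q k t) * \<bar>g k t\<bar>)"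
    by metis
  have tf: "total_form \<epsilon> r F x y = (\<lambda>t. \<Sum>k\<in>F. Q k t)" by (simp add: total_form_def[abs_def] Q_def)
  have d: "((\<lambda>t. \<Sum>k\<in>F. Q k t) has_real_derivative (\<Sum>k\<in>F. Q' k)) (at t within {0..})"
    using Q'(1) by (rule DERIV_sum)
  have CS: "(\<Sum>k\<in>F. sqrt (Q k t) * \<bar>g k t\<bar>) \<le> sqrt (\<Sum>k\<in>F. Q k t) * G t"
  proof -
    have "(\<Sum>k\<in>F. \<bar>sqrt (Q k t)\<bar> * \<bar>\<bar>g k t\<bar>\<bar>) \<le> L2_set (\<lambda>k. sqrt (Q k t)) F * L2_set (\<lambda>k. \<bar>g k t\<bar>) F"
      by (rule L2_set_mult_ineq)
    also have "L2_set (\<lambda>k. sqrt (Q k t)) F = sqrt (\<Sum>k\<in>F. Q k t)" using Q0 by (simp add: L2_set_def)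
    also have "L2_set (\<lambda>k. \<bar>g k t\<bar>) F \<le> G t" using G by (simp add: L2_set_def real_le_lsqrt sum_nonneg)
    finally show ?thesis using Q0 by (simp add: mult_left_mono sum_nonneg)
  qed
  have "\<bar>(\<Sum>k\<in>F. Q' k) + 2 * r * (\<Sum>k\<in>F. Q k t)\<bar> = \<bar>\<Sum>k\<in>F. Q' k + 2 * r * Q k t\<bar>"
    by (simp add: sum.distrib sum_distrib_left)
  also have "\<dots> \<le> (\<Sum>k\<in>F. 2 * e * Q k t + 2 * c * (sqrt (Q k t) * \<bar>g k t\<bar>))"
    using Q'(2) by (intro order_trans[OF sum_abs] sum_mono)
  also have "\<dots> = 2 * e * (\<Sum>k\<in>F. Q k t) + 2 * c * (\<Sum>k\<in>F. sqrt (Q k t) * \<bar>g k t\<bar>)"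
    by (simp add: sum.distrib sum_distrib_left)
  also have "\<dots> \<le> 2 * e * (\<Sum>k\<in>F. Q k t) + 2 * c * (sqrt (\<Sum>k\<in>F. Q k t) * G t)"
    using CS c by (intro add_left_mono mult_left_mono) auto
  finally show ?thesis unfolding tf e_def[symmetric] using d by (intro exI[of _ "\<Sum>k\<in>F. Q' k"]) (simp add: mult_ac)
qed

text \<open>After multiplication by \<open>exp (2 * b * \<tau>)\<close> the homogeneous part of the
  derivative has a sign as soon as \<open>b\<close> stays away from \<open>r\<close> by the loss,
  and the forcing part has the form treated by the square root lemmas. For
  \<open>r \<noteq> \<delta>\<close> there is no loss and \<open>b = r\<close> is allowed.\<close>

lemma total_form_integral_estimates:
  fixes r :: real
  assumes fm: "forced_modes F x y G" and eps: "0 < \<epsilon>" and st: "0 \<le> s" "s \<le> t"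
  defines "loss \<equiv> (if r = \<delta> then \<epsilon> else 0)" and "Q \<equiv> total_form \<epsilon> r F x y"
  shows "b \<le> r - loss \<Longrightarrow> exp (b * t) * sqrt (Q t) \<le> exp (b * s) * sqrt (Q s) + c * integral {s..t} (\<lambda>\<tau>. exp (b * \<tau>) * G \<tau>)"
    and "r + loss \<le> b \<Longrightarrow> exp (b * s) * sqrt (Q s) \<le> exp (b * t) * sqrt (Q t) + c * integral {s..t} (\<lambda>\<tau>. exp (b * \<tau>) * G \<tau>)"
proof -
  have G: "continuous_on {0..} G" "\<And>t. 0 \<le> t \<Longrightarrow> 0 \<le> G t" using fm by (auto simp: forced_modes_def)
  have Q0: "0 \<le> Q t" for t by (simp add: Q_def total_form_nonneg)
  obtain Q' where Q': "\<And>t. 0 \<le> t \<Longrightarrow> (Q has_real_derivative Q' t) (at t within {0..})"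
    "\<And>t. 0 \<le> t \<Longrightarrow> \<bar>Q' t + 2 * r * Q t\<bar> \<le> 2 * loss * Q t + 2 * (c * G t) * sqrt (Q t)"
    using total_form_deriv[OF fm _ eps, of _ r] unfolding Q_def loss_def by metis
  define R where "R \<tau> = exp (2 * b * \<tau>) * Q \<tau>" for \<tau>
  define R' where "R' \<tau> = exp (2 * b * \<tau>) * (Q' \<tau> + 2 * b * Q \<tau>)" for \<tau>
  define h where "h \<tau> = c * (exp (b * \<tau>) * G \<tau>)" for \<tau>
  have sub: "\<tau> \<in> {s..t} \<Longrightarrow> 0 \<le> \<tau>" "{s..t} \<subseteq> {0..}" for \<tau> using st by auto
  have ee: "exp (2 * b * \<tau>) = exp (b * \<tau>) * exp (b * \<tau>)" for \<tau> by (simp flip: exp_add)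
  have sR: "sqrt (R \<tau>) = exp (b * \<tau>) * sqrt (Q \<tau>)" for \<tau> by (simp add: R_def ee real_sqrt_mult)
  have dR: "(R has_real_derivative R' \<tau>) (at \<tau> within {s..t})" if "\<tau> \<in> {s..t}" for \<tau>
    unfolding R_def R'_def using sub that
    by (auto intro!: derivative_eq_intros DERIV_subset[OF Q'(1)] simp: algebra_simps)
  have h: "continuous_on {s..t} h" "\<And>\<tau>. \<tau> \<in> {s..t} \<Longrightarrow> 0 \<le> h \<tau>"
    unfolding h_def using sub c G by (auto intro!: continuous_intros continuous_on_subset[OF G(1)])
  have R0: "0 \<le> R \<tau>" for \<tau> by (simp add: R_def Q0)
  have ih: "integral {s..t} h = c * integral {s..t} (\<lambda>\<tau>. exp (b * \<tau>) * G \<tau>)" by (simp add: h_def[abs_def])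
  have hR: "exp (2 * b * \<tau>) * (2 * (c * G \<tau>) * sqrt (Q \<tau>)) = 2 * h \<tau> * sqrt (R \<tau>)" for \<tau>
    by (simp add: h_def sR ee)
  show "exp (b * t) * sqrt (Q t) \<le> exp (b * s) * sqrt (Q s) + c * integral {s..t} (\<lambda>\<tau>. exp (b * \<tau>) * G \<tau>)"
    if b: "b \<le> r - loss"
    unfolding sR[symmetric] ih[symmetric]
  proof (rule sqrt_growth_upper[OF dR R0 h(2) _ h(1) st(2)])
    fix \<tau> assume t: "\<tau> \<in> {s..t}"
    have "(b - r + loss) * Q \<tau> \<le> 0" using b Q0 by (intro mult_nonpos_nonneg) auto
    then have "Q' \<tau> + 2 * b * Q \<tau> \<le> 2 * (c * G \<tau>) * sqrt (Q \<tau>)"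
      using Q'(2)[OF sub(1)[OF t]] unfolding abs_le_iff by (simp add: algebra_simps)
    then show "R' \<tau> \<le> 2 * h \<tau> * sqrt (R \<tau>)" unfolding R'_def hR[symmetric] by (intro mult_left_mono) auto
  qed auto
  show "exp (b * s) * sqrt (Q s) \<le> exp (b * t) * sqrt (Q t) + c * integral {s..t} (\<lambda>\<tau>. exp (b * \<tau>) * G \<tau>)"
    if b: "r + loss \<le> b"
    unfolding sR[symmetric] ih[symmetric]
  proof (rule sqrt_growth_lower[OF dR R0 h(2) _ h(1) st(2)])
    fix \<tau> assume t: "\<tau> \<in> {s..t}"
    have "(r + loss - b) * Q \<tau> \<le> 0" using b Q0 by (intro mult_nonpos_nonneg) auto
    then have "- (Q' \<tau> + 2 * b * Q \<tau>) \<le> 2 * (c * G \<tau>) * sqrt (Q \<tau>)"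
      using Q'(2)[OF sub(1)[OF t]] unfolding abs_le_iff by (simp add: algebra_simps)
    then have "exp (2 * b * \<tau>) * (- (Q' \<tau> + 2 * b * Q \<tau>)) \<le> exp (2 * b * \<tau>) * (2 * (c * G \<tau>) * sqrt (Q \<tau>))"
      by (intro mult_left_mono) auto
    then show "- R' \<tau> \<le> 2 * h \<tau> * sqrt (R \<tau>)" unfolding R'_def hR[symmetric] by (simp only: mult_minus_right)
  qed auto
qed

text \<open>The price of stating with the form for \<open>\<epsilon> = 1\<close> an estimate proved
  with the form for \<open>\<epsilon>\<close>; it blows up as \<open>\<epsilon>\<close> tends to
  0.\<close>

definition rate_const :: "real \<Rightarrow> real" where
  "rate_const \<epsilon> = sqrt (1 + (1 / \<epsilon>)\<^sup>2) * (sqrt (1 + \<epsilon>\<^sup>2) + c)"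

lemma rate_const_nonneg: "0 \<le> rate_const \<epsilon>"
  using c by (simp add: rate_const_def)

lemma transfer_regularisation:
  assumes eps: "0 < \<epsilon>" and I: "0 \<le> I" and e: "0 \<le> e1" "0 \<le> e2"
    and le: "e1 * sqrt (total_form \<epsilon> r F x y t) \<le> e2 * sqrt (total_form \<epsilon> r F x y s) + c * I"
  shows "e1 * sqrt (total_form 1 r F x y t) \<le> rate_const \<epsilon> * (e2 * sqrt (total_form 1 r F x y s) + I)"
proof -
  have 1: "sqrt (total_form 1 r F x y t) \<le> sqrt (1 + (1 / \<epsilon>)\<^sup>2) * sqrt (total_form \<epsilon> r F x y t)"
    unfolding real_sqrt_mult[symmetric] total_form_def sum_distrib_left
    using mode_form_regularisation[of 1 \<epsilon>] eps by (intro real_sqrt_le_mono sum_mono) auto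
  have 2: "sqrt (total_form \<epsilon> r F x y s) \<le> sqrt (1 + \<epsilon>\<^sup>2) * sqrt (total_form 1 r F x y s)"
    unfolding real_sqrt_mult[symmetric] total_form_def sum_distrib_left
    using mode_form_regularisation[of \<epsilon> 1] eps by (intro real_sqrt_le_mono sum_mono) auto
  let ?k = "sqrt (1 + (1 / \<epsilon>)\<^sup>2)" and ?S = "sqrt (total_form 1 r F x y s)"
  have S: "0 \<le> ?S" using total_form_nonneg by simp
  have "e1 * sqrt (total_form 1 r F x y t) \<le> ?k * (e1 * sqrt (total_form \<epsilon> r F x y t))"
    using mult_left_mono[OF 1 e(1)] by (simp add: mult_ac)
  also have "\<dots> \<le> ?k * (e2 * sqrt (total_form \<epsilon> r F x y s) + c * I)" using le by (intro mult_left_mono) auto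
  also have "\<dots> \<le> ?k * (e2 * (sqrt (1 + \<epsilon>\<^sup>2) * ?S) + c * I)"
    using 2 e by (intro mult_left_mono add_right_mono) auto
  also have "\<dots> \<le> ?k * ((sqrt (1 + \<epsilon>\<^sup>2) + c) * (e2 * ?S + I))"
  proof (rule mult_left_mono)
    have "0 \<le> c * (e2 * ?S)" "0 \<le> sqrt (1 + \<epsilon>\<^sup>2) * I" using c e S I by auto
    then show "e2 * (sqrt (1 + \<epsilon>\<^sup>2) * ?S) + c * I \<le> (sqrt (1 + \<epsilon>\<^sup>2) + c) * (e2 * ?S + I)"
      by (simp add: algebra_simps)
  qed simp
  finally show ?thesis by (simp add: rate_const_def mult.assoc)
qed

lemma forced_modes_integral_nonneg:
  assumes "forced_modes F x y G" "0 \<le> s"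
  shows "0 \<le> integral {s..t} (\<lambda>\<tau>. exp (b * \<tau>) * G \<tau>)"
proof (rule integral_nonneg)
  have "continuous_on {0..} G" using assms by (simp add: forced_modes_def)
  then have "continuous_on {s..t} (\<lambda>\<tau>. exp (b * \<tau>) * G \<tau>)"
    using assms by (intro continuous_intros) (auto elim: continuous_on_subset)
  then show "(\<lambda>\<tau>. exp (b * \<tau>) * G \<tau>) integrable_on {s..t}" by (rule integrable_continuous_real)
qed (use assms in \<open>auto simp: forced_modes_def\<close>)

text \<open>The whole distance \<open>r - b\<close> is spent as regularisation parameter, which
  makes the loss exactly affordable.\<close>

lemma finite_upper_estimate:
  assumes fm: "forced_modes F x y G" and b: "b < r" and st: "0 \<le> s" "s \<le> t"
  shows "exp (b * t) * sqrt (total_form 1 r F x y t) \<le>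
     rate_const (r - b) * (exp (b * s) * sqrt (total_form 1 r F x y s) + integral {s..t} (\<lambda>\<tau>. exp (b * \<tau>) * G \<tau>))"
  using b by (intro transfer_regularisation total_form_integral_estimates(1)[OF fm _ st] forced_modes_integral_nonneg[OF fm st(1)]) auto

lemma finite_lower_estimate:
  assumes fm: "forced_modes F x y G" and a: "r < a" and st: "0 \<le> s" "s \<le> t"
  shows "exp (a * s) * sqrt (total_form 1 r F x y s) \<le>
     rate_const (a - r) * (exp (a * t) * sqrt (total_form 1 r F x y t) + integral {s..t} (\<lambda>\<tau>. exp (a * \<tau>) * G \<tau>))"
  using a by (intro transfer_regularisation total_form_integral_estimates(2)[OF fm _ st] forced_modes_integral_nonneg[OF fm st(1)]) auto

end

text \<open>After completing the square, the imaginary part of the equation forces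
  \<open>Im z = 0\<close> or \<open>Re z = \<delta>\<close>, and the sign of
  \<open>\<delta>\<^sup>2 - l\<close> decides which of the two occurs.\<close>

lemma calD_iff:
  "r \<in> calD K lam \<delta> \<longleftrightarrow> (\<exists>k\<in>K. if \<delta>\<^sup>2 \<le> lam k then r = \<delta>
     else r = slow_rate \<delta> (lam k) \<or> r = fast_rate \<delta> (lam k))"
proof -
  have eq: "z\<^sup>2 - 2 * complex_of_real \<delta> * z + complex_of_real l = 0 \<longleftrightarrow>
      (Re z - \<delta>)\<^sup>2 - (Im z)\<^sup>2 = \<delta>\<^sup>2 - l \<and> (Re z - \<delta>) * Im z = 0" for z l
    by (simp add: complex_eq_iff power2_eq_square algebra_simps)
  have *: "(\<exists>z. r = Re z \<and> z\<^sup>2 - 2 * complex_of_real \<delta> * z + complex_of_real l = 0) \<longleftrightarrow>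
      (if \<delta>\<^sup>2 \<le> l then r = \<delta> else r = slow_rate \<delta> l \<or> r = fast_rate \<delta> l)" for l
  proof (cases "\<delta>\<^sup>2 \<le> l")
    case True
    have "Re z = \<delta>" if "(Re z - \<delta>)\<^sup>2 - (Im z)\<^sup>2 = \<delta>\<^sup>2 - l" "(Re z - \<delta>) * Im z = 0" for z
    proof (rule ccontr)
      assume "Re z \<noteq> \<delta>"
      then have "Im z = 0" and pos: "0 < (Re z - \<delta>)\<^sup>2" using that(2) by auto
      then have "(Re z - \<delta>)\<^sup>2 = \<delta>\<^sup>2 - l" using that(1) by simp
      then show False using pos True by linarith
    qed
    moreover have "\<exists>z. \<delta> = Re z \<and> (Re z - \<delta>)\<^sup>2 - (Im z)\<^sup>2 = \<delta>\<^sup>2 - l \<and> (Re z - \<delta>) * Im z = 0"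
      using True by (intro exI[of _ "Complex \<delta> (sqrt (l - \<delta>\<^sup>2))"]) simp
    ultimately show ?thesis using True unfolding eq by auto
  next
    case False
    then have l: "0 < \<delta>\<^sup>2 - l" by simp
    have "Re z = slow_rate \<delta> l \<or> Re z = fast_rate \<delta> l"
      if "(Re z - \<delta>)\<^sup>2 - (Im z)\<^sup>2 = \<delta>\<^sup>2 - l" "(Re z - \<delta>) * Im z = 0" for z
    proof -
      have "Im z = 0"
      proof (rule ccontr)
        assume "Im z \<noteq> 0"
        then have "Re z - \<delta> = 0" and pos: "0 < (Im z)\<^sup>2" using that(2) by auto
        then have "- (Im z)\<^sup>2 = \<delta>\<^sup>2 - l" using that(1) by simp
        then show False using pos l by linarith
      qed
      then have "\<bar>Re z - \<delta>\<bar> = sqrt (\<delta>\<^sup>2 - l)" using that(1) real_sqrt_abs[of "Re z - \<delta>"] by simp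
      then show ?thesis by (auto simp: slow_rate_def fast_rate_def abs_if split: if_splits)
    qed
    moreover have "\<exists>z. r = Re z \<and> (Re z - \<delta>)\<^sup>2 - (Im z)\<^sup>2 = \<delta>\<^sup>2 - l \<and> (Re z - \<delta>) * Im z = 0"
      if "r = slow_rate \<delta> l \<or> r = fast_rate \<delta> l"
      using that l by (intro exI[of _ "complex_of_real r"]) (auto simp: slow_rate_def fast_rate_def)
    ultimately show ?thesis using False unfolding eq by auto
  qed
  have "r \<in> calD K lam \<delta> \<longleftrightarrow>
      (\<exists>k\<in>K. \<exists>z. r = Re z \<and> z\<^sup>2 - 2 * complex_of_real \<delta> * z + complex_of_real (lam k) = 0)"
    unfolding calD_def spec_def by blast
  then show ?thesis unfolding * .
qed

lemma finite_calD:
  assumes "finite (lam ` K \<inter> {..\<delta>\<^sup>2})"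
  shows "finite (calD K lam \<delta>)"
proof (rule finite_subset)
  show "calD K lam \<delta> \<subseteq> {\<delta>} \<union> slow_rate \<delta> ` (lam ` K \<inter> {..\<delta>\<^sup>2}) \<union> fast_rate \<delta> ` (lam ` K \<inter> {..\<delta>\<^sup>2})"
    by (auto simp: calD_iff split: if_splits)
qed (use assms in auto)

text \<open>Only finitely many distinct eigenvalues lie below \<open>\<delta>\<^sup>2\<close>, so
  the reciprocals have a maximum even if eigenspaces are infinite dimensional.\<close>

lemma exists_gap_constant:
  assumes "finite (lam ` K \<inter> {..\<delta>\<^sup>2})"
  shows "\<exists>c\<ge>1. \<forall>k\<in>K. lam k < \<delta>\<^sup>2 \<longrightarrow> 1 \<le> c * (2 * sqrt (\<delta>\<^sup>2 - lam k))"
proof -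
  define S where "S = insert 1 ((\<lambda>l. 1 / (2 * sqrt (\<delta>\<^sup>2 - l))) ` (lam ` K \<inter> {..\<delta>\<^sup>2}))"
  have S: "finite S" using assms by (simp add: S_def)
  have "1 \<le> Max S * (2 * sqrt (\<delta>\<^sup>2 - lam k))" if "k \<in> K" "lam k < \<delta>\<^sup>2" for k
  proof -
    have "1 / (2 * sqrt (\<delta>\<^sup>2 - lam k)) \<le> Max S" using S that by (intro Max_ge) (auto simp: S_def)
    then show ?thesis using that by (simp add: field_simps)
  qed
  moreover have "1 \<le> Max S" using S by (intro Max_ge) (auto simp: S_def)
  ultimately show ?thesis by blast
qed

section \<open>Limits at infinity of a single forced mode\<close>

text \<open>The limits \<open>X\<close>, \<open>W\<close> are those of the solution carried back to time \<open>0\<close> by the homogeneous flow,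
  a rotation of frequency \<open>sqrt (l - \<delta>\<^sup>2)\<close> that degenerates to a shear at the double root.\<close>

lemma oscillating_mode_limit:
  assumes sol: "mode_sol \<delta> l x y g" and l: "\<delta>\<^sup>2 \<le> l" and delta: "0 < \<delta>"
    and g: "\<And>t. 0 \<le> t \<Longrightarrow> \<bar>g t\<bar> \<le> M * exp (- \<kappa> * t)" and kappa: "\<delta> < \<kappa>"
  shows "\<exists>vx vy. mode_sol \<delta> l vx vy (\<lambda>_. 0) \<and>
    (\<forall>a<\<delta> + (\<kappa> - \<delta>) / 4. ((\<lambda>t. exp (a * t) * sqrt (mode_form \<delta> 1 \<delta> l (x t - vx t) (y t - vy t))) \<longlongrightarrow> 0) at_top)"
proof -
  define \<phi> where "\<phi> = sqrt (l - \<delta>\<^sup>2)"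
  have phi: "0 \<le> \<phi>" "\<phi>\<^sup>2 = l - \<delta>\<^sup>2" using l by (auto simp: \<phi>_def)
  \<comment> \<open>\<open>C\<close> and \<open>S\<close> are the entries of the fundamental matrix
    of \<open>x' = w\<close>, \<open>w' = - \<phi>\<^sup>2 * x\<close>; dividing the sine by
    \<open>\<phi>\<close> keeps one formula for the double root, where
    \<open>S t = t\<close>.\<close>
  define C where "C t = cos (\<phi> * t)" for t
  define S where "S t = (if \<phi> = 0 then t else sin (\<phi> * t) / \<phi>)" for t
  have dC: "(C has_real_derivative - \<phi>\<^sup>2 * S t) (at t within A)" for t A
    unfolding C_def S_def by (auto intro!: derivative_eq_intros simp: power2_eq_square)
  have dS: "(S has_real_derivative C t) (at t within A)" for t A
  proof (cases "\<phi> = 0")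
    case True
    then show ?thesis by (simp add: S_def[abs_def] C_def)
  next
    case False
    then have "((\<lambda>t. sin (\<phi> * t) / \<phi>) has_real_derivative cos (\<phi> * t)) (at t within A)"
      by (auto intro!: derivative_eq_intros)
    then show ?thesis using False by (simp add: S_def[abs_def] C_def)
  qed
  have pyth: "(C t)\<^sup>2 + \<phi>\<^sup>2 * (S t)\<^sup>2 = 1" for t
    by (simp add: C_def S_def power_divide)
  have C1: "\<bar>C t\<bar> \<le> 1" for t by (simp add: C_def)
  have S1: "\<bar>S t\<bar> \<le> t" if "0 \<le> t" for t
  proof (cases "\<phi> = 0")
    case False
    then show ?thesis using phi that abs_sin_x_le_abs_x[of "\<phi> * t"] by (simp add: S_def abs_mult field_simps)
  qed (use that in \<open>simp add: S_def\<close>)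
  define w where "w t = y t + \<delta> * x t" for t
  have dx: "(x has_real_derivative w t - \<delta> * x t) (at t within {0..})"
    and dw: "(w has_real_derivative - \<delta> * w t - \<phi>\<^sup>2 * x t + g t) (at t within {0..})" if "0 \<le> t" for t
  proof -
    have 1: "(x has_real_derivative y t) (at t within {0..})"
      "(y has_real_derivative - 2 * \<delta> * y t - l * x t + g t) (at t within {0..})"
      using sol that by (auto simp: mode_sol_def)
    show "(x has_real_derivative w t - \<delta> * x t) (at t within {0..})" using 1 by (simp add: w_def)
    have "(w has_real_derivative (- 2 * \<delta> * y t - l * x t + g t) + \<delta> * y t) (at t within {0..})"
      unfolding w_def by (auto intro!: derivative_eq_intros 1)
    moreover have "(- 2 * \<delta> * y t - l * x t + g t) + \<delta> * y t = - \<delta> * w t - \<phi>\<^sup>2 * x t + g t"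
      unfolding phi(2) w_def by (simp add: algebra_simps power2_eq_square)
    ultimately show "(w has_real_derivative - \<delta> * w t - \<phi>\<^sup>2 * x t + g t) (at t within {0..})" by (simp only:)
  qed
  define X where "X t = exp (\<delta> * t) * (C t * x t - S t * w t)" for t
  define W where "W t = exp (\<delta> * t) * (\<phi>\<^sup>2 * S t * x t + C t * w t)" for t
  have dX: "(X has_real_derivative - exp (\<delta> * t) * (S t * g t)) (at t within {0..})" if "0 \<le> t" for t
    unfolding X_def by (auto intro!: derivative_eq_intros dC dS dx[OF that] dw[OF that] simp: algebra_simps)
  have dW: "(W has_real_derivative exp (\<delta> * t) * (C t * g t)) (at t within {0..})" if "0 \<le> t" for t
    unfolding W_def by (auto intro!: derivative_eq_intros dC dS dx[OF that] dw[OF that] simp: algebra_simps)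
  \<comment> \<open>\<open>S\<close> may grow linearly. Half of the gap
    \<open>\<kappa> - \<delta>\<close> pays for it when going back to time 0, and half of the
    remaining half, called \<open>\<zeta>\<close> below, pays for it when flowing forward again;
    hence the quarter in the statement.\<close>
  define \<eta> where "\<eta> = (\<kappa> - \<delta>) / 2"
  have eta: "0 < \<eta>" using kappa by (simp add: \<eta>_def)
  have M: "0 \<le> M" using g[of 0] by simp
  have texp: "t \<le> exp (\<eta> * t) / \<eta>" for t
  proof -
    have "\<eta> * t \<le> exp (\<eta> * t)" using exp_ge_add_one_self[of "\<eta> * t"] by linarith
    then show ?thesis using eta by (simp add: field_simps)
  qed
  have expe: "exp (\<delta> * t) * (M * exp (- \<kappa> * t)) = M * exp (- 2 * \<eta> * t)" for t
    by (simp add: \<eta>_def algebra_simps flip: exp_add)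
  have bX: "\<bar>- exp (\<delta> * t) * (S t * g t)\<bar> \<le> M / \<eta> * exp (- \<eta> * t)" if t: "0 \<le> t" for t
  proof -
    have "\<bar>S t\<bar> * \<bar>g t\<bar> \<le> (exp (\<eta> * t) / \<eta>) * (M * exp (- \<kappa> * t))"
      using S1[OF t] texp[of t] g[OF t] M by (intro mult_mono) auto
    then have "exp (\<delta> * t) * (\<bar>S t\<bar> * \<bar>g t\<bar>) \<le> exp (\<delta> * t) * ((exp (\<eta> * t) / \<eta>) * (M * exp (- \<kappa> * t)))"
      by (intro mult_left_mono) auto
    also have "\<dots> = (exp (\<eta> * t) / \<eta>) * (M * exp (- 2 * \<eta> * t))" unfolding expe[symmetric] by simp
    also have "\<dots> = M / \<eta> * exp (- \<eta> * t)" by (simp flip: exp_add)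
    finally show ?thesis by (simp add: abs_mult)
  qed
  have bW: "\<bar>exp (\<delta> * t) * (C t * g t)\<bar> \<le> M * exp (- \<eta> * t)" if t: "0 \<le> t" for t
  proof -
    have "\<bar>C t\<bar> * \<bar>g t\<bar> \<le> 1 * (M * exp (- \<kappa> * t))" using C1 g[OF t] by (intro mult_mono) auto
    then have "exp (\<delta> * t) * (\<bar>C t\<bar> * \<bar>g t\<bar>) \<le> exp (\<delta> * t) * (1 * (M * exp (- \<kappa> * t)))" by (intro mult_left_mono) auto
    also have "\<dots> = M * exp (- 2 * \<eta> * t)" using expe[of t] by simp
    also have "\<dots> \<le> M * exp (- \<eta> * t)" using eta M t by (intro mult_left_mono) auto
    finally show ?thesis by (simp add: abs_mult)
  qed
  obtain X0 where X0: "\<And>t. 0 \<le> t \<Longrightarrow> \<bar>X t - X0\<bar> \<le> M / \<eta> / \<eta> * exp (- \<eta> * t)"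
    using exp_rate_limit[OF dX bX eta] by blast
  obtain W0 where W0: "\<And>t. 0 \<le> t \<Longrightarrow> \<bar>W t - W0\<bar> \<le> M / \<eta> * exp (- \<eta> * t)"
    using exp_rate_limit[OF dW bW eta] by blast
  \<comment> \<open>The homogeneous flow started at time 0 from the limits \<open>X0\<close> and
    \<open>W0\<close>.\<close>
  define vx where "vx t = exp (- \<delta> * t) * (C t * X0 + S t * W0)" for t
  define vw where "vw t = exp (- \<delta> * t) * (- \<phi>\<^sup>2 * S t * X0 + C t * W0)" for t
  define vy where "vy t = vw t - \<delta> * vx t" for t
  have dvx: "(vx has_real_derivative vw t - \<delta> * vx t) (at t within {0..})" for t
    unfolding vx_def vw_def by (auto intro!: derivative_eq_intros dC dS simp: algebra_simps)
  have dvw: "(vw has_real_derivative - \<delta> * vw t - \<phi>\<^sup>2 * vx t) (at t within {0..})" for t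
    unfolding vx_def vw_def by (auto intro!: derivative_eq_intros dC dS simp: algebra_simps)
  have "(vy has_real_derivative - 2 * \<delta> * vy t - l * vx t + 0) (at t within {0..})" for t
  proof -
    have "(vy has_real_derivative (- \<delta> * vw t - \<phi>\<^sup>2 * vx t) - \<delta> * (vw t - \<delta> * vx t)) (at t within {0..})"
      unfolding vy_def by (auto intro!: derivative_eq_intros dvx dvw)
    moreover have "(- \<delta> * vw t - \<phi>\<^sup>2 * vx t) - \<delta> * (vw t - \<delta> * vx t) = - 2 * \<delta> * vy t - l * vx t + 0"
      unfolding phi(2) vy_def by (simp add: algebra_simps power2_eq_square)
    ultimately show ?thesis by (simp only:)
  qed
  then have sol': "mode_sol \<delta> l vx vy (\<lambda>_. 0)" using dvx by (simp add: mode_sol_def vy_def)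
  have ee: "exp (- \<delta> * t) * exp (\<delta> * t) = 1" for t by (simp flip: exp_add)
  have x_eq: "x t = exp (- \<delta> * t) * (C t * X t + S t * W t)" for t
  proof -
    have "exp (- \<delta> * t) * (C t * X t + S t * W t) = exp (- \<delta> * t) * exp (\<delta> * t) * (((C t)\<^sup>2 + \<phi>\<^sup>2 * (S t)\<^sup>2) * x t)"
      unfolding X_def W_def by (simp add: algebra_simps power2_eq_square)
    then show ?thesis unfolding ee pyth by simp
  qed
  have w_eq: "w t = exp (- \<delta> * t) * (- \<phi>\<^sup>2 * S t * X t + C t * W t)" for t
  proof -
    have "exp (- \<delta> * t) * (- \<phi>\<^sup>2 * S t * X t + C t * W t) = exp (- \<delta> * t) * exp (\<delta> * t) * (((C t)\<^sup>2 + \<phi>\<^sup>2 * (S t)\<^sup>2) * w t)"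
      unfolding X_def W_def by (simp add: algebra_simps power2_eq_square)
    then show ?thesis unfolding ee pyth by simp
  qed
  define \<zeta> where "\<zeta> = \<eta> / 2"
  have zeta: "0 < \<zeta>" "\<eta> - \<zeta> = \<zeta>" using eta by (auto simp: \<zeta>_def)
  define B where "B = M / \<eta> / \<eta> + (1 / \<zeta>) * (M / \<eta>) + \<phi>\<^sup>2 * (1 / \<zeta>) * (M / \<eta> / \<eta>) + M / \<eta>"
  have tz: "t \<le> exp (\<zeta> * t) / \<zeta>" for t
  proof -
    have "\<zeta> * t \<le> exp (\<zeta> * t)" using exp_ge_add_one_self[of "\<zeta> * t"] by linarith
    then show ?thesis using zeta(1) by (simp add: field_simps)
  qed
  have Sz: "\<bar>S t\<bar> * (m * exp (- \<eta> * t)) \<le> (1 / \<zeta>) * m * exp (- \<zeta> * t)" if t: "0 \<le> t" and m: "0 \<le> m" for t m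
  proof -
    have "\<bar>S t\<bar> * (m * exp (- \<eta> * t)) \<le> (exp (\<zeta> * t) / \<zeta>) * (m * exp (- \<eta> * t))"
      using S1[OF t] tz[of t] m by (intro mult_right_mono) auto
    also have "\<dots> = (1 / \<zeta>) * m * (exp (\<zeta> * t) * exp (- \<eta> * t))" by simp
    also have "exp (\<zeta> * t) * exp (- \<eta> * t) = exp (- \<zeta> * t)" by (simp add: \<zeta>_def flip: exp_add)
    finally show ?thesis .
  qed
  have Cz: "\<bar>C t\<bar> * (m * exp (- \<eta> * t)) \<le> m * exp (- \<zeta> * t)" if t: "0 \<le> t" and m: "0 \<le> m" for t m
  proof -
    have "\<bar>C t\<bar> * (m * exp (- \<eta> * t)) \<le> 1 * (m * exp (- \<zeta> * t))"
      using C1 m t zeta eta by (intro mult_mono mult_left_mono) (auto simp: \<zeta>_def)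
    then show ?thesis by simp
  qed
  have M': "0 \<le> M / \<eta>" "0 \<le> M / \<eta> / \<eta>" using M eta by auto
  have bx: "\<bar>x t - vx t\<bar> \<le> B * exp (- (\<delta> + \<zeta>) * t)" and bw: "\<bar>w t - vw t\<bar> \<le> B * exp (- (\<delta> + \<zeta>) * t)" if t: "0 \<le> t" for t
  proof -
    have e2: "exp (- \<delta> * t) * (B * exp (- \<zeta> * t)) = B * exp (- (\<delta> + \<zeta>) * t)"
      by (simp add: algebra_simps flip: exp_add)
    have CX: "\<bar>C t\<bar> * \<bar>X t - X0\<bar> \<le> M / \<eta> / \<eta> * exp (- \<zeta> * t)"
      using mult_left_mono[OF X0[OF t], of "\<bar>C t\<bar>"] Cz[OF t M'(2)] by linarith
    have SW: "\<bar>S t\<bar> * \<bar>W t - W0\<bar> \<le> (1 / \<zeta>) * (M / \<eta>) * exp (- \<zeta> * t)"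
      using mult_left_mono[OF W0[OF t], of "\<bar>S t\<bar>"] Sz[OF t M'(1)] by linarith
    have SX: "\<bar>S t\<bar> * \<bar>X t - X0\<bar> \<le> (1 / \<zeta>) * (M / \<eta> / \<eta>) * exp (- \<zeta> * t)"
      using mult_left_mono[OF X0[OF t], of "\<bar>S t\<bar>"] Sz[OF t M'(2)] by linarith
    have CW: "\<bar>C t\<bar> * \<bar>W t - W0\<bar> \<le> M / \<eta> * exp (- \<zeta> * t)"
      using mult_left_mono[OF W0[OF t], of "\<bar>C t\<bar>"] Cz[OF t M'(1)] by linarith
    have pSX: "\<phi>\<^sup>2 * (\<bar>S t\<bar> * \<bar>X t - X0\<bar>) \<le> \<phi>\<^sup>2 * ((1 / \<zeta>) * (M / \<eta> / \<eta>) * exp (- \<zeta> * t))"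
      using SX by (intro mult_left_mono) auto
    have nn: "0 \<le> (1 / \<zeta>) * (M / \<eta>) * exp (- \<zeta> * t)" "0 \<le> \<phi>\<^sup>2 * ((1 / \<zeta>) * (M / \<eta> / \<eta>) * exp (- \<zeta> * t))"
      "0 \<le> M / \<eta> * exp (- \<zeta> * t)" "0 \<le> M / \<eta> / \<eta> * exp (- \<zeta> * t)"
      using M eta zeta(1) by simp_all
    have Bsum: "B * exp (- \<zeta> * t) = M / \<eta> / \<eta> * exp (- \<zeta> * t) + (1 / \<zeta>) * (M / \<eta>) * exp (- \<zeta> * t)
        + \<phi>\<^sup>2 * ((1 / \<zeta>) * (M / \<eta> / \<eta>) * exp (- \<zeta> * t)) + M / \<eta> * exp (- \<zeta> * t)"
      unfolding B_def by (simp only: distrib_right mult.assoc)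
    have "x t - vx t = exp (- \<delta> * t) * (C t * (X t - X0) + S t * (W t - W0))"
      using x_eq[of t] by (simp add: vx_def algebra_simps)
    then have "\<bar>x t - vx t\<bar> = exp (- \<delta> * t) * \<bar>C t * (X t - X0) + S t * (W t - W0)\<bar>" by (simp add: abs_mult)
    also have "\<dots> \<le> exp (- \<delta> * t) * (B * exp (- \<zeta> * t))"
    proof (rule mult_left_mono)
      have "\<bar>C t * (X t - X0) + S t * (W t - W0)\<bar> \<le> \<bar>C t\<bar> * \<bar>X t - X0\<bar> + \<bar>S t\<bar> * \<bar>W t - W0\<bar>"
        by (rule order_trans[OF abs_triangle_ineq]) (simp add: abs_mult)
      then show "\<bar>C t * (X t - X0) + S t * (W t - W0)\<bar> \<le> B * exp (- \<zeta> * t)"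
        unfolding Bsum using CX SW nn by linarith
    qed simp
    finally show "\<bar>x t - vx t\<bar> \<le> B * exp (- (\<delta> + \<zeta>) * t)" unfolding e2 .
    have "w t - vw t = exp (- \<delta> * t) * (C t * (W t - W0) - \<phi>\<^sup>2 * (S t * (X t - X0)))"
      using w_eq[of t] by (simp add: vw_def algebra_simps)
    then have "\<bar>w t - vw t\<bar> = exp (- \<delta> * t) * \<bar>C t * (W t - W0) - \<phi>\<^sup>2 * (S t * (X t - X0))\<bar>" by (simp add: abs_mult)
    also have "\<dots> \<le> exp (- \<delta> * t) * (B * exp (- \<zeta> * t))"
    proof (rule mult_left_mono)
      have "\<bar>C t * (W t - W0) - \<phi>\<^sup>2 * (S t * (X t - X0))\<bar> \<le> \<bar>C t\<bar> * \<bar>W t - W0\<bar> + \<phi>\<^sup>2 * (\<bar>S t\<bar> * \<bar>X t - X0\<bar>)"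
        by (rule order_trans[OF abs_triangle_ineq4]) (simp add: abs_mult)
      then show "\<bar>C t * (W t - W0) - \<phi>\<^sup>2 * (S t * (X t - X0))\<bar> \<le> B * exp (- \<zeta> * t)"
        unfolding Bsum using CW pSX nn by linarith
    qed simp
    finally show "\<bar>w t - vw t\<bar> \<le> B * exp (- (\<delta> + \<zeta>) * t)" unfolding e2 .
  qed
  have B0: "0 \<le> B" using bx[of 0] by simp
  have "exp_decay (\<lambda>t. sqrt (mode_form \<delta> 1 \<delta> l (x t - vx t) (y t - vy t))) (\<delta> + \<zeta>)"
  proof (rule exp_decayI[where M = "sqrt (2 + \<phi>\<^sup>2) * B"])
    fix t :: real assume t: "0 \<le> t"
    let ?E = "B * exp (- (\<delta> + \<zeta>) * t)"
    have E: "0 \<le> ?E" using B0 by simp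
    have "mode_form \<delta> 1 \<delta> l (x t - vx t) (y t - vy t) = (w t - vw t)\<^sup>2 + (\<phi>\<^sup>2 + 1) * (x t - vx t)\<^sup>2"
      using l by (simp add: mode_form_def phi(2) w_def vy_def algebra_simps)
    also have "\<dots> \<le> ?E\<^sup>2 + (\<phi>\<^sup>2 + 1) * ?E\<^sup>2"
      using bx[OF t] bw[OF t] E by (intro add_mono mult_left_mono abs_le_square_iff[THEN iffD1]) auto
    also have "\<dots> = (2 + \<phi>\<^sup>2) * ?E\<^sup>2" by (simp add: algebra_simps)
    finally have "sqrt (mode_form \<delta> 1 \<delta> l (x t - vx t) (y t - vy t)) \<le> sqrt ((2 + \<phi>\<^sup>2) * ?E\<^sup>2)" by simp
    also have "\<dots> = sqrt (2 + \<phi>\<^sup>2) * ?E" using E by (simp only: real_sqrt_mult real_sqrt_abs abs_of_nonneg)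
    finally show "sqrt (mode_form \<delta> 1 \<delta> l (x t - vx t) (y t - vy t)) \<le> sqrt (2 + \<phi>\<^sup>2) * B * exp (- (\<delta> + \<zeta>) * t)"
      by (simp only: mult.assoc)
  qed
  moreover have "\<delta> + \<zeta> = \<delta> + (\<kappa> - \<delta>) / 4" by (simp add: \<zeta>_def \<eta>_def)
  ultimately show ?thesis using sol' by (intro exI[of _ vx] exI[of _ vy]) (auto intro!: exp_decay_tendsto mode_form_nonneg)
qed

text \<open>The product \<open>exp (r * t) * a t\<close> has a derivative decaying at the rate
  \<open>\<kappa> - r\<close>; its limit is \<open>\<alpha>\<close>. Without a double root the full
  rate \<open>\<kappa>\<close> is kept.\<close>

lemma exponential_mode_limit:
  assumes a: "\<And>t. 0 \<le> t \<Longrightarrow> (a has_real_derivative - r * a t + h t) (at t within {0..})"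
    and h: "\<And>t. 0 \<le> t \<Longrightarrow> \<bar>h t\<bar> \<le> M * exp (- \<kappa> * t)" and kappa: "r < \<kappa>"
  shows "\<exists>\<alpha>. exp_decay (\<lambda>t. \<bar>a t - \<alpha> * exp (- r * t)\<bar>) \<kappa>"
proof -
  have d: "((\<lambda>t. exp (r * t) * a t) has_real_derivative exp (r * t) * h t) (at t within {0..})" if "0 \<le> t" for t
    by (auto intro!: derivative_eq_intros a that simp: algebra_simps)
  have b: "\<bar>exp (r * t) * h t\<bar> \<le> M * exp (- (\<kappa> - r) * t)" if t: "0 \<le> t" for t
  proof -
    have "exp (r * t) * \<bar>h t\<bar> \<le> exp (r * t) * (M * exp (- \<kappa> * t))" using h[OF t] by (intro mult_left_mono) auto
    also have "\<dots> = M * exp (- (\<kappa> - r) * t)" by (simp add: algebra_simps flip: exp_add)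
    finally show ?thesis by (simp add: abs_mult)
  qed
  have kr: "0 < \<kappa> - r" using kappa by simp
  obtain \<alpha> where al: "\<And>t. 0 \<le> t \<Longrightarrow> \<bar>exp (r * t) * a t - \<alpha>\<bar> \<le> M / (\<kappa> - r) * exp (- (\<kappa> - r) * t)"
    using exp_rate_limit[OF d b kr] by blast
  have "exp_decay (\<lambda>t. \<bar>a t - \<alpha> * exp (- r * t)\<bar>) \<kappa>"
  proof (rule exp_decayI[where M = "M / (\<kappa> - r)"])
    fix t :: real assume t: "0 \<le> t"
    have ee: "exp (- r * t) * exp (r * t) = 1" by (simp flip: exp_add)
    have "a t - \<alpha> * exp (- r * t) = (exp (- r * t) * exp (r * t)) * a t - \<alpha> * exp (- r * t)" unfolding ee by simp
    also have "\<dots> = exp (- r * t) * (exp (r * t) * a t - \<alpha>)" by (simp add: algebra_simps)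
    finally have "\<bar>a t - \<alpha> * exp (- r * t)\<bar> = exp (- r * t) * \<bar>exp (r * t) * a t - \<alpha>\<bar>" by (simp add: abs_mult)
    also have "\<dots> \<le> exp (- r * t) * (M / (\<kappa> - r) * exp (- (\<kappa> - r) * t))" using al[OF t] by (intro mult_left_mono) auto
    also have "\<dots> = M / (\<kappa> - r) * (exp (- r * t) * exp (- (\<kappa> - r) * t))" by simp
    also have "exp (- r * t) * exp (- (\<kappa> - r) * t) = exp (- \<kappa> * t)" by (simp add: algebra_simps flip: exp_add)
    finally show "\<bar>a t - \<alpha> * exp (- r * t)\<bar> \<le> M / (\<kappa> - r) * exp (- \<kappa> * t)" .
  qed
  then show ?thesis ..
qed

lemma exponential_mode_sol:
  assumes "r\<^sup>2 - 2 * \<delta> * r + l = 0"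
  shows "mode_sol \<delta> l (\<lambda>t. \<alpha> * exp (- r * t)) (\<lambda>t. - r * (\<alpha> * exp (- r * t))) (\<lambda>_. 0)"
proof -
  have l: "l = 2 * \<delta> * r - r * r" using assms by (simp add: power2_eq_square)
  have "- r * (\<alpha> * (exp (- r * t) * (- r))) = - 2 * \<delta> * (- r * (\<alpha> * exp (- r * t))) - l * (\<alpha> * exp (- r * t)) + 0" for t
    unfolding l by (simp add: algebra_simps)
  moreover have "((\<lambda>t. - r * (\<alpha> * exp (- r * t))) has_real_derivative - r * (\<alpha> * (exp (- r * t) * (- r)))) (at t within A)" for t A
    by (auto intro!: derivative_eq_intros)
  moreover have "((\<lambda>t. \<alpha> * exp (- r * t)) has_real_derivative - r * (\<alpha> * exp (- r * t))) (at t within A)" for t A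
    by (auto intro!: derivative_eq_intros)
  ultimately show ?thesis unfolding mode_sol_def by simp
qed

lemma rate_quadratic:
  assumes "l < \<delta>\<^sup>2" "r = slow_rate \<delta> l \<or> r = fast_rate \<delta> l"
  shows "r\<^sup>2 - 2 * \<delta> * r + l = 0"
  using assms(2) rates(3)[OF assms(1)] unfolding rates(4)[OF assms(1), symmetric]
  by (auto simp: power2_eq_square algebra_simps)

lemma coeffs_of_exponential:
  assumes "l < \<delta>\<^sup>2"
  shows "slow_coeff \<delta> l z (- slow_rate \<delta> l * z) = z" "fast_coeff \<delta> l z (- slow_rate \<delta> l * z) = 0"
    "slow_coeff \<delta> l z (- fast_rate \<delta> l * z) = 0" "fast_coeff \<delta> l z (- fast_rate \<delta> l * z) = z"
proof -
  let ?d = "fast_rate \<delta> l - slow_rate \<delta> l"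
  have d: "?d \<noteq> 0" using rates(5)[OF assms] by simp
  have 1: "fast_rate \<delta> l * z + - slow_rate \<delta> l * z = ?d * z" by (simp add: algebra_simps)
  have 2: "- (slow_rate \<delta> l * z + - fast_rate \<delta> l * z) = ?d * z" by (simp add: algebra_simps)
  show "slow_coeff \<delta> l z (- slow_rate \<delta> l * z) = z" unfolding slow_coeff_def 1 using d by simp
  show "fast_coeff \<delta> l z (- fast_rate \<delta> l * z) = z" unfolding fast_coeff_def 2 using d by simp
qed (simp_all add: slow_coeff_def fast_coeff_def)

text \<open>Only a qualitative limit is claimed, because the constants behind it depend on the mode
  through its frequency. Uniform rates are recovered later by integrating from infinity, where this
  limit serves as the vanishing boundary term.\<close>

lemma mode_limit:
  assumes sol: "mode_sol \<delta> l x y g" and delta: "0 < \<delta>"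
    and g: "\<And>t. 0 \<le> t \<Longrightarrow> \<bar>g t\<bar> \<le> M * exp (- \<kappa> * t)" and kappa: "r0 < \<kappa>"
  shows "\<exists>vx vy. mode_sol \<delta> l vx vy (\<lambda>_. 0) \<and>
    (\<forall>t\<ge>0. \<forall>r. r \<noteq> r0 \<longrightarrow> mode_form \<delta> 1 r l (vx t) (vy t) = 0) \<and>
    (\<forall>a<r0 + (\<kappa> - r0) / 4. ((\<lambda>t. exp (a * t) * sqrt (mode_form \<delta> 1 r0 l (x t - vx t) (y t - vy t))) \<longlongrightarrow> 0) at_top)"
    (is "\<exists>vx vy. ?P vx vy")
proof (cases "\<delta>\<^sup>2 \<le> l \<and> r0 = \<delta>")
  case True
  then obtain vx vy where "mode_sol \<delta> l vx vy (\<lambda>_. 0)"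
    "\<forall>a<\<delta> + (\<kappa> - \<delta>) / 4. ((\<lambda>t. exp (a * t) * sqrt (mode_form \<delta> 1 \<delta> l (x t - vx t) (y t - vy t))) \<longlongrightarrow> 0) at_top"
    using oscillating_mode_limit[OF sol _ delta g] kappa by blast
  then show ?thesis using True by (intro exI[of _ vx] exI[of _ vy]) (auto simp: mode_form_def)
next
  case no_osc: False
  show ?thesis
  proof (cases "l < \<delta>\<^sup>2 \<and> (r0 = slow_rate \<delta> l \<or> r0 = fast_rate \<delta> l)")
    case True
    then have l: "l < \<delta>\<^sup>2" by simp
    let ?w = "2 * sqrt (\<delta>\<^sup>2 - l)"
    have w: "0 < ?w" using rates(2)[OF l] by simp
    have gw: "\<bar>\<sigma> * (g t / ?w)\<bar> \<le> M / ?w * exp (- \<kappa> * t)" if "0 \<le> t" "\<bar>\<sigma>\<bar> = 1" for t \<sigma>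
      using divide_right_mono[OF g[OF that(1)], of ?w] w that by (simp add: abs_mult)
    \<comment> \<open>Common packaging of the two overdamped cases: \<open>a\<close> is the
      coefficient that belongs to \<open>r0\<close>, and \<open>\<sigma>\<close> the sign with which
      the forcing enters its equation.\<close>
    obtain a where a: "exp_decay (\<lambda>t. \<bar>a t - \<alpha> * exp (- r0 * t)\<bar>) \<kappa> \<Longrightarrow>
        ?P (\<lambda>t. \<alpha> * exp (- r0 * t)) (\<lambda>t. - r0 * (\<alpha> * exp (- r0 * t)))"
      and da: "\<exists>\<sigma>. \<bar>\<sigma>\<bar> = 1 \<and> (\<forall>t\<ge>0. (a has_real_derivative - r0 * a t + \<sigma> * (g t / ?w)) (at t within {0..}))" for \<alpha>
    proof -
      have lim: "\<forall>a<r0 + (\<kappa> - r0) / 4. ((\<lambda>t. exp (a * t) * sqrt (f t)) \<longlongrightarrow> 0) at_top"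
        if "exp_decay h \<kappa>" "\<And>t. sqrt (f t) = h t" "\<And>t. 0 \<le> h t" for f h :: "real \<Rightarrow> real"
      proof (intro allI impI)
        fix a assume "a < r0 + (\<kappa> - r0) / 4"
        then have "a < \<kappa>" using kappa by (simp add: field_simps)
        then show "((\<lambda>t. exp (a * t) * sqrt (f t)) \<longlongrightarrow> 0) at_top"
          unfolding that(2) by (rule exp_decay_tendsto[OF that(1) _ that(3)])
      qed
      have diff: "slow_coeff \<delta> l (x - x') (y - y') = slow_coeff \<delta> l x y - slow_coeff \<delta> l x' y'"
          "fast_coeff \<delta> l (x - x') (y - y') = fast_coeff \<delta> l x y - fast_coeff \<delta> l x' y'" for x x' y y'
        by (simp_all add: slow_coeff_def fast_coeff_def algebra_simps flip: add_divide_distrib diff_divide_distrib)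
      have ms: "mode_sol \<delta> l (\<lambda>t. \<alpha> * exp (- r0 * t)) (\<lambda>t. - r0 * (\<alpha> * exp (- r0 * t))) (\<lambda>_. 0)" for \<alpha>
        using rate_quadratic[OF l, of r0] True by (intro exponential_mode_sol) auto
      note r = rates[OF l]
      from True have "r0 = slow_rate \<delta> l \<or> r0 = fast_rate \<delta> l" by simp
      then show ?thesis
      proof
        assume r0: "r0 = slow_rate \<delta> l"
        show ?thesis
        proof (rule that[of "\<lambda>t. slow_coeff \<delta> l (x t) (y t)"])
          show "?P (\<lambda>t. \<alpha> * exp (- r0 * t)) (\<lambda>t. - r0 * (\<alpha> * exp (- r0 * t)))"
            if "exp_decay (\<lambda>t. \<bar>slow_coeff \<delta> l (x t) (y t) - \<alpha> * exp (- r0 * t)\<bar>) \<kappa>" for \<alpha>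
          proof (intro conjI ms lim[OF that])
            show "\<forall>t\<ge>0. \<forall>r. r \<noteq> r0 \<longrightarrow> mode_form \<delta> 1 r l (\<alpha> * exp (- r0 * t)) (- r0 * (\<alpha> * exp (- r0 * t))) = 0"
              unfolding r0 mode_form_def coeffs_of_exponential[OF l] using l by simp
            show "sqrt (mode_form \<delta> 1 r0 l (x t - \<alpha> * exp (- r0 * t)) (y t - - r0 * (\<alpha> * exp (- r0 * t))))
                = \<bar>slow_coeff \<delta> l (x t) (y t) - \<alpha> * exp (- r0 * t)\<bar>" for t
              unfolding r0 mode_form_def diff coeffs_of_exponential[OF l] using l r by simp
          qed simp
          show "\<exists>\<sigma>. \<bar>\<sigma>\<bar> = 1 \<and> (\<forall>t\<ge>0. ((\<lambda>t. slow_coeff \<delta> l (x t) (y t)) has_real_derivative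
              - r0 * slow_coeff \<delta> l (x t) (y t) + \<sigma> * (g t / ?w)) (at t within {0..}))"
            using coeff_deriv(1)[OF sol l] by (intro exI[of _ 1]) (simp add: r0)
        qed
      next
        assume r0: "r0 = fast_rate \<delta> l"
        show ?thesis
        proof (rule that[of "\<lambda>t. fast_coeff \<delta> l (x t) (y t)"])
          show "?P (\<lambda>t. \<alpha> * exp (- r0 * t)) (\<lambda>t. - r0 * (\<alpha> * exp (- r0 * t)))"
            if "exp_decay (\<lambda>t. \<bar>fast_coeff \<delta> l (x t) (y t) - \<alpha> * exp (- r0 * t)\<bar>) \<kappa>" for \<alpha>
          proof (intro conjI ms lim[OF that])
            show "\<forall>t\<ge>0. \<forall>r. r \<noteq> r0 \<longrightarrow> mode_form \<delta> 1 r l (\<alpha> * exp (- r0 * t)) (- r0 * (\<alpha> * exp (- r0 * t))) = 0"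
              unfolding r0 mode_form_def coeffs_of_exponential[OF l] using l by simp
            show "sqrt (mode_form \<delta> 1 r0 l (x t - \<alpha> * exp (- r0 * t)) (y t - - r0 * (\<alpha> * exp (- r0 * t))))
                = \<bar>fast_coeff \<delta> l (x t) (y t) - \<alpha> * exp (- r0 * t)\<bar>" for t
              unfolding r0 mode_form_def diff coeffs_of_exponential[OF l] using l r by simp
          qed simp
          show "\<exists>\<sigma>. \<bar>\<sigma>\<bar> = 1 \<and> (\<forall>t\<ge>0. ((\<lambda>t. fast_coeff \<delta> l (x t) (y t)) has_real_derivative
              - r0 * fast_coeff \<delta> l (x t) (y t) + \<sigma> * (g t / ?w)) (at t within {0..}))"
            using coeff_deriv(2)[OF sol l] by (intro exI[of _ "-1"]) (simp add: r0)
        qed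
      qed
    qed
    obtain \<sigma> where s: "\<bar>\<sigma>\<bar> = 1" "\<And>t. 0 \<le> t \<Longrightarrow> (a has_real_derivative - r0 * a t + \<sigma> * (g t / ?w)) (at t within {0..})"
      using da by blast
    obtain \<alpha> where "exp_decay (\<lambda>t. \<bar>a t - \<alpha> * exp (- r0 * t)\<bar>) \<kappa>"
      using exponential_mode_limit[OF s(2) gw[OF _ s(1)] kappa] by blast
    then show ?thesis using a by blast
  next
    \<comment> \<open>The mode carries no exponent \<open>r0\<close>; its form vanishes identically
      and the zero profile works.\<close>
    case False
    have "mode_form \<delta> 1 r0 l X Y = 0" for X Y using False no_osc by (auto simp: mode_form_def)
    moreover have "mode_form \<delta> 1 r l 0 0 = 0" for r by (simp add: mode_form_def slow_coeff_def fast_coeff_def)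
    ultimately have "?P (\<lambda>_. 0) (\<lambda>_. 0)" by (simp add: mode_sol_def)
    then show ?thesis by blast
  qed
qed

section \<open>Comparison of the exponent forms with position, velocity and energy\<close>

context damped_modes
begin

lemma exps_nonneg:
  assumes "r \<in> calD K lam \<delta>"
  shows "0 \<le> r"
proof -
  have "0 \<le> slow_rate \<delta> (lam k)" if "k \<in> K" for k using slow_rate_nonneg lam[OF that] delta by simp
  moreover have "\<delta> < fast_rate \<delta> (lam k)" if "\<not> \<delta>\<^sup>2 \<le> lam k" for k using rates(7) that by simp
  ultimately show ?thesis using assms delta unfolding calD_iff by (smt (verit))
qed

lemma coeff_bounds:
  assumes k: "k \<in> K" and l: "lam k < \<delta>\<^sup>2"
  shows "(slow_coeff \<delta> (lam k) x y)\<^sup>2 \<le> c\<^sup>2 * (8 * \<delta>\<^sup>2 * x\<^sup>2 + 2 * y\<^sup>2)"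
    and "(fast_coeff \<delta> (lam k) x y)\<^sup>2 \<le> c\<^sup>2 * (8 * \<delta>\<^sup>2 * x\<^sup>2 + 2 * y\<^sup>2)"
proof -
  let ?w = "2 * sqrt (\<delta>\<^sup>2 - lam k)"
  note r = rates[OF l]
  have w: "0 < ?w" "1 / ?w \<le> c" using r(2) gap[OF k l] by (auto simp: field_simps)
  have iw: "(1 / ?w)\<^sup>2 \<le> c\<^sup>2" using w by (intro power_mono) auto
  have R: "\<rho>\<^sup>2 \<le> 4 * \<delta>\<^sup>2" if "\<rho> = slow_rate \<delta> (lam k) \<or> \<rho> = fast_rate \<delta> (lam k)" for \<rho>
  proof -
    have "0 \<le> \<rho>" "\<rho> \<le> 2 * \<delta>"
      using that r slow_rate_nonneg[OF lam[OF k], of \<delta>] delta by auto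
    then have "\<rho>\<^sup>2 \<le> (2 * \<delta>)\<^sup>2" by (intro power_mono)
    then show ?thesis by (simp add: power_mult_distrib)
  qed
  have key: "((\<rho> * x + y) / ?w)\<^sup>2 \<le> c\<^sup>2 * (8 * \<delta>\<^sup>2 * x\<^sup>2 + 2 * y\<^sup>2)" if "\<rho>\<^sup>2 \<le> 4 * \<delta>\<^sup>2" for \<rho>
  proof -
    have "(\<rho> * x + y)\<^sup>2 \<le> 2 * (\<rho> * x)\<^sup>2 + 2 * y\<^sup>2" using square_diff_le[of "\<rho> * x" "- y"] by simp
    also have "\<dots> \<le> 8 * \<delta>\<^sup>2 * x\<^sup>2 + 2 * y\<^sup>2" using mult_right_mono[OF that, of "x\<^sup>2"] by (simp add: power_mult_distrib)
    finally have "(1 / ?w)\<^sup>2 * (\<rho> * x + y)\<^sup>2 \<le> c\<^sup>2 * (8 * \<delta>\<^sup>2 * x\<^sup>2 + 2 * y\<^sup>2)" using iw by (intro mult_mono) auto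
    then show ?thesis by (simp add: power_divide)
  qed
  show "(slow_coeff \<delta> (lam k) x y)\<^sup>2 \<le> c\<^sup>2 * (8 * \<delta>\<^sup>2 * x\<^sup>2 + 2 * y\<^sup>2)"
    using key[OF R[of "fast_rate \<delta> (lam k)"]] by (simp add: slow_coeff_def r(1))
  show "(fast_coeff \<delta> (lam k) x y)\<^sup>2 \<le> c\<^sup>2 * (8 * \<delta>\<^sup>2 * x\<^sup>2 + 2 * y\<^sup>2)"
    using key[OF R[of "slow_rate \<delta> (lam k)"]]
    unfolding fast_coeff_def r(1) minus_divide_left[symmetric] power2_minus by simp
qed

definition upper_const :: real where "upper_const = c\<^sup>2 * (2 + 8 * \<delta>\<^sup>2)"

text \<open>Dictated by the overdamped modes: position gives 2, velocity gives 8 times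
  \<open>\<delta>\<^sup>2\<close> because rates are at most \<open>2 * \<delta>\<close>, and
  \<open>lam k * x\<^sup>2\<close> gives 2 more.\<close>

definition lower_const :: real where "lower_const = 2 + 10 * \<delta>\<^sup>2"

lemma const_nonneg: "0 \<le> upper_const" "0 \<le> lower_const"
  by (auto simp: upper_const_def lower_const_def)

text \<open>Since 0 differs from \<open>\<delta>\<close>, only overdamped modes contribute, and no
  factor \<open>lam k\<close> appears. This is what makes the neutral component comparable with
  \<open>norm (u t)\<close> alone.\<close>

lemma neutral_form_le:
  assumes "k \<in> K"
  shows "mode_form \<delta> 1 0 (lam k) x y \<le> upper_const * (x\<^sup>2 + y\<^sup>2)"
proof -
  have "c\<^sup>2 * (8 * \<delta>\<^sup>2 * x\<^sup>2 + 2 * y\<^sup>2) \<le> upper_const * (x\<^sup>2 + y\<^sup>2)"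
    unfolding upper_const_def mult.assoc by (intro mult_left_mono) (auto simp: algebra_simps)
  moreover have "0 \<le> upper_const * (x\<^sup>2 + y\<^sup>2)" using const_nonneg by simp
  ultimately show ?thesis
    using coeff_bounds[OF assms, of x y] delta rates(5)[of "lam k" \<delta>] by (auto simp: mode_form_def)
qed

lemma mode_form_le:
  assumes k: "k \<in> K"
  shows "mode_form \<delta> 1 r (lam k) x y \<le> upper_const * (y\<^sup>2 + (1 + lam k) * x\<^sup>2)"
proof (cases "\<delta>\<^sup>2 \<le> lam k")
  case True
  define Z where "Z = (1 + lam k) * x\<^sup>2"
  define E where "E = y\<^sup>2 + Z"
  have Z: "x\<^sup>2 \<le> Z" using lam[OF k] by (simp add: Z_def distrib_right)
  then have E: "x\<^sup>2 \<le> E" "0 \<le> E" "Z \<le> E" 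
    using zero_le_power2[of x] zero_le_power2[of y] unfolding E_def by linarith+
  have c2: "1 \<le> c\<^sup>2" using c by simp
  have "(y + \<delta> * x)\<^sup>2 \<le> 2 * y\<^sup>2 + 2 * (\<delta>\<^sup>2 * x\<^sup>2)" using square_diff_le[of y "- \<delta> * x"] by (simp add: power_mult_distrib)
  moreover have "(lam k - \<delta>\<^sup>2 + 1) * x\<^sup>2 \<le> Z" by (simp add: Z_def algebra_simps)
  moreover have "\<delta>\<^sup>2 * x\<^sup>2 \<le> \<delta>\<^sup>2 * E" "0 \<le> \<delta>\<^sup>2 * E" using E by (auto intro: mult_left_mono)
  moreover have "2 * y\<^sup>2 + Z \<le> 2 * E" using order_trans[OF zero_le_power2 Z] by (simp add: E_def)
  ultimately have "(y + \<delta> * x)\<^sup>2 + (lam k - \<delta>\<^sup>2 + 1) * x\<^sup>2 \<le> 2 * E + 8 * (\<delta>\<^sup>2 * E)" by linarith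
  also have "\<dots> = 1 * ((2 + 8 * \<delta>\<^sup>2) * E)" by (simp add: distrib_right)
  also have "\<dots> \<le> c\<^sup>2 * ((2 + 8 * \<delta>\<^sup>2) * E)" using c2 E by (intro mult_right_mono) auto
  also have "\<dots> = upper_const * (y\<^sup>2 + (1 + lam k) * x\<^sup>2)" by (simp add: upper_const_def E_def Z_def mult.assoc)
  finally show ?thesis using True lam[OF k] const_nonneg by (simp add: mode_form_def)
next
  case False
  have "c\<^sup>2 * (8 * \<delta>\<^sup>2 * x\<^sup>2 + 2 * y\<^sup>2) \<le> upper_const * (y\<^sup>2 + 1 * x\<^sup>2)"
    unfolding upper_const_def mult.assoc by (intro mult_left_mono) (auto simp: algebra_simps)
  also have "\<dots> \<le> upper_const * (y\<^sup>2 + (1 + lam k) * x\<^sup>2)"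
    using lam[OF k] const_nonneg by (intro mult_left_mono add_left_mono mult_right_mono) auto
  finally show ?thesis
    using coeff_bounds[OF k, of x y] False lam[OF k] const_nonneg rates(5)[of "lam k" \<delta>] by (auto simp: mode_form_def)
qed

text \<open>The first estimate omits the exponent 0: it occurs only for the eigenvalue 0, where the
  neutral part is a constant position with neither velocity nor potential energy.\<close>

lemma mode_le_positive_forms:
  assumes k: "k \<in> K"
  shows "y\<^sup>2 + lam k * x\<^sup>2 \<le> lower_const * (\<Sum>r\<in>calD K lam \<delta> - {0}. mode_form \<delta> 1 r (lam k) x y)"
    and "y\<^sup>2 + (1 + lam k) * x\<^sup>2 \<le> lower_const * (\<Sum>r\<in>calD K lam \<delta>. mode_form \<delta> 1 r (lam k) x y)"
proof -
  let ?f = "\<lambda>r. mode_form \<delta> 1 r (lam k) x y"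
  let ?D = "calD K lam \<delta>"
  have le: "(\<Sum>r\<in>A. ?f r) \<le> (\<Sum>r\<in>B. ?f r)" if "A \<subseteq> B" "finite B" for A B
    using that mode_form_nonneg by (intro sum_mono2) auto
  have fin: "finite ?D" "finite (?D - {0})" using finite_exps by auto
  have "y\<^sup>2 + lam k * x\<^sup>2 \<le> lower_const * (\<Sum>r\<in>?D - {0}. ?f r) \<and>
    y\<^sup>2 + (1 + lam k) * x\<^sup>2 \<le> lower_const * (\<Sum>r\<in>?D. ?f r)"
  proof (cases "\<delta>\<^sup>2 \<le> lam k")
    case True
    have D: "\<delta> \<in> ?D - {0}" using True k delta by (auto simp: calD_iff)
    have f: "?f \<delta> = (y + \<delta> * x)\<^sup>2 + (lam k - \<delta>\<^sup>2 + 1) * x\<^sup>2" using True by (simp add: mode_form_def)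
    have 1: "y\<^sup>2 \<le> 2 * (y + \<delta> * x)\<^sup>2 + 2 * (\<delta>\<^sup>2 * x\<^sup>2)"
      using square_diff_le[of "y + \<delta> * x" "\<delta> * x"] by (simp add: power_mult_distrib)
    define z where "z = lam k - \<delta>\<^sup>2"
    have z: "0 \<le> z" "lam k = z + \<delta>\<^sup>2" using True by (auto simp: z_def)
    have m: "0 \<le> z * x\<^sup>2" "0 \<le> \<delta>\<^sup>2 * (z * x\<^sup>2)" "0 \<le> \<delta>\<^sup>2 * (y + \<delta> * x)\<^sup>2" "0 \<le> \<delta>\<^sup>2 * x\<^sup>2" using z by auto
    have "y\<^sup>2 + (1 + lam k) * x\<^sup>2 \<le> 2 * (y + \<delta> * x)\<^sup>2 + 3 * (\<delta>\<^sup>2 * x\<^sup>2) + z * x\<^sup>2 + x\<^sup>2"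
      using 1 unfolding z(2) by (simp add: algebra_simps)
    also have "\<dots> \<le> 2 * (y + \<delta> * x)\<^sup>2 + 10 * (\<delta>\<^sup>2 * x\<^sup>2) + 2 * (z * x\<^sup>2) + 2 * x\<^sup>2 + 10 * (\<delta>\<^sup>2 * (y + \<delta> * x)\<^sup>2) + 10 * (\<delta>\<^sup>2 * (z * x\<^sup>2))"
      using m zero_le_power2[of x] by linarith
    also have "\<dots> = lower_const * ?f \<delta>" unfolding f lower_const_def z_def[symmetric] by (simp only: distrib_left distrib_right mult.assoc)
    finally have 2: "y\<^sup>2 + (1 + lam k) * x\<^sup>2 \<le> lower_const * ?f \<delta>" .
    have "lower_const * ?f \<delta> \<le> lower_const * (\<Sum>r\<in>?D - {0}. ?f r)" "lower_const * ?f \<delta> \<le> lower_const * (\<Sum>r\<in>?D. ?f r)"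
      using le[of "{\<delta>}" "?D - {0}"] le[of "{\<delta>}" ?D] D fin const_nonneg by (auto intro!: mult_left_mono)
    moreover have "y\<^sup>2 + lam k * x\<^sup>2 \<le> y\<^sup>2 + (1 + lam k) * x\<^sup>2" by (simp add: algebra_simps)
    ultimately show ?thesis using 2 by linarith
  next
    case False
    then have l: "lam k < \<delta>\<^sup>2" by simp
    note r = rates[OF l]
    let ?r = "slow_rate \<delta> (lam k)" and ?R = "fast_rate \<delta> (lam k)"
    define a b where "a = slow_coeff \<delta> (lam k) x y" and "b = fast_coeff \<delta> (lam k) x y"
    have D: "?r \<in> ?D" "?R \<in> ?D" using False k by (force simp: calD_iff)+
    have f: "?f ?r = a\<^sup>2" "?f ?R = b\<^sup>2" using l r by (auto simp: mode_form_def a_def b_def)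
    have rR: "0 \<le> ?r" "?r \<le> 2 * \<delta>" "0 < ?R" "?R \<le> 2 * \<delta>"
      using slow_rate_nonneg[OF lam[OF k], of \<delta>] delta r by auto
    have rsq: "?r\<^sup>2 \<le> 4 * \<delta>\<^sup>2" "?R\<^sup>2 \<le> 4 * \<delta>\<^sup>2"
      using power_mono[OF rR(2) rR(1), of 2] power_mono[OF rR(4), of 2] rR by (auto simp: power_mult_distrib)
    have xab: "x = a + b" and yab: "y = - ?r * a - ?R * b" using mode_of_coeffs[OF l] by (simp_all add: a_def b_def)
    have x2: "x\<^sup>2 \<le> 2 * a\<^sup>2 + 2 * b\<^sup>2" using square_diff_le[of a "- b"] by (simp add: xab)
    have y2: "y\<^sup>2 \<le> 2 * (?r\<^sup>2 * a\<^sup>2) + 2 * (?R\<^sup>2 * b\<^sup>2)"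
      using square_diff_le[of "- ?r * a" "?R * b"] by (simp add: yab power_mult_distrib)
    have ra: "?r\<^sup>2 * a\<^sup>2 \<le> 4 * \<delta>\<^sup>2 * a\<^sup>2" "?R\<^sup>2 * b\<^sup>2 \<le> 4 * \<delta>\<^sup>2 * b\<^sup>2" using rsq by (auto intro: mult_right_mono)
    have lx: "lam k * x\<^sup>2 \<le> \<delta>\<^sup>2 * (2 * a\<^sup>2 + 2 * b\<^sup>2)" using x2 l lam[OF k] by (intro mult_mono) auto
    have m: "0 \<le> \<delta>\<^sup>2 * a\<^sup>2" "0 \<le> \<delta>\<^sup>2 * b\<^sup>2" by auto
    have Cab: "lower_const * (a\<^sup>2 + b\<^sup>2) = 2 * a\<^sup>2 + 2 * b\<^sup>2 + 10 * (\<delta>\<^sup>2 * a\<^sup>2) + 10 * (\<delta>\<^sup>2 * b\<^sup>2)"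
      by (simp add: lower_const_def algebra_simps)
    have 2: "y\<^sup>2 + (1 + lam k) * x\<^sup>2 \<le> lower_const * (a\<^sup>2 + b\<^sup>2)"
      unfolding Cab using x2 y2 ra lx by (simp add: algebra_simps)
    have "lower_const * (a\<^sup>2 + b\<^sup>2) \<le> lower_const * (\<Sum>r\<in>?D. ?f r)"
    proof (rule mult_left_mono[OF _ const_nonneg(2)])
      have "(\<Sum>r\<in>{?r, ?R}. ?f r) \<le> (\<Sum>r\<in>?D. ?f r)" using D fin by (intro le) auto
      then show "a\<^sup>2 + b\<^sup>2 \<le> (\<Sum>r\<in>?D. ?f r)" using r(5) f by simp
    qed
    moreover have "y\<^sup>2 + lam k * x\<^sup>2 \<le> lower_const * (\<Sum>r\<in>?D - {0}. ?f r)"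
    proof (cases "?r = 0")
      \<comment> \<open>The eigenvalue is 0, and the slow coefficient drops out of the velocity,
        leaving only the fast one.\<close>
      case True
      then have l0: "lam k = 0" using r(3) by simp
      have "y\<^sup>2 + lam k * x\<^sup>2 = ?R\<^sup>2 * b\<^sup>2" using True by (simp add: l0 yab power_mult_distrib)
      also have "\<dots> \<le> 2 * b\<^sup>2 + 10 * (\<delta>\<^sup>2 * b\<^sup>2)" using ra(2) m(2) zero_le_power2[of b] by linarith
      also have "\<dots> = lower_const * b\<^sup>2" by (simp add: lower_const_def algebra_simps)
      also have "\<dots> \<le> lower_const * (\<Sum>r\<in>?D - {0}. ?f r)"
        using le[of "{?R}" "?D - {0}"] D fin rR(3) f by (intro mult_left_mono const_nonneg) auto
      finally show ?thesis .
    next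
      case False
      have "(\<Sum>r\<in>{?r, ?R}. ?f r) \<le> (\<Sum>r\<in>?D - {0}. ?f r)" using D fin False rR(3) by (intro le) auto
      then have "a\<^sup>2 + b\<^sup>2 \<le> (\<Sum>r\<in>?D - {0}. ?f r)" using r(5) f by simp
      then have "lower_const * (a\<^sup>2 + b\<^sup>2) \<le> lower_const * (\<Sum>r\<in>?D - {0}. ?f r)" by (intro mult_left_mono const_nonneg)
      moreover have "y\<^sup>2 + lam k * x\<^sup>2 \<le> y\<^sup>2 + (1 + lam k) * x\<^sup>2" by (simp add: algebra_simps)
      ultimately show ?thesis using 2 by linarith
    qed
    ultimately show ?thesis using 2 by linarith
  qed
  then show "y\<^sup>2 + lam k * x\<^sup>2 \<le> lower_const * (\<Sum>r\<in>?D - {0}. ?f r)"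
    "y\<^sup>2 + (1 + lam k) * x\<^sup>2 \<le> lower_const * (\<Sum>r\<in>?D. ?f r)" by auto
qed

end

section \<open>Assembling modes in the Hilbert space\<close>

lemma onb_parseval:
  assumes "onb K e"
  shows "((\<lambda>k. (x \<bullet> e k)\<^sup>2) has_sum (norm x)\<^sup>2) K"
proof -
  have "((\<lambda>k. (x \<bullet> e k) *\<^sub>R e k) has_sum x) K" using assms by (simp add: onb_def)
  from has_sum_bounded_linear[OF bounded_linear_inner_right this, of x]
  show ?thesis by (simp add: power2_norm_eq_inner) (simp add: power2_eq_square)
qed

lemma onb_finite_sum:
  assumes onb: "onb K e" and F: "finite F" "F \<subseteq> K"
  shows "k \<in> K \<Longrightarrow> (\<Sum>i\<in>F. a i *\<^sub>R e i) \<bullet> e k = (if k \<in> F then a k else 0)"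
    and "(norm (\<Sum>i\<in>F. a i *\<^sub>R e i))\<^sup>2 = (\<Sum>i\<in>F. (a i)\<^sup>2)"
proof -
  have e: "e i \<bullet> e j = (if i = j then 1 else 0)" if "i \<in> K" "j \<in> K" for i j using onb that by (simp add: onb_def)
  have ip: "(\<Sum>i\<in>F. a i *\<^sub>R e i) \<bullet> e k = (if k \<in> F then a k else 0)" if "k \<in> K" for k
  proof -
    have "(\<Sum>i\<in>F. a i *\<^sub>R e i) \<bullet> e k = (\<Sum>i\<in>F. if i = k then a i else 0)"
      unfolding inner_sum_left using F that by (intro sum.cong) (auto simp: e)
    then show ?thesis using F by simp
  qed
  then show "k \<in> K \<Longrightarrow> (\<Sum>i\<in>F. a i *\<^sub>R e i) \<bullet> e k = (if k \<in> F then a k else 0)" .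
  have "(norm (\<Sum>i\<in>F. a i *\<^sub>R e i))\<^sup>2 = (\<Sum>k\<in>F. (\<Sum>i\<in>F. a i *\<^sub>R e i) \<bullet> (a k *\<^sub>R e k))"
    unfolding power2_norm_eq_inner by (rule inner_sum_right)
  also have "\<dots> = (\<Sum>i\<in>F. (a i)\<^sup>2)"
    using F by (intro sum.cong) (auto simp: ip power2_eq_square)
  finally show "(norm (\<Sum>i\<in>F. a i *\<^sub>R e i))\<^sup>2 = (\<Sum>i\<in>F. (a i)\<^sup>2)" .
qed

text \<open>The Weierstrass test for orthogonal series: tails of the majorant \<open>B\<close> bound
  tails of the squared norms uniformly in \<open>t\<close>, so the partial sums converge uniformly
  and the limit is continuous.\<close>

lemma riesz_fischer_dominated:
  fixes e :: "'k \<Rightarrow> 'a::{real_inner,complete_space}" and f :: "'k \<Rightarrow> real \<Rightarrow> real"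
  assumes onb: "onb K e" and cont: "\<And>k. k \<in> K \<Longrightarrow> continuous_on {0..} (f k)"
    and le: "\<And>k t. \<lbrakk>k \<in> K; 0 \<le> t\<rbrakk> \<Longrightarrow> (f k t)\<^sup>2 \<le> B k" and B: "B summable_on K"
  shows "\<exists>z. continuous_on {0..} z \<and> (\<forall>t\<ge>0. \<forall>k\<in>K. z t \<bullet> e k = f k t)"
proof -
  have B0: "0 \<le> B k" if "k \<in> K" for k using le[OF that, of 0] zero_le_power2[of "f k 0"] by linarith
  have hs: "(B has_sum infsum B K) K" using B by simp
  have "\<exists>F. finite F \<and> F \<subseteq> K \<and> dist (sum B F) (infsum B K) \<le> 1 / (real n + 1)" for n
    using has_sum_finite_approximation[OF hs, of "1 / (real n + 1)"] by simp
  then obtain F0 where F0: "\<And>n. finite (F0 n)" "\<And>n. F0 n \<subseteq> K" "\<And>n. dist (sum B (F0 n)) (infsum B K) \<le> 1 / (real n + 1)"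
    by metis
  \<comment> \<open>Unions make the approximating sets increasing.\<close>
  define F where "F n = (\<Union>m\<le>n. F0 m)" for n
  have F: "finite (F n)" "F n \<subseteq> K" "F0 n \<subseteq> F n" for n using F0 by (auto simp: F_def)
  have Fm: "F n \<subseteq> F m" if "n \<le> m" for n m using that by (force simp: F_def)
  have tail: "sum B H \<le> 1 / (real n + 1)" if H: "finite H" "H \<subseteq> K" "H \<inter> F n = {}" for H n
  proof -
    have "sum B (F n) + sum B H = sum B (F n \<union> H)" using H F by (intro sum.union_disjoint[symmetric]) auto
    also have "\<dots> \<le> infsum B K" using H F B0 by (intro finite_sum_le_infsum[OF B]) auto
    finally have "sum B H \<le> infsum B K - sum B (F n)" by simp
    also have "\<dots> \<le> infsum B K - sum B (F0 n)"
    proof -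
      have "sum B (F0 n) \<le> sum B (F n)" using F B0 by (intro sum_mono2) (auto dest: subsetD[OF F(2)])
      then show ?thesis by simp
    qed
    also have "\<dots> \<le> 1 / (real n + 1)" using F0(3)[of n] by (auto simp: dist_real_def)
    finally show ?thesis .
  qed
  define s where "s n t = (\<Sum>k\<in>F n. f k t *\<^sub>R e k)" for n t
  have diff: "(norm (s m t - s n t))\<^sup>2 \<le> 1 / (real n + 1)" if mn: "n \<le> m" and t: "0 \<le> t" for m n t
  proof -
    have "s m t - s n t = (\<Sum>k\<in>F m - F n. f k t *\<^sub>R e k)"
      unfolding s_def using F Fm[OF mn] by (simp add: sum_diff)
    then have "(norm (s m t - s n t))\<^sup>2 = (\<Sum>k\<in>F m - F n. (f k t)\<^sup>2)"
      using F(1) subsetD[OF F(2)] by (simp only:) (intro onb_finite_sum(2)[OF onb], auto)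
    also have "\<dots> \<le> sum B (F m - F n)" using F t by (intro sum_mono le) auto
    also have "\<dots> \<le> 1 / (real n + 1)" using F by (intro tail) auto
    finally show ?thesis .
  qed
  have "uniformly_Cauchy_on {0..} s"
    unfolding uniformly_Cauchy_on_def
  proof (intro allI impI)
    fix \<epsilon> :: real assume eps: "0 < \<epsilon>"
    obtain M where M: "1 / (real M + 1) < \<epsilon>\<^sup>2"
      using reals_Archimedean[of "\<epsilon>\<^sup>2"] eps by (auto simp: inverse_eq_divide add.commute)
    have *: "norm (s m t - s n t) < \<epsilon>" if "M \<le> n" "n \<le> m" "0 \<le> t" for m n t
    proof -
      have "(norm (s m t - s n t))\<^sup>2 \<le> 1 / (real n + 1)" using that by (intro diff)
      also have "\<dots> \<le> 1 / (real M + 1)" using that by (intro divide_left_mono) auto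
      finally have "(norm (s m t - s n t))\<^sup>2 < \<epsilon>\<^sup>2" using M by linarith
      then show ?thesis using eps by (simp add: power_less_imp_less_base)
    qed
    show "\<exists>M. \<forall>x\<in>{0..}. \<forall>m\<ge>M. \<forall>n\<ge>M. dist (s m x) (s n x) < \<epsilon>"
    proof (intro exI ballI allI impI)
      fix x :: real and m n assume "x \<in> {0..}" "M \<le> m" "M \<le> n"
      then show "dist (s m x) (s n x) < \<epsilon>"
        using *[of n m x] *[of m n x] by (cases "n \<le> m") (auto simp: dist_norm norm_minus_commute)
    qed
  qed
  then obtain z where z: "uniform_limit {0..} s z sequentially"
    using Cauchy_uniformly_convergent by (auto simp: uniformly_convergent_on_def)
  have "continuous_on {0..} z"
  proof (rule uniform_limit_theorem[OF _ z])
    show "\<forall>\<^sub>F n in sequentially. continuous_on {0..} (s n)"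
      unfolding s_def using F(2) cont by (intro always_eventually allI continuous_intros) auto
  qed simp
  moreover have "z t \<bullet> e k = f k t" if t: "0 \<le> t" and k: "k \<in> K" for t k
  proof -
    have "(\<lambda>n. s n t) \<longlonglongrightarrow> z t" using tendsto_uniform_limitI[OF z] t by auto
    then have 1: "(\<lambda>n. s n t \<bullet> e k) \<longlonglongrightarrow> z t \<bullet> e k" by (intro tendsto_intros)
    have "(\<lambda>n. s n t \<bullet> e k) \<longlonglongrightarrow> f k t"
    proof (cases "\<exists>n. k \<in> F n")
      case True
      then obtain n where n: "k \<in> F n" by blast
      have "eventually (\<lambda>m. s m t \<bullet> e k = f k t) sequentially"
        using eventually_ge_at_top[of n]
      proof eventually_elim
        case (elim m)
        then show ?case using Fm[of n m] n onb_finite_sum(1)[OF onb F(1,2) k, of "\<lambda>k. f k t" m] by (auto simp: s_def)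
      qed
      then show ?thesis by (rule tendsto_eventually)
    next
      case False
      \<comment> \<open>An index missed by all the sets belongs to every tail, so its majorant and
        its coefficient vanish.\<close>
      have "B k \<le> 1 / (real n + 1)" for n using tail[of "{k}" n] False k by auto
      then have "B k \<le> 0"
        by (intro LIMSEQ_le_const[OF LIMSEQ_inverse_real_of_nat]) (auto simp: inverse_eq_divide add.commute)
      then have "(f k t)\<^sup>2 \<le> 0" using le[OF k t] by linarith
      then have "f k t = 0" by simp
      moreover have "s n t \<bullet> e k = 0" for n
        using onb_finite_sum(1)[OF onb F(1,2) k, of "\<lambda>k. f k t" n] False by (simp add: s_def)
      ultimately show ?thesis by simp
    qed
    with 1 show ?thesis by (rule LIMSEQ_unique)
  qed
  ultimately show ?thesis by blast
qed

text \<open>Differentiability in each coordinate becomes differentiability in norm because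
  \<open>v'\<close> is continuous: the mean value theorem, applied along one vector at a time,
  bounds every finite projection of the remainder by the same \<open>\<epsilon>\<close>.\<close>

lemma onb_has_vector_derivative:
  fixes e :: "'k \<Rightarrow> 'a::{real_inner,complete_space}" and v v' :: "real \<Rightarrow> 'a"
  assumes onb: "onb K e" and cont: "continuous_on {0..} v'"
    and der: "\<And>k t. \<lbrakk>k \<in> K; 0 \<le> t\<rbrakk> \<Longrightarrow> ((\<lambda>s. v s \<bullet> e k) has_real_derivative v' t \<bullet> e k) (at t within {0..})"
    and t: "0 \<le> t"
  shows "(v has_vector_derivative v' t) (at t within {0..})"
  unfolding has_vector_derivative_def has_derivative_within_alt
proof (intro conjI allI impI)
  show "bounded_linear (\<lambda>x. x *\<^sub>R v' t)" by (rule bounded_linear_scaleR_left)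
  fix \<epsilon> :: real assume eps: "0 < \<epsilon>"
  obtain d where d: "0 < d" "\<And>s. \<lbrakk>0 \<le> s; dist s t < d\<rbrakk> \<Longrightarrow> dist (v' s) (v' t) < \<epsilon>"
    using cont t eps unfolding continuous_on_iff by (metis atLeast_iff)
  have "norm (v s - v t - (s - t) *\<^sub>R v' t) \<le> \<epsilon> * norm (s - t)" if s: "0 \<le> s" "norm (s - t) < d" for s
  proof -
    define D where "D = v s - v t - (s - t) *\<^sub>R v' t"
    have fin: "(\<Sum>k\<in>F. (D \<bullet> e k)\<^sup>2) \<le> (\<epsilon> * \<bar>s - t\<bar>)\<^sup>2" if F: "finite F" "F \<subseteq> K" for F
    proof -
      \<comment> \<open>Testing the remainder \<open>D\<close> against its own projection turns the
        scalar estimate into a bound on \<open>norm P\<close>, since \<open>D \<bullet> P\<close> is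
        the square of that norm.\<close>
      define P where "P = (\<Sum>k\<in>F. (D \<bullet> e k) *\<^sub>R e k)"
      have P: "(norm P)\<^sup>2 = (\<Sum>k\<in>F. (D \<bullet> e k)\<^sup>2)" unfolding P_def by (rule onb_finite_sum(2)[OF onb F])
      have DP: "D \<bullet> P = (norm P)\<^sup>2" unfolding P by (simp add: P_def inner_sum_right power2_eq_square)
      have dP: "((\<lambda>s. v s \<bullet> P) has_real_derivative v' \<tau> \<bullet> P) (at \<tau> within {0..})" if "0 \<le> \<tau>" for \<tau>
        unfolding P_def inner_sum_right inner_scaleR_right
        using F that by (intro DERIV_sum DERIV_cmult der) auto
      have mv: "\<exists>\<xi>\<in>{a<..<b}. v b \<bullet> P - v a \<bullet> P = (v' \<xi> \<bullet> P) * (b - a)" if "0 \<le> a" "a < b" for a b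
      proof (rule mvt_simple[OF that(2), where f = "\<lambda>s. v s \<bullet> P" and f' = "\<lambda>x h. (v' x \<bullet> P) * h"])
        fix x assume "a \<le> x" "x \<le> b"
        then show "((\<lambda>s. v s \<bullet> P) has_derivative (\<lambda>h. (v' x \<bullet> P) * h)) (at x within {a..b})"
          using that DERIV_subset[OF dP[of x], of "{a..b}"] by (auto simp: has_field_derivative_def)
      qed
      have "\<exists>\<xi>\<ge>0. dist \<xi> t < d \<and> v s \<bullet> P - v t \<bullet> P = (v' \<xi> \<bullet> P) * (s - t)"
      proof (cases s t rule: linorder_cases)
        case less
        then obtain \<xi> where "\<xi> \<in> {s<..<t}" "v t \<bullet> P - v s \<bullet> P = (v' \<xi> \<bullet> P) * (t - s)" using mv[of s t] s by blast
        then show ?thesis using s by (intro exI[of _ \<xi>]) (auto simp: dist_real_def algebra_simps)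
      next
        case equal
        then show ?thesis using t d by (intro exI[of _ t]) auto
      next
        case greater
        then obtain \<xi> where "\<xi> \<in> {t<..<s}" "v s \<bullet> P - v t \<bullet> P = (v' \<xi> \<bullet> P) * (s - t)" using mv[of t s] t by blast
        then show ?thesis using s t by (intro exI[of _ \<xi>]) (auto simp: dist_real_def)
      qed
      then obtain \<xi> where xi: "0 \<le> \<xi>" "dist \<xi> t < d" "v s \<bullet> P - v t \<bullet> P = (v' \<xi> \<bullet> P) * (s - t)" by blast
      have "D \<bullet> P = (s - t) * ((v' \<xi> - v' t) \<bullet> P)"
        using xi(3) by (simp add: D_def inner_diff_left algebra_simps)
      also have "\<dots> \<le> \<bar>s - t\<bar> * (\<epsilon> * norm P)"
      proof -
        have "\<bar>(v' \<xi> - v' t) \<bullet> P\<bar> \<le> norm (v' \<xi> - v' t) * norm P" by (rule Cauchy_Schwarz_ineq2)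
        also have "\<dots> \<le> \<epsilon> * norm P" using d(2)[OF xi(1,2)] by (intro mult_right_mono) (auto simp: dist_norm)
        finally have "\<bar>s - t\<bar> * \<bar>(v' \<xi> - v' t) \<bullet> P\<bar> \<le> \<bar>s - t\<bar> * (\<epsilon> * norm P)" by (intro mult_left_mono) auto
        moreover have "(s - t) * ((v' \<xi> - v' t) \<bullet> P) \<le> \<bar>s - t\<bar> * \<bar>(v' \<xi> - v' t) \<bullet> P\<bar>"
          unfolding abs_mult[symmetric] by (rule abs_ge_self)
        ultimately show ?thesis by (rule order_trans[rotated])
      qed
      finally have "norm P * norm P \<le> (\<epsilon> * \<bar>s - t\<bar>) * norm P" by (simp add: DP power2_eq_square algebra_simps)
      then have "norm P \<le> \<epsilon> * \<bar>s - t\<bar>" using eps by (cases "norm P = 0") auto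
      then show ?thesis unfolding P[symmetric] by (intro power_mono) auto
    qed
    have "(norm D)\<^sup>2 \<le> (\<epsilon> * \<bar>s - t\<bar>)\<^sup>2" using onb_parseval[OF onb] fin by (rule has_sum_le_finite_sums)
    then have "norm D \<le> \<epsilon> * \<bar>s - t\<bar>" by (rule power2_le_imp_le) (use eps in auto)
    then show ?thesis by (simp add: D_def)
  qed
  then show "\<exists>d>0. \<forall>y\<in>{0..}. norm (y - t) < d \<longrightarrow> norm (v y - v t - (y - t) *\<^sub>R v' t) \<le> \<epsilon> * norm (y - t)"
    using d(1) by auto
qed

section \<open>Energy norms and synthesis of weak solutions from modes\<close>

locale damped_system = damped_modes K lam \<delta> c
  for K :: "'k set" and lam :: "'k \<Rightarrow> real" and \<delta> c :: real +
  fixes e :: "'k \<Rightarrow> 'a::{real_inner,complete_space}"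
  assumes onb: "onb K e"
begin

lemma halfnorm_has_sum:
  assumes "x \<in> domhalf K e lam"
  shows "((\<lambda>k. lam k * (x \<bullet> e k)\<^sup>2) has_sum (halfnorm K e lam x)\<^sup>2) K"
proof -
  have "0 \<le> (\<Sum>\<^sub>\<infinity>k\<in>K. lam k * (x \<bullet> e k)\<^sup>2)" using lam by (intro infsum_nonneg) auto
  then show ?thesis using assms by (simp add: halfnorm_def domhalf_def)
qed

lemma dnorm_has_sum:
  assumes "x \<in> domhalf K e lam"
  shows "((\<lambda>k. (1 + lam k) * (x \<bullet> e k)\<^sup>2) has_sum (dnorm K e lam x)\<^sup>2) K"
proof -
  have "((\<lambda>k. (x \<bullet> e k)\<^sup>2 + lam k * (x \<bullet> e k)\<^sup>2) has_sum (norm x)\<^sup>2 + (halfnorm K e lam x)\<^sup>2) K"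
    by (intro has_sum_add onb_parseval[OF onb] halfnorm_has_sum assms)
  then show ?thesis by (simp add: dnorm_def algebra_simps)
qed

lemma halfnorm_nonneg: "0 \<le> halfnorm K e lam x"
  unfolding halfnorm_def using lam by (intro real_sqrt_ge_zero infsum_nonneg) auto

lemma norm_le_dnorm: "norm x \<le> dnorm K e lam x" "halfnorm K e lam x \<le> dnorm K e lam x"
  using halfnorm_nonneg by (auto simp: dnorm_def intro: real_le_rsqrt)

lemma domhalf_diff:
  assumes "x \<in> domhalf K e lam" "y \<in> domhalf K e lam"
  shows "x - y \<in> domhalf K e lam"
proof -
  have "(\<lambda>k. 2 * (lam k * (x \<bullet> e k)\<^sup>2) + 2 * (lam k * (y \<bullet> e k)\<^sup>2)) summable_on K"
    using assms by (intro summable_on_add summable_on_cmult_right) (auto simp: domhalf_def)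
  then have "(\<lambda>k. lam k * ((x - y) \<bullet> e k)\<^sup>2) summable_on K"
  proof (rule summable_on_comparison_test)
    fix k assume k: "k \<in> K"
    have "lam k * ((x - y) \<bullet> e k)\<^sup>2 \<le> lam k * (2 * (x \<bullet> e k)\<^sup>2 + 2 * (y \<bullet> e k)\<^sup>2)"
      unfolding inner_diff_left using lam[OF k] by (intro mult_left_mono square_diff_le)
    then show "lam k * ((x - y) \<bullet> e k)\<^sup>2 \<le> 2 * (lam k * (x \<bullet> e k)\<^sup>2) + 2 * (lam k * (y \<bullet> e k)\<^sup>2)"
      by (simp add: algebra_simps)
  qed (use lam in auto)
  then show ?thesis by (simp add: domhalf_def)
qed

lemma weak_sol_of_modes:
  assumes ms: "\<And>k. k \<in> K \<Longrightarrow> mode_sol \<delta> (lam k) (vx k) (vy k) (\<lambda>_. 0)"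
    and le: "\<And>k t. \<lbrakk>k \<in> K; 0 \<le> t\<rbrakk> \<Longrightarrow> (vy k t)\<^sup>2 + (1 + lam k) * (vx k t)\<^sup>2 \<le> B k"
    and B: "B summable_on K"
  shows "\<exists>v v'. weak_sol K e lam \<delta> v v' (\<lambda>_. 0) \<and>
    (\<forall>k\<in>K. \<forall>t\<ge>0. v t \<bullet> e k = vx k t \<and> v' t \<bullet> e k = vy k t)"
proof -
  have dvx: "(vx k has_real_derivative vy k t) (at t within {0..})"
    and dvy: "(vy k has_real_derivative - 2 * \<delta> * vy k t - lam k * vx k t + 0) (at t within {0..})"
    if "k \<in> K" "0 \<le> t" for k t using ms[OF that(1)] that(2) by (auto simp: mode_sol_def)
  have cx: "continuous_on {0..} (vx k)" and cy: "continuous_on {0..} (vy k)" if "k \<in> K" for k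
    by (rule DERIV_continuous_on, rule dvx[OF that], simp) (rule DERIV_continuous_on, rule dvy[OF that], simp)
  have parts: "(vy k t)\<^sup>2 \<le> B k" "(1 + lam k) * (vx k t)\<^sup>2 \<le> B k" "(vx k t)\<^sup>2 \<le> B k" if k: "k \<in> K" and t: "0 \<le> t" for k t
  proof -
    have "0 \<le> (vy k t)\<^sup>2" "0 \<le> lam k * (vx k t)\<^sup>2" "0 \<le> (vx k t)\<^sup>2" using lam[OF k] by auto
    then show "(vy k t)\<^sup>2 \<le> B k" "(1 + lam k) * (vx k t)\<^sup>2 \<le> B k" "(vx k t)\<^sup>2 \<le> B k"
      using le[OF k t] unfolding distrib_right by linarith+
  qed
  obtain v where v: "continuous_on {0..} v" "\<And>t k. \<lbrakk>0 \<le> t; k \<in> K\<rbrakk> \<Longrightarrow> v t \<bullet> e k = vx k t"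
    using riesz_fischer_dominated[OF onb cx parts(3) B] by blast
  obtain v' where v': "continuous_on {0..} v'" "\<And>t k. \<lbrakk>0 \<le> t; k \<in> K\<rbrakk> \<Longrightarrow> v' t \<bullet> e k = vy k t"
    using riesz_fischer_dominated[OF onb cy parts(1) B] by blast
  \<comment> \<open>The function \<open>z\<close> is the image of \<open>v\<close> under the square
    root of \<open>1 + A\<close>; its norm is the graph norm of \<open>v\<close>, so its continuity
    is the continuity required of a weak solution.\<close>
  have "\<exists>z. continuous_on {0..} z \<and> (\<forall>t\<ge>0. \<forall>k\<in>K. z t \<bullet> e k = sqrt (1 + lam k) * vx k t)"
  proof (rule riesz_fischer_dominated[OF onb _ _ B])
    fix k t assume "k \<in> K" "0 \<le> (t::real)"
    then show "(sqrt (1 + lam k) * vx k t)\<^sup>2 \<le> B k" using parts(2)[of k t] lam[of k] by (simp add: power_mult_distrib)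
  qed (auto intro!: continuous_intros cx)
  then obtain z where z: "continuous_on {0..} z" "\<And>t k. \<lbrakk>0 \<le> t; k \<in> K\<rbrakk> \<Longrightarrow> z t \<bullet> e k = sqrt (1 + lam k) * vx k t"
    by blast
  have dom: "v t \<in> domhalf K e lam" if t: "0 \<le> t" for t
    unfolding domhalf_def mem_Collect_eq
  proof (rule summable_on_comparison_test[OF B])
    fix k assume k: "k \<in> K"
    have "lam k * (vx k t)\<^sup>2 \<le> (1 + lam k) * (vx k t)\<^sup>2" by (intro mult_right_mono) auto
    then show "lam k * (v t \<bullet> e k)\<^sup>2 \<le> B k" using parts(2)[OF k t] v(2)[OF t k] by simp
  qed (use lam in auto)
  have zd: "dnorm K e lam (v s - v t) = norm (z s - z t)" if s: "0 \<le> s" and t: "0 \<le> t" for s t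
  proof -
    have "((\<lambda>k. ((z s - z t) \<bullet> e k)\<^sup>2) has_sum (norm (z s - z t))\<^sup>2) K" by (rule onb_parseval[OF onb])
    moreover have "((z s - z t) \<bullet> e k)\<^sup>2 = (1 + lam k) * ((v s - v t) \<bullet> e k)\<^sup>2" if "k \<in> K" for k
      using lam[OF that] by (simp add: inner_diff_left z(2) v(2) s t that power_mult_distrib flip: right_diff_distrib)
    ultimately have "((\<lambda>k. (1 + lam k) * ((v s - v t) \<bullet> e k)\<^sup>2) has_sum (norm (z s - z t))\<^sup>2) K"
      by (simp cong: has_sum_cong)
    with dnorm_has_sum[OF domhalf_diff[OF dom[OF s] dom[OF t]]]
    have "(dnorm K e lam (v s - v t))\<^sup>2 = (norm (z s - z t))\<^sup>2" by (rule has_sum_unique)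
    then show ?thesis by (simp add: dnorm_def power2_eq_iff_nonneg)
  qed
  have tend: "((\<lambda>s. dnorm K e lam (v s - v t)) \<longlongrightarrow> 0) (at t within {0..})" if t: "0 \<le> t" for t
  proof -
    have "((\<lambda>s. norm (z s - z t)) \<longlongrightarrow> 0) (at t within {0..})"
      using z(1) t by (auto simp: continuous_on_def intro!: tendsto_norm_zero LIM_zero)
    then show ?thesis
    proof (rule Lim_transform_eventually)
      show "\<forall>\<^sub>F s in at t within {0..}. norm (z s - z t) = dnorm K e lam (v s - v t)"
        using zd t by (auto simp: eventually_at_filter)
    qed
  qed
  have dv: "(v has_vector_derivative v' t) (at t within {0..})" if t: "0 \<le> t" for t
  proof (rule onb_has_vector_derivative[OF onb v'(1) _ t])
    fix k and t :: real assume k: "k \<in> K" and t: "0 \<le> t"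
    show "((\<lambda>s. v s \<bullet> e k) has_real_derivative v' t \<bullet> e k) (at t within {0..})"
      unfolding v'(2)[OF t k]
      unfolding has_field_derivative_def
      by (rule has_derivative_transform[OF _ _ dvx[OF k t, unfolded has_field_derivative_def]]) (use t k v(2) in auto)
  qed
  have "weak_sol K e lam \<delta> v v' (\<lambda>_. 0)"
    unfolding weak_sol_def
  proof (intro conjI allI impI ballI dom tend dv v'(1))
    fix k and t :: real assume k: "k \<in> K" and t: "0 \<le> t"
    have "((\<lambda>s. v' s \<bullet> e k) has_real_derivative - 2 * \<delta> * vy k t - lam k * vx k t + 0) (at t within {0..})"
      unfolding has_field_derivative_def
      by (rule has_derivative_transform[OF _ _ dvy[OF k t, unfolded has_field_derivative_def]]) (use t k v'(2) in auto)
    then show "((\<lambda>s. v' s \<bullet> e k) has_real_derivative - 2 * \<delta> * (v' t \<bullet> e k) - lam k * (v t \<bullet> e k) + 0 \<bullet> e k) (at t within {0..})"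
      using v(2)[OF t k] v'(2)[OF t k] by simp
  qed
  then show ?thesis using v(2) v'(2) by blast
qed

end

section \<open>Norms of the exponent components and their growth\<close>

context damped_system
begin

text \<open>The regularisation is fixed at 1. Convergence of the sum is guaranteed on
  \<open>domhalf\<close>; a divergent sum would default to 0, which is why the estimates carry this
  membership.\<close>

definition exp_norm :: "real \<Rightarrow> 'a \<Rightarrow> 'a \<Rightarrow> real" where
  "exp_norm r x y = sqrt (\<Sum>\<^sub>\<infinity>k\<in>K. mode_form \<delta> 1 r (lam k) (x \<bullet> e k) (y \<bullet> e k))"

lemma exp_norm_nonneg: "0 \<le> exp_norm r x y"
  unfolding exp_norm_def by (intro real_sqrt_ge_zero infsum_nonneg mode_form_nonneg)

lemma energy_has_sum:
  assumes "x \<in> domhalf K e lam"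
  shows "((\<lambda>k. (y \<bullet> e k)\<^sup>2 + (1 + lam k) * (x \<bullet> e k)\<^sup>2) has_sum (norm y)\<^sup>2 + (dnorm K e lam x)\<^sup>2) K"
  by (intro has_sum_add onb_parseval[OF onb] dnorm_has_sum assms)

lemma form_summable:
  assumes "x \<in> domhalf K e lam"
  shows "(\<lambda>k. mode_form \<delta> 1 r (lam k) (x \<bullet> e k) (y \<bullet> e k)) summable_on K"
proof (rule summable_on_comparison_test)
  show "(\<lambda>k. upper_const * ((y \<bullet> e k)\<^sup>2 + (1 + lam k) * (x \<bullet> e k)\<^sup>2)) summable_on K"
    by (intro summable_on_cmult_right has_sum_imp_summable[OF energy_has_sum[OF assms]])
qed (auto intro: mode_form_le mode_form_nonneg)

lemma finite_form_le_exp_norm: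
  assumes "x \<in> domhalf K e lam" "finite F" "F \<subseteq> K"
  shows "sqrt (\<Sum>k\<in>F. mode_form \<delta> 1 r (lam k) (x \<bullet> e k) (y \<bullet> e k)) \<le> exp_norm r x y"
  unfolding exp_norm_def
  by (intro real_sqrt_le_mono finite_sum_le_infsum form_summable assms mode_form_nonneg)

text \<open>The passage from finite sets of modes to all modes: a bound independent of
  \<open>F\<close> survives the supremum, and no infinite sum is ever differentiated.\<close>

lemma exp_norm_leI:
  assumes "x \<in> domhalf K e lam"
    and le: "\<And>F. \<lbrakk>finite F; F \<subseteq> K\<rbrakk> \<Longrightarrow> sqrt (\<Sum>k\<in>F. mode_form \<delta> 1 r (lam k) (x \<bullet> e k) (y \<bullet> e k)) \<le> B"
  shows "exp_norm r x y \<le> B"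
proof -
  have B: "0 \<le> B" using le[of "{}"] by simp
  have "(\<Sum>\<^sub>\<infinity>k\<in>K. mode_form \<delta> 1 r (lam k) (x \<bullet> e k) (y \<bullet> e k)) \<le> B\<^sup>2"
  proof (rule infsum_le_finite_sums[OF form_summable[OF assms(1)]])
    fix F assume "finite F" "F \<subseteq> K"
    from le[OF this] show "(\<Sum>k\<in>F. mode_form \<delta> 1 r (lam k) (x \<bullet> e k) (y \<bullet> e k)) \<le> B\<^sup>2"
      by (rule sqrt_le_D)
  qed
  then show ?thesis unfolding exp_norm_def using B by (simp add: real_le_lsqrt infsum_nonneg mode_form_nonneg)
qed

lemma exp_norm_eq_0:
  assumes "\<And>k. k \<in> K \<Longrightarrow> mode_form \<delta> 1 r (lam k) (x \<bullet> e k) (y \<bullet> e k) = 0"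
  shows "exp_norm r x y = 0"
  using assms by (simp add: exp_norm_def infsum_0)

lemma exp_norm_outside:
  assumes "r \<notin> calD K lam \<delta>"
  shows "exp_norm r x y = 0"
proof (rule exp_norm_eq_0)
  fix k assume "k \<in> K"
  then have "\<not> (if \<delta>\<^sup>2 \<le> lam k then r = \<delta> else r = slow_rate \<delta> (lam k) \<or> r = fast_rate \<delta> (lam k))"
    using assms unfolding calD_iff by blast
  then show "mode_form \<delta> 1 r (lam k) (x \<bullet> e k) (y \<bullet> e k) = 0"
    unfolding mode_form_def by (cases "\<delta>\<^sup>2 \<le> lam k") simp_all
qed

lemma exp_norm_diff_eq:
  assumes "\<And>k. k \<in> K \<Longrightarrow> mode_form \<delta> 1 r (lam k) (x' \<bullet> e k) (y' \<bullet> e k) = 0"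
  shows "exp_norm r (x - x') (y - y') = exp_norm r x y"
  unfolding exp_norm_def inner_diff_left using assms by (simp add: mode_form_diff_eq cong: infsum_cong)

lemma neutral_exp_norm_le:
  assumes "x \<in> domhalf K e lam"
  shows "exp_norm 0 x y \<le> sqrt upper_const * (norm x + norm y)"
proof (rule exp_norm_leI[OF assms])
  fix F assume F: "finite F" "F \<subseteq> K"
  have "(\<Sum>k\<in>F. mode_form \<delta> 1 0 (lam k) (x \<bullet> e k) (y \<bullet> e k)) \<le> (\<Sum>k\<in>F. upper_const * ((x \<bullet> e k)\<^sup>2 + (y \<bullet> e k)\<^sup>2))"
    using F by (intro sum_mono neutral_form_le) auto
  also have "\<dots> = upper_const * (\<Sum>k\<in>F. (x \<bullet> e k)\<^sup>2 + (y \<bullet> e k)\<^sup>2)" by (simp add: sum_distrib_left)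
  also have "\<dots> \<le> upper_const * ((norm x)\<^sup>2 + (norm y)\<^sup>2)"
    using F by (intro mult_left_mono const_nonneg finite_sum_le_has_sum[OF has_sum_add[OF onb_parseval[OF onb] onb_parseval[OF onb]]]) auto
  also have "\<dots> \<le> upper_const * (norm x + norm y)\<^sup>2"
    using const_nonneg by (intro mult_left_mono) (auto simp: power2_sum)
  finally have "sqrt (\<Sum>k\<in>F. mode_form \<delta> 1 0 (lam k) (x \<bullet> e k) (y \<bullet> e k)) \<le> sqrt (upper_const * (norm x + norm y)\<^sup>2)"
    by (rule real_sqrt_le_mono)
  then show "sqrt (\<Sum>k\<in>F. mode_form \<delta> 1 0 (lam k) (x \<bullet> e k) (y \<bullet> e k)) \<le> sqrt upper_const * (norm x + norm y)"
    by (simp add: real_sqrt_mult)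
qed

definition norm_const :: real where "norm_const = 2 * sqrt lower_const"

lemma norm_const_pos: "0 < norm_const"
  by (simp add: norm_const_def lower_const_def add_pos_nonneg)

lemma norms_le_exp_norms_aux:
  assumes x: "x \<in> domhalf K e lam" and D: "finite D"
    and hs: "(h has_sum a\<^sup>2 + b\<^sup>2) K" and ab: "0 \<le> a" "0 \<le> b"
    and le: "\<And>k. k \<in> K \<Longrightarrow> h k \<le> lower_const * (\<Sum>r\<in>D. mode_form \<delta> 1 r (lam k) (x \<bullet> e k) (y \<bullet> e k))"
  shows "a + b \<le> norm_const * (\<Sum>r\<in>D. exp_norm r x y)"
proof -
  let ?S = "\<Sum>r\<in>D. exp_norm r x y"
  have "a\<^sup>2 + b\<^sup>2 \<le> lower_const * (\<Sum>r\<in>D. (exp_norm r x y)\<^sup>2)"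
  proof (rule has_sum_le_finite_sums[OF hs])
    fix F assume F: "finite F" "F \<subseteq> K"
    have "sum h F \<le> (\<Sum>k\<in>F. lower_const * (\<Sum>r\<in>D. mode_form \<delta> 1 r (lam k) (x \<bullet> e k) (y \<bullet> e k)))"
      using F by (intro sum_mono le) auto
    also have "\<dots> = lower_const * (\<Sum>r\<in>D. \<Sum>k\<in>F. mode_form \<delta> 1 r (lam k) (x \<bullet> e k) (y \<bullet> e k))"
      by (simp add: sum_distrib_left[symmetric] sum.swap[of _ D F])
    also have "\<dots> \<le> lower_const * (\<Sum>r\<in>D. (exp_norm r x y)\<^sup>2)"
      using finite_form_le_exp_norm[OF x F] by (intro mult_left_mono sum_mono const_nonneg sqrt_le_D) auto
    finally show "sum h F \<le> lower_const * (\<Sum>r\<in>D. (exp_norm r x y)\<^sup>2)" .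
  qed
  also have "\<dots> \<le> lower_const * ?S\<^sup>2"
  proof (rule mult_left_mono[OF _ const_nonneg(2)])
    have "L2_set (\<lambda>r. exp_norm r x y) D \<le> ?S" using exp_norm_nonneg by (intro L2_set_le_sum)
    then show "(\<Sum>r\<in>D. (exp_norm r x y)\<^sup>2) \<le> ?S\<^sup>2" unfolding L2_set_def by (rule sqrt_le_D)
  qed
  finally have 1: "a\<^sup>2 + b\<^sup>2 \<le> lower_const * ?S\<^sup>2" .
  have S: "0 \<le> ?S" using exp_norm_nonneg by (intro sum_nonneg)
  have "(a + b)\<^sup>2 \<le> 4 * (a\<^sup>2 + b\<^sup>2)" using square_diff_le[of a "- b"] by simp (smt (verit) zero_le_power2)
  also have "\<dots> \<le> (norm_const * ?S)\<^sup>2"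
    using 1 const_nonneg by (simp add: norm_const_def power_mult_distrib)
  finally show ?thesis by (rule power2_le_imp_le) (use S norm_const_pos in auto)
qed

lemma norms_le_exp_norms:
  assumes "x \<in> domhalf K e lam"
  shows "norm y + dnorm K e lam x \<le> norm_const * (\<Sum>r\<in>calD K lam \<delta>. exp_norm r x y)"
  by (rule norms_le_exp_norms_aux[OF assms finite_exps energy_has_sum[OF assms]])
     (auto simp: dnorm_def intro!: mode_le_positive_forms)

lemma norms_le_positive_exp_norms:
  assumes "x \<in> domhalf K e lam"
  shows "norm y + halfnorm K e lam x \<le> norm_const * (\<Sum>r\<in>calD K lam \<delta> - {0}. exp_norm r x y)"
  by (rule norms_le_exp_norms_aux[OF assms _ has_sum_add[OF onb_parseval[OF onb] halfnorm_has_sum[OF assms]]])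
     (auto simp: finite_exps halfnorm_nonneg intro!: mode_le_positive_forms)

lemma weak_sol_mode_sol:
  assumes "weak_sol K e lam \<delta> u u' g" "k \<in> K"
  shows "mode_sol \<delta> (lam k) (\<lambda>t. u t \<bullet> e k) (\<lambda>t. u' t \<bullet> e k) (\<lambda>t. g t \<bullet> e k)"
  unfolding mode_sol_def
proof (intro allI impI conjI)
  fix t :: real assume t: "0 \<le> t"
  have "(u has_vector_derivative u' t) (at t within {0..})" using assms t by (simp add: weak_sol_def)
  from bounded_linear.has_vector_derivative[OF bounded_linear_inner_left this]
  show "((\<lambda>t. u t \<bullet> e k) has_real_derivative u' t \<bullet> e k) (at t within {0..})"
    by (simp add: has_real_derivative_iff_has_vector_derivative)
  show "((\<lambda>t. u' t \<bullet> e k) has_real_derivative - 2 * \<delta> * (u' t \<bullet> e k) - lam k * (u t \<bullet> e k) + g t \<bullet> e k) (at t within {0..})"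
    using assms t by (simp add: weak_sol_def)
qed

lemma bessel: "\<lbrakk>finite F; F \<subseteq> K\<rbrakk> \<Longrightarrow> (\<Sum>k\<in>F. (x \<bullet> e k)\<^sup>2) \<le> (norm x)\<^sup>2"
  by (rule finite_sum_le_has_sum[OF onb_parseval[OF onb]]) auto

lemma weak_sol_forced_modes:
  assumes "weak_sol K e lam \<delta> u u' g" "continuous_on {0..} g" "finite F" "F \<subseteq> K"
  shows "forced_modes F (\<lambda>k t. u t \<bullet> e k) (\<lambda>k t. u' t \<bullet> e k) (\<lambda>t. norm (g t))"
  unfolding forced_modes_def
proof (intro conjI exI[of _ "\<lambda>k t. g t \<bullet> e k"] ballI allI impI)
  show "mode_sol \<delta> (lam k) (\<lambda>t. u t \<bullet> e k) (\<lambda>t. u' t \<bullet> e k) (\<lambda>t. g t \<bullet> e k)" if "k \<in> F" for k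
    using weak_sol_mode_sol[OF assms(1)] assms(4) that by blast
qed (use assms bessel in \<open>auto intro!: continuous_intros\<close>)

lemma weak_sol_domhalf: "\<lbrakk>weak_sol K e lam \<delta> u u' g; 0 \<le> t\<rbrakk> \<Longrightarrow> u t \<in> domhalf K e lam"
  by (simp add: weak_sol_def)

lemma exp_norm_upper_estimate:
  assumes sol: "weak_sol K e lam \<delta> u u' g" and cont: "continuous_on {0..} g" and b: "b < r" and st: "0 \<le> s" "s \<le> t"
  shows "exp (b * t) * exp_norm r (u t) (u' t) \<le>
     rate_const (r - b) * (exp (b * s) * exp_norm r (u s) (u' s) + integral {s..t} (\<lambda>\<tau>. exp (b * \<tau>) * norm (g \<tau>)))"
    (is "_ \<le> ?B")
proof -
  have "exp_norm r (u t) (u' t) \<le> ?B * exp (- b * t)"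
  proof (rule exp_norm_leI[OF weak_sol_domhalf[OF sol]])
    fix F assume F: "finite F" "F \<subseteq> K"
    let ?T = "\<lambda>t. total_form 1 r F (\<lambda>k t. u t \<bullet> e k) (\<lambda>k t. u' t \<bullet> e k) t"
    have "exp (b * t) * sqrt (?T t) \<le> rate_const (r - b) * (exp (b * s) * sqrt (?T s) + integral {s..t} (\<lambda>\<tau>. exp (b * \<tau>) * norm (g \<tau>)))"
      by (rule finite_upper_estimate[OF weak_sol_forced_modes[OF sol cont F] b st])
    also have "\<dots> \<le> ?B"
      using finite_form_le_exp_norm[OF weak_sol_domhalf[OF sol st(1)] F, of r "u' s"]
      by (intro mult_left_mono add_right_mono rate_const_nonneg) (auto simp: total_form_def)
    finally show "sqrt (\<Sum>k\<in>F. mode_form \<delta> 1 r (lam k) (u t \<bullet> e k) (u' t \<bullet> e k)) \<le> ?B * exp (- b * t)"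
      unfolding exp_weight_le_iff by (simp add: total_form_def)
  qed (use st in auto)
  then show ?thesis unfolding exp_weight_le_iff .
qed

lemma exp_norm_lower_estimate:
  assumes sol: "weak_sol K e lam \<delta> u u' g" and cont: "continuous_on {0..} g" and a: "r < a" and st: "0 \<le> s" "s \<le> t"
  shows "exp (a * s) * exp_norm r (u s) (u' s) \<le>
     rate_const (a - r) * (exp (a * t) * exp_norm r (u t) (u' t) + integral {s..t} (\<lambda>\<tau>. exp (a * \<tau>) * norm (g \<tau>)))"
    (is "_ \<le> ?B")
proof -
  have t: "0 \<le> t" using st by simp
  have "exp_norm r (u s) (u' s) \<le> ?B * exp (- a * s)"
  proof (rule exp_norm_leI[OF weak_sol_domhalf[OF sol]])
    fix F assume F: "finite F" "F \<subseteq> K"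
    let ?T = "\<lambda>t. total_form 1 r F (\<lambda>k t. u t \<bullet> e k) (\<lambda>k t. u' t \<bullet> e k) t"
    have "exp (a * s) * sqrt (?T s) \<le> rate_const (a - r) * (exp (a * t) * sqrt (?T t) + integral {s..t} (\<lambda>\<tau>. exp (a * \<tau>) * norm (g \<tau>)))"
      by (rule finite_lower_estimate[OF weak_sol_forced_modes[OF sol cont F] a st])
    also have "\<dots> \<le> ?B"
      using finite_form_le_exp_norm[OF weak_sol_domhalf[OF sol t] F, of r "u' t"]
      by (intro mult_left_mono add_right_mono rate_const_nonneg) (auto simp: total_form_def)
    finally show "sqrt (\<Sum>k\<in>F. mode_form \<delta> 1 r (lam k) (u s \<bullet> e k) (u' s \<bullet> e k)) \<le> ?B * exp (- a * s)"
      unfolding exp_weight_le_iff by (simp add: total_form_def)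
  qed (use st in auto)
  then show ?thesis unfolding exp_weight_le_iff .
qed

text \<open>As 0 differs from \<open>\<delta>\<close>, the estimates hold at the exact rate 0 and
  with the factor 1 in front of the norm. A larger factor would bound the ratio of the two norms but
  not their difference.\<close>

lemma neutral_exp_norm_variation:
  assumes sol: "weak_sol K e lam \<delta> u u' g" and cont: "continuous_on {0..} g" and st: "0 \<le> s" "s \<le> t"
  shows "\<bar>exp_norm 0 (u t) (u' t) - exp_norm 0 (u s) (u' s)\<bar> \<le> c * integral {s..t} (\<lambda>\<tau>. norm (g \<tau>))"
proof -
  let ?I = "c * integral {s..t} (\<lambda>\<tau>. norm (g \<tau>))"
  let ?T = "\<lambda>F t. total_form 1 0 F (\<lambda>k t. u t \<bullet> e k) (\<lambda>k t. u' t \<bullet> e k) t"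
  have t: "0 \<le> t" using st by simp
  have est: "sqrt (?T F t) \<le> sqrt (?T F s) + ?I" "sqrt (?T F s) \<le> sqrt (?T F t) + ?I" if "finite F" "F \<subseteq> K" for F
    using total_form_integral_estimates[OF weak_sol_forced_modes[OF sol cont that] zero_less_one st, of 0 0] delta
    by simp_all
  have "exp_norm 0 (u t) (u' t) \<le> exp_norm 0 (u s) (u' s) + ?I"
  proof (rule exp_norm_leI[OF weak_sol_domhalf[OF sol t]])
    fix F assume F: "finite F" "F \<subseteq> K"
    show "sqrt (\<Sum>k\<in>F. mode_form \<delta> 1 0 (lam k) (u t \<bullet> e k) (u' t \<bullet> e k)) \<le> exp_norm 0 (u s) (u' s) + ?I"
      using est(1)[OF F] finite_form_le_exp_norm[OF weak_sol_domhalf[OF sol st(1)] F, of 0 "u' s"] by (simp add: total_form_def)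
  qed
  moreover have "exp_norm 0 (u s) (u' s) \<le> exp_norm 0 (u t) (u' t) + ?I"
  proof (rule exp_norm_leI[OF weak_sol_domhalf[OF sol st(1)]])
    fix F assume F: "finite F" "F \<subseteq> K"
    show "sqrt (\<Sum>k\<in>F. mode_form \<delta> 1 0 (lam k) (u s \<bullet> e k) (u' s \<bullet> e k)) \<le> exp_norm 0 (u t) (u' t) + ?I"
      using est(2)[OF F] finite_form_le_exp_norm[OF weak_sol_domhalf[OF sol t] F, of 0 "u' t"] by (simp add: total_form_def)
  qed
  ultimately show ?thesis by (simp add: abs_le_iff)
qed

end

section \<open>Pure solutions and asymptotic profiles\<close>

lemma halfline_zero_derivative:
  fixes f :: "real \<Rightarrow> 'a::real_normed_vector"
  assumes t: "0 \<le> t" and f: "\<And>s. 0 \<le> s \<Longrightarrow> f s = 0"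
    and d: "(f has_vector_derivative f') (at t within {0..})"
  shows "f' = 0"
proof (rule vector_derivative_unique_within[OF _ d])
  \<comment> \<open>At \<open>t = 0\<close> the derivative is one-sided; it is still unique because
    points to the right accumulate there.\<close>
  have "at_right t \<le> at t within {0..}" using t by (intro at_le) auto
  then show "at t within {0..} \<noteq> bot" using trivial_limit_at_right_real[of t] by (metis bot.extremum_uniqueI)
  show "(f has_vector_derivative 0) (at t within {0..})"
    by (rule has_vector_derivative_transform[OF _ _ has_vector_derivative_const[of 0]]) (use t f in auto)
qed

text \<open>The assumption on \<open>u\<close> says nothing about \<open>u'\<close>, so the decay of
  the positive components has to be drawn from the equation: the weight forgets the initial data and
  a vanishing forcing leaves a vanishing remainder.\<close>

lemma tendsto_zero_of_upper_estimate:
  fixes f G :: "real \<Rightarrow> real"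
  assumes upper: "\<And>s t. \<lbrakk>0 \<le> s; s \<le> t\<rbrakk> \<Longrightarrow>
      exp (b * t) * f t \<le> C * (exp (b * s) * f s + integral {s..t} (\<lambda>\<tau>. exp (b * \<tau>) * G \<tau>))"
    and C: "0 \<le> C" and b: "0 < b" and f: "\<And>t. 0 \<le> t \<Longrightarrow> 0 \<le> f t"
    and cont: "continuous_on {0..} G" and lim: "(G \<longlongrightarrow> 0) at_top"
  shows "(f \<longlongrightarrow> 0) at_top"
proof (rule order_tendstoI)
  fix a :: real assume "a < 0"
  show "eventually (\<lambda>t. a < f t) at_top"
    using eventually_ge_at_top[of 0]
  proof eventually_elim
    case (elim t)
    then show ?case using f[of t] \<open>a < 0\<close> by linarith
  qed
next
  fix a :: real assume a: "0 < a"
  \<comment> \<open>The forcing contributes \<open>C * (\<eta> / b)\<close> in the long run, which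
    this choice keeps below \<open>a / 2\<close>; using \<open>C + 1\<close> avoids a division by
    zero.\<close>
  define \<eta> where "\<eta> = a * b / (2 * (C + 1))"
  have eta: "0 < \<eta>" using a b C by (simp add: \<eta>_def)
  have Ceta: "C * (\<eta> / b) \<le> a / 2"
  proof -
    have "C * (\<eta> / b) = (C / (C + 1)) * (a / 2)" using b C by (simp add: \<eta>_def)
    also have "\<dots> \<le> 1 * (a / 2)" using a C by (intro mult_right_mono) auto
    finally show ?thesis by simp
  qed
  obtain T0 where T0: "\<And>t. T0 \<le> t \<Longrightarrow> G t < \<eta>"
    using order_tendstoD(2)[OF lim eta] by (auto simp: eventually_at_top_linorder)
  define T where "T = max T0 0"
  have T: "0 \<le> T" "\<And>t. T \<le> t \<Longrightarrow> G t \<le> \<eta>" using T0 by (auto simp: T_def less_imp_le)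
  have bound: "f t \<le> C * (exp (b * T) * f T) * exp (- b * t) + a / 2" if t: "T \<le> t" for t
  proof -
    have i: "((\<lambda>\<tau>. \<eta> * exp (b * \<tau>)) has_integral \<eta> / b * exp (b * t) - \<eta> / b * exp (b * T)) {T..t}"
    proof (intro fundamental_theorem_of_calculus[OF t])
      fix x
      have "((\<lambda>\<tau>. \<eta> / b * exp (b * \<tau>)) has_real_derivative \<eta> / b * (exp (b * x) * b)) (at x within {T..t})"
        by (rule derivative_eq_intros refl | simp)+
      then show "((\<lambda>\<tau>. \<eta> / b * exp (b * \<tau>)) has_vector_derivative \<eta> * exp (b * x)) (at x within {T..t})"
        using b by (simp add: has_real_derivative_iff_has_vector_derivative)
    qed
    have "integral {T..t} (\<lambda>\<tau>. exp (b * \<tau>) * G \<tau>) \<le> integral {T..t} (\<lambda>\<tau>. \<eta> * exp (b * \<tau>))"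
    proof (rule integral_le)
      show "(\<lambda>\<tau>. exp (b * \<tau>) * G \<tau>) integrable_on {T..t}"
        using T by (intro integrable_continuous_real continuous_intros continuous_on_subset[OF cont]) auto
      show "(\<lambda>\<tau>. \<eta> * exp (b * \<tau>)) integrable_on {T..t}" using i by blast
      show "exp (b * x) * G x \<le> \<eta> * exp (b * x)" if "x \<in> {T..t}" for x
        using T(2)[of x] that by (simp add: mult.commute)
    qed
    also have "\<dots> \<le> \<eta> / b * exp (b * t)" using integral_unique[OF i] eta b by simp
    finally have "C * (exp (b * T) * f T + integral {T..t} (\<lambda>\<tau>. exp (b * \<tau>) * G \<tau>)) \<le> C * (exp (b * T) * f T + \<eta> / b * exp (b * t))"
      using C by (intro mult_left_mono) auto
    then have "exp (b * t) * f t \<le> C * (exp (b * T) * f T + \<eta> / b * exp (b * t))" using upper[OF T(1) t] by linarith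
    then have "f t \<le> C * (exp (b * T) * f T + \<eta> / b * exp (b * t)) * exp (- b * t)" unfolding exp_weight_le_iff .
    also have "\<dots> = C * (exp (b * T) * f T) * exp (- b * t) + C * (\<eta> / b) * (exp (b * t) * exp (- b * t))" by (simp add: algebra_simps)
    also have "exp (b * t) * exp (- b * t) = 1" by (simp flip: exp_add)
    finally show ?thesis using Ceta unfolding mult_1_right by linarith
  qed
  let ?A = "C * (exp (b * T) * f T)"
  have "exp_decay (\<lambda>t. ?A * exp (- b * t)) b" by (rule exp_decayI[where M = ?A]) simp
  from exp_decay_tendsto[OF this b] have "((\<lambda>t. ?A * exp (- b * t)) \<longlongrightarrow> 0) at_top"
    using C f[OF T(1)] by simp
  then have "eventually (\<lambda>t. ?A * exp (- b * t) < a / 2) at_top" using a by (intro order_tendstoD(2)) auto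
  then show "eventually (\<lambda>t. f t < a) at_top"
    using eventually_ge_at_top[of T]
  proof eventually_elim
    case (elim t)
    then show ?case using bound[of t] by linarith
  qed
qed

lemma mode_sol_diff:
  assumes "mode_sol \<delta> l x y g" "mode_sol \<delta> l x' y' (\<lambda>_. 0)"
  shows "mode_sol \<delta> l (\<lambda>t. x t - x' t) (\<lambda>t. y t - y' t) g"
  unfolding mode_sol_def
proof (intro allI impI conjI)
  fix t :: real assume t: "0 \<le> t"
  have d: "(x has_real_derivative y t) (at t within {0..})" "(x' has_real_derivative y' t) (at t within {0..})"
    "(y has_real_derivative - 2 * \<delta> * y t - l * x t + g t) (at t within {0..})"
    "(y' has_real_derivative - 2 * \<delta> * y' t - l * x' t + 0) (at t within {0..})"
    using assms t by (auto simp: mode_sol_def)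
  show "((\<lambda>t. x t - x' t) has_real_derivative y t - y' t) (at t within {0..})" by (intro DERIV_diff d)
  have "((\<lambda>t. y t - y' t) has_real_derivative (- 2 * \<delta> * y t - l * x t + g t) - (- 2 * \<delta> * y' t - l * x' t + 0)) (at t within {0..})"
    by (intro DERIV_diff d)
  then show "((\<lambda>t. y t - y' t) has_real_derivative - 2 * \<delta> * (y t - y' t) - l * (x t - x' t) + g t) (at t within {0..})"
    by (simp add: algebra_simps)
qed

lemma piece_eq:
  "piece e lam \<delta> v v' k r t = (if \<delta>\<^sup>2 \<le> lam k then (if r = \<delta> then v t \<bullet> e k else 0)
     else (if r = slow_rate \<delta> (lam k) then slow_coeff \<delta> (lam k) (v 0 \<bullet> e k) (v' 0 \<bullet> e k) * exp (- slow_rate \<delta> (lam k) * t) else 0)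
        + (if r = fast_rate \<delta> (lam k) then fast_coeff \<delta> (lam k) (v 0 \<bullet> e k) (v' 0 \<bullet> e k) * exp (- fast_rate \<delta> (lam k) * t) else 0))"
  unfolding piece_def Let_def slow_coeff_def fast_coeff_def slow_rate_def fast_rate_def ..

context damped_modes
begin

lemma homogeneous_form_le:
  assumes ms: "mode_sol \<delta> (lam k) x y (\<lambda>_. 0)" and k: "k \<in> K" and b: "b < r" and t: "0 \<le> t"
  shows "exp (b * t) * sqrt (mode_form \<delta> 1 r (lam k) (x t) (y t)) \<le> rate_const (r - b) * sqrt (mode_form \<delta> 1 r (lam k) (x 0) (y 0))"
proof -
  have "forced_modes {k} (\<lambda>_. x) (\<lambda>_. y) (\<lambda>_. 0)"
    unfolding forced_modes_def using ms k by (auto intro!: exI[of _ "\<lambda>_ _. 0"])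
  from finite_upper_estimate[OF this b order_refl t] show ?thesis by (simp add: total_form_def)
qed

text \<open>The exponents do not mix under the homogeneous flow; any weight below \<open>r\<close>
  shows it.\<close>

lemma homogeneous_form_zero:
  assumes ms: "mode_sol \<delta> (lam k) x y (\<lambda>_. 0)" and k: "k \<in> K" and t: "0 \<le> t"
    and "mode_form \<delta> 1 r (lam k) (x 0) (y 0) = 0"
  shows "mode_form \<delta> 1 r (lam k) (x t) (y t) = 0"
  using homogeneous_form_le[OF ms k _ t, of "r - 1" r] assms(4) mode_form_nonneg[of \<delta> 1 r "lam k" "x t" "y t"]
  by (simp add: mult_le_0_iff)

end

context damped_system
begin

lemma pureI:
  assumes z: "\<And>k t r. \<lbrakk>k \<in> K; 0 \<le> t; r \<noteq> r0\<rbrakk> \<Longrightarrow> mode_form \<delta> 1 r (lam k) (v t \<bullet> e k) (v' t \<bullet> e k) = 0"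
  shows "pure K e lam \<delta> v v' r0"
  unfolding pure_def
proof (intro ballI impI allI)
  fix r t :: real assume r: "r \<noteq> r0" and t: "0 \<le> t"
  have "piece e lam \<delta> v v' k r t = 0" if k: "k \<in> K" for k
  proof (cases "\<delta>\<^sup>2 \<le> lam k")
    case True
    have "v t \<bullet> e k = 0" if "r = \<delta>"
    proof -
      \<comment> \<open>The regularisation contributes the square of the coordinate itself, so a
        vanishing form forces it to be 0 also at the double root.\<close>
      have "0 = (v' t \<bullet> e k + \<delta> * (v t \<bullet> e k))\<^sup>2 + (lam k - \<delta>\<^sup>2) * (v t \<bullet> e k)\<^sup>2 + (v t \<bullet> e k)\<^sup>2"
        using z[OF k t r] True that by (simp add: mode_form_def algebra_simps)
      moreover have "0 \<le> (lam k - \<delta>\<^sup>2) * (v t \<bullet> e k)\<^sup>2" using True by simp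
      ultimately have "(v t \<bullet> e k)\<^sup>2 \<le> 0"
        using zero_le_power2[of "v' t \<bullet> e k + \<delta> * (v t \<bullet> e k)"] by linarith
      then show ?thesis by simp
    qed
    then show ?thesis using True by (simp add: piece_eq)
  next
    case False
    have "mode_form \<delta> 1 r (lam k) (v 0 \<bullet> e k) (v' 0 \<bullet> e k) = 0" by (rule z[OF k _ r]) simp
    then show ?thesis using False rates(5)[of "lam k" \<delta>] by (auto simp: piece_eq mode_form_def split: if_splits)
  qed
  then show "comp_r K e lam \<delta> v v' r t = 0" unfolding comp_r_def by (intro infsum_0) simp
qed

text \<open>The sum \<open>comp_r\<close> would also be 0 if its series did not converge. Its
  convergence therefore has to be shown before the individual pieces can be read off as
  coordinates.\<close>

lemma pureD:
  assumes sol: "weak_sol K e lam \<delta> v v' (\<lambda>_. 0)" and pure: "pure K e lam \<delta> v v' r0"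
    and k: "k \<in> K" and t: "0 \<le> t" and r: "r \<in> calD K lam \<delta>" "r \<noteq> r0"
  shows "mode_form \<delta> 1 r (lam k) (v t \<bullet> e k) (v' t \<bullet> e k) = 0"
proof -
  have piece0: "piece e lam \<delta> v v' j r s = 0" if s: "0 \<le> s" and j: "j \<in> K" for s j
  proof -
    \<comment> \<open>The time \<open>s\<close> is frozen and the family is constant in
      \<open>\<tau>\<close>: the lemma is used here only to sum the series.\<close>
    have "\<exists>z. continuous_on {0..} z \<and> (\<forall>\<tau>\<ge>0::real. \<forall>k\<in>K. z \<tau> \<bullet> e k = piece e lam \<delta> v v' k r s)"
    proof (rule riesz_fischer_dominated[OF onb, where f = "\<lambda>k _. piece e lam \<delta> v v' k r s"])
      show "(\<lambda>k. (v s \<bullet> e k)\<^sup>2 + mode_form \<delta> 1 r (lam k) (v 0 \<bullet> e k) (v' 0 \<bullet> e k)) summable_on K"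
        by (intro summable_on_add form_summable weak_sol_domhalf[OF sol] has_sum_imp_summable[OF onb_parseval[OF onb]]) simp
      fix k assume k: "k \<in> K"
      have mono: "(z * exp (- \<rho> * s))\<^sup>2 \<le> z\<^sup>2" if "0 \<le> \<rho>" for z \<rho> :: real
      proof -
        have "(exp (- \<rho> * s))\<^sup>2 \<le> 1\<^sup>2" using that s by (intro power_mono) auto
        then show ?thesis using mult_left_mono[of "(exp (- \<rho> * s))\<^sup>2" 1 "z\<^sup>2"] by (simp add: power_mult_distrib)
      qed
      have "(piece e lam \<delta> v v' k r s)\<^sup>2 \<le> mode_form \<delta> 1 r (lam k) (v 0 \<bullet> e k) (v' 0 \<bullet> e k)" if "\<not> \<delta>\<^sup>2 \<le> lam k"
        using that mono rates(5,7)[of "lam k" \<delta>] slow_rate_nonneg[OF lam[OF k], of \<delta>] delta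
        by (auto simp: piece_eq mode_form_def)
      then show "(piece e lam \<delta> v v' k r s)\<^sup>2 \<le> (v s \<bullet> e k)\<^sup>2 + mode_form \<delta> 1 r (lam k) (v 0 \<bullet> e k) (v' 0 \<bullet> e k)"
        using mode_form_nonneg[of \<delta> 1 r "lam k" "v 0 \<bullet> e k" "v' 0 \<bullet> e k"]
        by (cases "\<delta>\<^sup>2 \<le> lam k") (auto simp: piece_eq intro: add_increasing)
    qed auto
    then obtain z where z: "\<And>k. k \<in> K \<Longrightarrow> z \<bullet> e k = piece e lam \<delta> v v' k r s" by (metis order_refl)
    have "((\<lambda>k. (z \<bullet> e k) *\<^sub>R e k) has_sum z) K" using onb by (simp add: onb_def)
    then have "((\<lambda>k. piece e lam \<delta> v v' k r s *\<^sub>R e k) has_sum z) K" using z by (simp cong: has_sum_cong)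
    then have "comp_r K e lam \<delta> v v' r s = z" unfolding comp_r_def by (rule infsumI)
    then have "z = 0" using pure r s by (simp add: pure_def)
    then show ?thesis using z[OF j] by simp
  qed
  note ms = weak_sol_mode_sol[OF sol k, unfolded inner_zero_left]
  show ?thesis
  proof (cases "\<delta>\<^sup>2 \<le> lam k")
    case True
    \<comment> \<open>For these modes the piece records only the position; the velocity vanishes
      because the position does so on the whole half line.\<close>
    have "v t \<bullet> e k = 0 \<and> v' t \<bullet> e k = 0" if rd: "r = \<delta>"
    proof -
      have v0: "v s \<bullet> e k = 0" if "0 \<le> s" for s using piece0[OF that k] True rd by (simp add: piece_eq)
      have d: "((\<lambda>s. v s \<bullet> e k) has_vector_derivative v' t \<bullet> e k) (at t within {0..})"
        using ms t by (simp add: mode_sol_def has_real_derivative_iff_has_vector_derivative)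
      have "v' t \<bullet> e k = 0" by (rule halfline_zero_derivative[OF t _ d]) (rule v0)
      then show ?thesis using v0[OF t] by simp
    qed
    then show ?thesis using True by (auto simp: mode_form_def)
  next
    case False
    have "mode_form \<delta> 1 r (lam k) (v 0 \<bullet> e k) (v' 0 \<bullet> e k) = 0"
      using piece0[OF order_refl k] False rates(5)[of "lam k" \<delta>] by (auto simp: piece_eq mode_form_def split: if_splits)
    then show ?thesis by (rule homogeneous_form_zero[OF ms k t])
  qed
qed

text \<open>The profile is built mode by mode, by solving the homogeneous equation backwards
  from infinity; the estimates are uniform over finite sets of modes, so the sum over all modes
  converges.\<close>

lemma asymptotic_profile:
  assumes sol: "weak_sol K e lam \<delta> u u' g" and cont: "continuous_on {0..} g"
    and r0: "0 < r0" "r0 < \<kappa>" and g: "exp_decay (\<lambda>t. norm (g t)) \<kappa>"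
  shows "\<exists>v v'. weak_sol K e lam \<delta> v v' (\<lambda>_. 0) \<and>
    (\<forall>k\<in>K. \<forall>t\<ge>0. \<forall>r. r \<noteq> r0 \<longrightarrow> mode_form \<delta> 1 r (lam k) (v t \<bullet> e k) (v' t \<bullet> e k) = 0) \<and>
    (\<forall>b\<ge>\<kappa>. exp_decay (\<lambda>t. norm (g t)) b \<longrightarrow> exp_decay (\<lambda>t. exp_norm r0 (u t - v t) (u' t - v' t)) b)"
proof -
  obtain M where M: "0 \<le> M" "\<And>t. 0 \<le> t \<Longrightarrow> norm (g t) \<le> M * exp (- \<kappa> * t)" by (rule exp_decayE[OF g]) blast
  have gk: "\<bar>g t \<bullet> e k\<bar> \<le> M * exp (- \<kappa> * t)" if "k \<in> K" "0 \<le> t" for k t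
  proof -
    have "(g t \<bullet> e k)\<^sup>2 \<le> (norm (g t))\<^sup>2" using bessel[of "{k}" "g t"] that by simp
    then have "\<bar>g t \<bullet> e k\<bar> \<le> norm (g t)" using abs_le_square_iff[of "g t \<bullet> e k" "norm (g t)"] by simp
    then show ?thesis using M(2)[OF that(2)] by linarith
  qed
  \<comment> \<open>Above \<open>r0\<close>, so that the lower estimate applies, and within the
    range in which the limits of the single modes are known.\<close>
  define a where "a = r0 + (\<kappa> - r0) / 8"
  have a: "r0 < a" "a < r0 + (\<kappa> - r0) / 4" "a < \<kappa>" using r0 by (auto simp: a_def field_simps)
  have "\<forall>k\<in>K. \<exists>vx vy. mode_sol \<delta> (lam k) vx vy (\<lambda>_. 0) \<and>
      (\<forall>t\<ge>0. \<forall>r. r \<noteq> r0 \<longrightarrow> mode_form \<delta> 1 r (lam k) (vx t) (vy t) = 0) \<and>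
      ((\<lambda>t. exp (a * t) * sqrt (mode_form \<delta> 1 r0 (lam k) (u t \<bullet> e k - vx t) (u' t \<bullet> e k - vy t))) \<longlongrightarrow> 0) at_top"
    (is "\<forall>k\<in>K. \<exists>vx vy. ?P k vx vy")
  proof
    fix k assume k: "k \<in> K"
    obtain vx vy where "mode_sol \<delta> (lam k) vx vy (\<lambda>_. 0)"
      "\<forall>t\<ge>0. \<forall>r. r \<noteq> r0 \<longrightarrow> mode_form \<delta> 1 r (lam k) (vx t) (vy t) = 0"
      "\<forall>a<r0 + (\<kappa> - r0) / 4. ((\<lambda>t. exp (a * t) * sqrt (mode_form \<delta> 1 r0 (lam k) (u t \<bullet> e k - vx t) (u' t \<bullet> e k - vy t))) \<longlongrightarrow> 0) at_top"
      using mode_limit[OF weak_sol_mode_sol[OF sol k] delta gk[OF k] r0(2)] by blast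
    then have "?P k vx vy" using a(2) by blast
    then show "\<exists>vx vy. ?P k vx vy" by blast
  qed
  then obtain vx where "\<forall>k\<in>K. \<exists>vy. ?P k (vx k) vy" by (rule bchoice[THEN exE])
  then obtain vy where vxy: "\<forall>k\<in>K. ?P k (vx k) (vy k)" by (rule bchoice[THEN exE])
  then have ms: "\<And>k. k \<in> K \<Longrightarrow> mode_sol \<delta> (lam k) (vx k) (vy k) (\<lambda>_. 0)"
    and zero: "\<And>k t r. \<lbrakk>k \<in> K; 0 \<le> t; r \<noteq> r0\<rbrakk> \<Longrightarrow> mode_form \<delta> 1 r (lam k) (vx k t) (vy k t) = 0"
    and lim: "\<And>k. k \<in> K \<Longrightarrow> ((\<lambda>t. exp (a * t) * sqrt (mode_form \<delta> 1 r0 (lam k) (u t \<bullet> e k - vx k t) (u' t \<bullet> e k - vy k t))) \<longlongrightarrow> 0) at_top"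
    by blast+
  let ?T = "\<lambda>F t. total_form 1 r0 F (\<lambda>k t. u t \<bullet> e k - vx k t) (\<lambda>k t. u' t \<bullet> e k - vy k t) t"
  \<comment> \<open>The constant is independent of \<open>F\<close>: the limits of single modes
    enter only as vanishing boundary terms at infinity, so their nonuniformity disappears.\<close>
  have diff_bound: "sqrt (?T F s) \<le> rate_const (a - r0) * (M' / (b - a)) * exp (- b * s)"
    if F: "finite F" "F \<subseteq> K" and b: "a < b" and M': "0 \<le> M'" "\<And>t. 0 \<le> t \<Longrightarrow> norm (g t) \<le> M' * exp (- b * t)"
      and s: "0 \<le> s" for F M' b s
  proof (rule exp_bound_of_lower_estimate[where f = "\<lambda>t. sqrt (?T F t)" and G = "\<lambda>t. norm (g t)", OF _ rate_const_nonneg _ _ M' b s])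
    have fm: "forced_modes F (\<lambda>k t. u t \<bullet> e k - vx k t) (\<lambda>k t. u' t \<bullet> e k - vy k t) (\<lambda>t. norm (g t))"
      unfolding forced_modes_def
    proof (intro conjI exI[of _ "\<lambda>k t. g t \<bullet> e k"] ballI allI impI)
      show "mode_sol \<delta> (lam k) (\<lambda>t. u t \<bullet> e k - vx k t) (\<lambda>t. u' t \<bullet> e k - vy k t) (\<lambda>t. g t \<bullet> e k)" if "k \<in> F" for k
        using weak_sol_mode_sol[OF sol] ms F that by (intro mode_sol_diff) auto
    qed (use F bessel cont in \<open>auto intro!: continuous_intros\<close>)
    show "exp (a * s) * sqrt (?T F s) \<le> rate_const (a - r0) * (exp (a * t) * sqrt (?T F t) + integral {s..t} (\<lambda>\<tau>. exp (a * \<tau>) * norm (g \<tau>)))"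
      if "0 \<le> s" "s \<le> t" for s t by (rule finite_lower_estimate[OF fm a(1) that])
    show "continuous_on {0..} (\<lambda>t. norm (g t))" by (intro continuous_intros cont)
    let ?q = "\<lambda>k t. mode_form \<delta> 1 r0 (lam k) (u t \<bullet> e k - vx k t) (u' t \<bullet> e k - vy k t)"
    \<comment> \<open>Limits mode by mode suffice because \<open>F\<close> is finite and a Euclidean
      norm is at most the sum of the moduli.\<close>
    have "((\<lambda>t. \<Sum>k\<in>F. exp (a * t) * sqrt (?q k t)) \<longlongrightarrow> (\<Sum>k\<in>F. 0)) at_top"
      using F by (intro tendsto_sum lim) auto
    then have "((\<lambda>t. \<Sum>k\<in>F. exp (a * t) * sqrt (?q k t)) \<longlongrightarrow> 0) at_top" by simp
    then show "((\<lambda>t. exp (a * t) * sqrt (?T F t)) \<longlongrightarrow> 0) at_top"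
    proof (rule tendsto_sandwich[OF _ _ tendsto_const, rotated 2])
      show "\<forall>\<^sub>F t in at_top. 0 \<le> exp (a * t) * sqrt (?T F t)" by (simp add: total_form_nonneg)
      have "sqrt (?T F t) \<le> (\<Sum>k\<in>F. sqrt (?q k t))" for t
        using L2_set_le_sum[of F "\<lambda>k. sqrt (?q k t)"] by (simp add: L2_set_def total_form_def mode_form_nonneg)
      then show "\<forall>\<^sub>F t in at_top. exp (a * t) * sqrt (?T F t) \<le> (\<Sum>k\<in>F. exp (a * t) * sqrt (?q k t))"
        by (simp add: sum_distrib_left[symmetric])
    qed
  qed
  define q0 where "q0 k = mode_form \<delta> 1 r0 (lam k) (vx k 0) (vy k 0)" for k
  \<comment> \<open>At time 0 the profile is the data of \<open>u\<close> minus the difference; the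
    former has finite energy and the latter is bounded uniformly over finite sets.\<close>
  have q0: "q0 summable_on K"
  proof (rule nonneg_bdd_above_summable_on)
    let ?A = "(exp_norm r0 (u 0) (u' 0))\<^sup>2" and ?B = "(rate_const (a - r0) * (M / (\<kappa> - a)))\<^sup>2"
    have "sum q0 F \<le> 2 * ?A + 2 * ?B" if F: "finite F" "F \<subseteq> K" for F
    proof -
      have "sum q0 F \<le> (\<Sum>k\<in>F. 2 * mode_form \<delta> 1 r0 (lam k) (u 0 \<bullet> e k) (u' 0 \<bullet> e k)
          + 2 * mode_form \<delta> 1 r0 (lam k) (u 0 \<bullet> e k - vx k 0) (u' 0 \<bullet> e k - vy k 0))"
      proof (rule sum_mono)
        fix k
        show "q0 k \<le> 2 * mode_form \<delta> 1 r0 (lam k) (u 0 \<bullet> e k) (u' 0 \<bullet> e k)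
          + 2 * mode_form \<delta> 1 r0 (lam k) (u 0 \<bullet> e k - vx k 0) (u' 0 \<bullet> e k - vy k 0)"
          using mode_form_diff_le[of \<delta> r0 "lam k" "u 0 \<bullet> e k" "u 0 \<bullet> e k - vx k 0" "u' 0 \<bullet> e k" "u' 0 \<bullet> e k - vy k 0"]
          by (simp add: q0_def)
      qed
      also have "\<dots> = 2 * (\<Sum>k\<in>F. mode_form \<delta> 1 r0 (lam k) (u 0 \<bullet> e k) (u' 0 \<bullet> e k)) + 2 * ?T F 0"
        by (simp add: sum.distrib sum_distrib_left total_form_def)
      also have "\<dots> \<le> 2 * ?A + 2 * ?B"
      proof (intro add_mono mult_left_mono)
        show "(\<Sum>k\<in>F. mode_form \<delta> 1 r0 (lam k) (u 0 \<bullet> e k) (u' 0 \<bullet> e k)) \<le> ?A"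
          by (rule sqrt_le_D[OF finite_form_le_exp_norm[OF weak_sol_domhalf[OF sol order_refl] F]])
        show "?T F 0 \<le> ?B"
          using diff_bound[OF F a(3) M order_refl] by (intro sqrt_le_D) simp
      qed auto
      finally show ?thesis .
    qed
    then show "bdd_above (sum q0 ` {F. F \<subseteq> K \<and> finite F})" by (intro bdd_aboveI[of _ "2 * ?A + 2 * ?B"]) auto
  qed (simp add: q0_def mode_form_nonneg)
  \<comment> \<open>The weight 0 lies below \<open>r0\<close>, so each homogeneous mode is bounded
    at all times by its initial form; this gives the summable majorant for the synthesis.\<close>
  define R where "R = (rate_const r0)\<^sup>2"
  have "\<exists>v v'. weak_sol K e lam \<delta> v v' (\<lambda>_. 0) \<and> (\<forall>k\<in>K. \<forall>t\<ge>0. v t \<bullet> e k = vx k t \<and> v' t \<bullet> e k = vy k t)"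
  proof (rule weak_sol_of_modes[OF ms])
    show "(\<lambda>k. lower_const * (R * q0 k)) summable_on K" by (intro summable_on_cmult_right q0)
    fix k and t :: real assume k: "k \<in> K" and t: "0 \<le> t"
    let ?f = "\<lambda>r. mode_form \<delta> 1 r (lam k) (vx k t) (vy k t)"
    have "(\<Sum>r\<in>calD K lam \<delta>. ?f r) = (\<Sum>r\<in>calD K lam \<delta>. if r = r0 then ?f r0 else 0)"
      using zero[OF k t] by (intro sum.cong) auto
    also have "\<dots> \<le> ?f r0" using finite_exps by (simp add: mode_form_nonneg)
    also have "\<dots> \<le> R * q0 k"
    proof -
      have "sqrt (?f r0) \<le> rate_const r0 * sqrt (q0 k)"
        using homogeneous_form_le[OF ms[OF k] k r0(1) t] by (simp add: q0_def)
      then have "?f r0 \<le> (rate_const r0 * sqrt (q0 k))\<^sup>2" by (rule sqrt_le_D)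
      then show ?thesis by (simp add: R_def q0_def power_mult_distrib mode_form_nonneg)
    qed
    finally have "lower_const * (\<Sum>r\<in>calD K lam \<delta>. ?f r) \<le> lower_const * (R * q0 k)"
      by (intro mult_left_mono const_nonneg)
    then show "(vy k t)\<^sup>2 + (1 + lam k) * (vx k t)\<^sup>2 \<le> lower_const * (R * q0 k)"
      using mode_le_positive_forms(2)[OF k, of "vy k t" "vx k t"] by linarith
  qed
  then obtain v v' where v: "weak_sol K e lam \<delta> v v' (\<lambda>_. 0)"
    "\<And>k t. \<lbrakk>k \<in> K; 0 \<le> t\<rbrakk> \<Longrightarrow> v t \<bullet> e k = vx k t \<and> v' t \<bullet> e k = vy k t" by blast
  \<comment> \<open>One profile serves all rates: it was fixed with \<open>\<kappa>\<close>, and a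
    faster forcing only improves the same estimate.\<close>
  have "exp_decay (\<lambda>t. exp_norm r0 (u t - v t) (u' t - v' t)) b" if b: "\<kappa> \<le> b" "exp_decay (\<lambda>t. norm (g t)) b" for b
  proof -
    obtain M' where M': "0 \<le> M'" "\<And>t. 0 \<le> t \<Longrightarrow> norm (g t) \<le> M' * exp (- b * t)" by (rule exp_decayE[OF b(2)]) blast
    have ab: "a < b" using a b by simp
    show ?thesis
    proof (rule exp_decayI[where M = "rate_const (a - r0) * (M' / (b - a))"])
      fix t :: real assume t: "0 \<le> t"
      show "exp_norm r0 (u t - v t) (u' t - v' t) \<le> rate_const (a - r0) * (M' / (b - a)) * exp (- b * t)"
      proof (rule exp_norm_leI[OF domhalf_diff[OF weak_sol_domhalf[OF sol t] weak_sol_domhalf[OF v(1) t]]])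
        fix F assume F: "finite F" "F \<subseteq> K"
        have "(\<Sum>k\<in>F. mode_form \<delta> 1 r0 (lam k) ((u t - v t) \<bullet> e k) ((u' t - v' t) \<bullet> e k)) = ?T F t"
          unfolding total_form_def using F v(2) t by (intro sum.cong) (auto simp: inner_diff_left)
        then show "sqrt (\<Sum>k\<in>F. mode_form \<delta> 1 r0 (lam k) ((u t - v t) \<bullet> e k) ((u' t - v' t) \<bullet> e k))
            \<le> rate_const (a - r0) * (M' / (b - a)) * exp (- b * t)"
          using diff_bound[OF F ab M' t] by simp
      qed
    qed
  qed
  then show ?thesis using v zero by (intro exI[of _ v] exI[of _ v']) auto
qed

end

section \<open>Solutions of the differential inequality\<close>

lemma less_beta0_iff:
  assumes fin: "finite (calD K lam \<delta>)" and ne: "calD K lam \<delta> \<noteq> {}"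
  shows "ereal \<gamma> < beta0 K lam \<delta> r0 \<longleftrightarrow> (\<forall>r\<in>calD K lam \<delta>. r0 < r \<longrightarrow> \<gamma> < r)"
proof (cases "\<exists>r\<in>calD K lam \<delta>. r0 < r")
  case True
  then obtain r where r: "r \<in> calD K lam \<delta>" "r0 < r" by blast
  then have "r0 < Max (calD K lam \<delta>)" using Max_ge[OF fin r(1)] by linarith
  moreover have "\<gamma> < Min {r \<in> calD K lam \<delta>. r > r0} \<longleftrightarrow> (\<forall>r\<in>{r \<in> calD K lam \<delta>. r > r0}. \<gamma> < r)"
    using True fin by (intro Min_gr_iff) auto
  ultimately show ?thesis by (auto simp: beta0_def)
next
  case False
  then have "Max (calD K lam \<delta>) \<le> r0" using fin ne by (simp add: not_less)
  then show ?thesis using False by (auto simp: beta0_def)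
qed

lemma polynomial_lower_bound_not_exp_decay:
  fixes f :: "real \<Rightarrow> real"
  assumes p: "0 < p" and M: "0 < M" and low: "\<And>t. T \<le> t \<Longrightarrow> M / (1 + t) powr (1 / p) \<le> f t"
    and gam: "0 < \<gamma>" and lim: "((\<lambda>t. f t * exp (\<gamma> * t)) \<longlongrightarrow> 0) at_top"
  shows False
proof -
  \<comment> \<open>The entry 1 gives \<open>\<eta> * (1 + t) \<le> 1 + \<eta> * t\<close>; the
    entry \<open>\<gamma> * p\<close> keeps the power \<open>1 / p\<close> of
    \<open>exp (\<eta> * t)\<close> below \<open>exp (\<gamma> * t)\<close>.\<close>
  define \<eta> where "\<eta> = min 1 (\<gamma> * p)"
  have eta: "0 < \<eta>" "\<eta> \<le> 1" "\<eta> / p \<le> \<gamma>" using p gam by (auto simp: \<eta>_def field_simps min_def)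
  define m where "m = M * \<eta> powr (1 / p)"
  have m: "0 < m" using M eta by (simp add: m_def)
  have ge: "m \<le> f t * exp (\<gamma> * t)" if t: "max T 0 \<le> t" for t
  proof -
    have t0: "0 \<le> t" "T \<le> t" using t by auto
    have "\<eta> * (1 + t) \<le> 1 + \<eta> * t" using eta by (simp add: algebra_simps)
    also have "\<dots> \<le> exp (\<eta> * t)" by (rule exp_ge_add_one_self)
    finally have "(\<eta> * (1 + t)) powr (1 / p) \<le> exp (\<eta> * t) powr (1 / p)"
      using eta t0 p by (intro powr_mono2) auto
    also have "\<dots> = exp (\<eta> / p * t)" by (simp add: exp_powr_real)
    also have "\<dots> \<le> exp (\<gamma> * t)" using mult_right_mono[OF eta(3) t0(1)] by simp
    finally have "\<eta> powr (1 / p) * (1 + t) powr (1 / p) \<le> exp (\<gamma> * t)" by (simp only: powr_mult)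
    then have "M / (1 + t) powr (1 / p) * (\<eta> powr (1 / p) * (1 + t) powr (1 / p)) \<le> f t * exp (\<gamma> * t)"
      using low[OF t0(2)] M t0 by (intro mult_mono) (auto intro: order_trans[OF _ low[OF t0(2)]])
    then show ?thesis using t0 by (simp add: m_def)
  qed
  have "m \<le> 0"
  proof (rule tendsto_lowerbound[OF lim])
    show "\<forall>\<^sub>F t in at_top. m \<le> f t * exp (\<gamma> * t)"
      using eventually_ge_at_top[of "max T 0"] by eventually_elim (rule ge)
  qed simp
  then show False using m by simp
qed

context damped_system
begin

lemma exp_norm_le_norms:
  assumes "x \<in> domhalf K e lam"
  shows "exp_norm r x y \<le> sqrt upper_const * (norm y + dnorm K e lam x)"
proof (rule exp_norm_leI[OF assms])
  fix F assume F: "finite F" "F \<subseteq> K"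
  have d0: "0 \<le> dnorm K e lam x" by (simp add: dnorm_def)
  have "(\<Sum>k\<in>F. mode_form \<delta> 1 r (lam k) (x \<bullet> e k) (y \<bullet> e k)) \<le> (\<Sum>k\<in>F. upper_const * ((y \<bullet> e k)\<^sup>2 + (1 + lam k) * (x \<bullet> e k)\<^sup>2))"
    using F by (intro sum_mono mode_form_le) auto
  also have "\<dots> = upper_const * (\<Sum>k\<in>F. (y \<bullet> e k)\<^sup>2 + (1 + lam k) * (x \<bullet> e k)\<^sup>2)" by (simp add: sum_distrib_left)
  also have "\<dots> \<le> upper_const * ((norm y)\<^sup>2 + (dnorm K e lam x)\<^sup>2)"
    using F lam by (intro mult_left_mono const_nonneg finite_sum_le_has_sum[OF energy_has_sum[OF assms]]) auto
  also have "\<dots> \<le> upper_const * (norm y + dnorm K e lam x)\<^sup>2"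
    using const_nonneg d0 by (intro mult_left_mono) (auto simp: power2_sum)
  finally have "sqrt (\<Sum>k\<in>F. mode_form \<delta> 1 r (lam k) (x \<bullet> e k) (y \<bullet> e k)) \<le> sqrt (upper_const * (norm y + dnorm K e lam x)\<^sup>2)"
    by (rule real_sqrt_le_mono)
  then show "sqrt (\<Sum>k\<in>F. mode_form \<delta> 1 r (lam k) (x \<bullet> e k) (y \<bullet> e k)) \<le> sqrt upper_const * (norm y + dnorm K e lam x)"
    using d0 by (simp add: real_sqrt_mult)
qed

text \<open>Room strictly above \<open>r0\<close> but below every competing rate. It is needed to
  build the profile and again to show that a trivial solution is not fast.\<close>

lemma exists_rate_above:
  assumes "0 < r0" "0 < m"
  shows "\<exists>b>r0. b < (1 + m) * r0 \<and> (\<forall>r\<in>calD K lam \<delta>. r0 < r \<longrightarrow> b < r)"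
proof -
  let ?S = "insert ((1 + m) * r0) {r \<in> calD K lam \<delta>. r0 < r}"
  have fin: "finite ?S" using finite_exps by simp
  have "r0 < Min ?S" using fin assms by (subst Min_gr_iff) auto
  then obtain b where b: "r0 < b" "b < Min ?S" using dense by blast
  then show ?thesis using fin by (intro exI[of _ b]) (auto simp: Min_gr_iff)
qed

lemma pure_exp_norm_zero:
  assumes "weak_sol K e lam \<delta> v v' (\<lambda>_. 0)" "pure K e lam \<delta> v v' r0" "0 \<le> t" "r \<in> calD K lam \<delta>" "r \<noteq> r0"
  shows "exp_norm r (v t) (v' t) = 0"
  using assms by (intro exp_norm_eq_0 pureD)

lemma pure_norms_le:
  assumes sol: "weak_sol K e lam \<delta> v v' (\<lambda>_. 0)" and pure: "pure K e lam \<delta> v v' r0" and t: "0 \<le> t"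
  shows "norm (v' t) + dnorm K e lam (v t) \<le> norm_const * exp_norm r0 (v t) (v' t)"
proof -
  have "(\<Sum>r\<in>calD K lam \<delta>. exp_norm r (v t) (v' t)) = (\<Sum>r\<in>calD K lam \<delta>. if r = r0 then exp_norm r0 (v t) (v' t) else 0)"
    using pure_exp_norm_zero[OF sol pure t] by (intro sum.cong) auto
  also have "\<dots> \<le> exp_norm r0 (v t) (v' t)" using finite_exps exp_norm_nonneg by simp
  finally have "norm_const * (\<Sum>r\<in>calD K lam \<delta>. exp_norm r (v t) (v' t)) \<le> norm_const * exp_norm r0 (v t) (v' t)"
    using norm_const_pos by (intro mult_left_mono) auto
  then show ?thesis using norms_le_exp_norms[OF weak_sol_domhalf[OF sol t], of "v' t"] by linarith
qed

text \<open>Integration from infinity with zero forcing: once the boundary term vanishes for a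
  weight above \<open>r0\<close>, nothing is left.\<close>

lemma pure_zero_if_fast:
  assumes sol: "weak_sol K e lam \<delta> v v' (\<lambda>_. 0)" and pure: "pure K e lam \<delta> v v' r0" and gam: "r0 < \<gamma>"
    and lim: "((\<lambda>t. (norm (v' t) + dnorm K e lam (v t)) * exp (\<gamma> * t)) \<longlongrightarrow> 0) at_top" and s: "0 \<le> s"
  shows "v s = 0"
proof -
  let ?E = "\<lambda>t. exp_norm r0 (v t) (v' t)"
  have "((\<lambda>t. sqrt upper_const * ((norm (v' t) + dnorm K e lam (v t)) * exp (\<gamma> * t))) \<longlongrightarrow> sqrt upper_const * 0) at_top"
    by (intro tendsto_intros lim)
  then have lim': "((\<lambda>t. sqrt upper_const * ((norm (v' t) + dnorm K e lam (v t)) * exp (\<gamma> * t))) \<longlongrightarrow> 0) at_top" by simp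
  have limE: "((\<lambda>t. exp (\<gamma> * t) * ?E t) \<longlongrightarrow> 0) at_top"
  proof (rule tendsto_sandwich[OF _ _ tendsto_const lim'])
    show "\<forall>\<^sub>F t in at_top. 0 \<le> exp (\<gamma> * t) * ?E t" by (simp add: exp_norm_nonneg)
    show "\<forall>\<^sub>F t in at_top. exp (\<gamma> * t) * ?E t \<le> sqrt upper_const * ((norm (v' t) + dnorm K e lam (v t)) * exp (\<gamma> * t))"
      using eventually_ge_at_top[of 0]
    proof eventually_elim
      case (elim t)
      have "exp (\<gamma> * t) * ?E t \<le> exp (\<gamma> * t) * (sqrt upper_const * (norm (v' t) + dnorm K e lam (v t)))"
        by (intro mult_left_mono exp_norm_le_norms weak_sol_domhalf[OF sol elim]) auto
      then show ?case by (simp add: mult_ac)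
    qed
  qed
  have "?E s \<le> rate_const (\<gamma> - r0) * (0 / ((\<gamma> + 1) - \<gamma>)) * exp (- (\<gamma> + 1) * s)"
  proof (rule exp_bound_of_lower_estimate[where f = ?E and G = "\<lambda>_. 0" and a = \<gamma>, OF _ rate_const_nonneg limE])
    show "exp (\<gamma> * s) * ?E s \<le> rate_const (\<gamma> - r0) * (exp (\<gamma> * t) * ?E t + integral {s..t} (\<lambda>\<tau>. exp (\<gamma> * \<tau>) * 0))"
      if "0 \<le> s" "s \<le> t" for s t
      using exp_norm_lower_estimate[OF sol continuous_on_const gam that] by simp
  qed (use s in auto)
  then have "norm_const * ?E s \<le> 0" using norm_const_pos by (simp add: mult_le_0_iff)
  then have "norm (v' s) + dnorm K e lam (v s) \<le> 0" using pure_norms_le[OF sol pure s] by linarith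
  moreover have "norm (v s) \<le> dnorm K e lam (v s)" by (rule norm_le_dnorm)
  ultimately have "norm (v s) \<le> 0" using norm_ge_zero[of "v' s"] by linarith
  then show ?thesis by simp
qed

lemma pure_exp_decay:
  assumes sol: "weak_sol K e lam \<delta> v v' (\<lambda>_. 0)" and pure: "pure K e lam \<delta> v v' r0" and b: "b < r0"
  shows "exp_decay (\<lambda>t. norm (v t)) b"
proof -
  have "exp_decay (\<lambda>t. exp_norm r0 (v t) (v' t)) b"
  proof (rule exp_decay_of_upper_estimate[where G = "\<lambda>_. 0" and c = "b + 1", OF _ rate_const_nonneg])
    show "exp (b * t) * exp_norm r0 (v t) (v' t) \<le> rate_const (r0 - b) * (exp_norm r0 (v 0) (v' 0) + integral {0..t} (\<lambda>\<tau>. exp (b * \<tau>) * 0))"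
      if "0 \<le> t" for t
      using exp_norm_upper_estimate[OF sol continuous_on_const b order_refl that] by simp
    show "exp_decay (\<lambda>_. 0) (b + 1)" by (rule exp_decayI[where M = 0]) simp
  qed auto
  then show ?thesis
  proof (rule exp_decay_le)
    fix t :: real assume t: "0 \<le> t"
    show "norm (v t) \<le> norm_const * exp_norm r0 (v t) (v' t)"
      using pure_norms_le[OF sol pure t] norm_le_dnorm(1)[of "v t"] norm_ge_zero[of "v' t"] by linarith
  qed (use norm_const_pos in simp)
qed

end

section \<open>Components of a solution of the inequality, and the alternatives\<close>

locale inequality_solution = damped_system K lam \<delta> c e
  for K :: "'k set" and lam :: "'k \<Rightarrow> real" and \<delta> c :: real and e :: "'k \<Rightarrow> 'a::{real_inner,complete_space}" +
  fixes u u' g :: "real \<Rightarrow> 'a" and K0 p q :: real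
  assumes sol: "weak_sol K e lam \<delta> u u' g" and cont: "continuous_on {0..} g"
    and K0: "0 \<le> K0" and p: "0 < p" and q: "0 < q"
    and g_le: "\<And>t. 0 \<le> t \<Longrightarrow> norm (g t) \<le> K0 * (norm (u t) powr (1 + p) + halfnorm K e lam (u t) powr (1 + q))"
    and lim: "((\<lambda>t. dnorm K e lam (u t)) \<longlongrightarrow> 0) at_top"
begin

definition comp_norm :: "real \<Rightarrow> real \<Rightarrow> real" where
  "comp_norm r t = exp_norm r (u t) (u' t)"

definition positive_norm :: "real \<Rightarrow> real" where
  "positive_norm t = (\<Sum>r\<in>calD K lam \<delta> - {0}. comp_norm r t)"

lemma comp_norm_nonneg: "0 \<le> comp_norm r t"
  by (simp add: comp_norm_def exp_norm_nonneg)

lemma positive_norm_nonneg: "0 \<le> positive_norm t"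
  by (simp add: positive_norm_def sum_nonneg comp_norm_nonneg)

text \<open>If 0 is not an exponent, the neutral norm vanishes by itself. Operators with and without
  kernel are thus treated together.\<close>

lemma sum_comp_norm: "(\<Sum>r\<in>calD K lam \<delta>. comp_norm r t) = comp_norm 0 t + positive_norm t"
proof (cases "0 \<in> calD K lam \<delta>")
  case True
  then show ?thesis using finite_exps by (simp add: positive_norm_def sum.remove)
next
  case False
  then show ?thesis by (simp add: positive_norm_def comp_norm_def exp_norm_outside)
qed

lemma dom: "0 \<le> t \<Longrightarrow> u t \<in> domhalf K e lam"
  by (rule weak_sol_domhalf[OF sol])

lemma norms_le: "0 \<le> t \<Longrightarrow> norm (u' t) + dnorm K e lam (u t) \<le> norm_const * (comp_norm 0 t + positive_norm t)"
  using norms_le_exp_norms[OF dom, of t "u' t"] sum_comp_norm[of t, unfolded comp_norm_def[of _ t]]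
  by (simp add: comp_norm_def)

lemma norms_le_positive: "0 \<le> t \<Longrightarrow> norm (u' t) + halfnorm K e lam (u t) \<le> norm_const * positive_norm t"
  using norms_le_positive_exp_norms[OF dom, of t "u' t"] by (simp add: comp_norm_def positive_norm_def)

lemma norm_g_cont: "continuous_on {0..} (\<lambda>t. norm (g t))"
  by (intro continuous_intros cont)

definition force_const :: real where
  "force_const = K0 * (norm_const powr (1 + p) + norm_const powr (1 + q))"

lemma force_const_nonneg: "0 \<le> force_const"
  using K0 by (simp add: force_const_def)

text \<open>The power \<open>1 + q\<close> falls on \<open>positive_norm\<close> alone because the
  neutral component has no potential energy; without this the slow rate would depend on
  \<open>q\<close>.\<close>

lemma norm_g_le:
  assumes t: "0 \<le> t"
  shows "norm (g t) \<le> force_const * ((comp_norm 0 t + positive_norm t) powr (1 + p) + positive_norm t powr (1 + q))"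
proof -
  let ?N = "comp_norm 0 t + positive_norm t" and ?Y = "positive_norm t"
  let ?P = "norm_const powr (1 + p)" and ?Q = "norm_const powr (1 + q)"
  have N0: "0 \<le> ?N" "0 \<le> ?Y" using comp_norm_nonneg positive_norm_nonneg by auto
  have "norm (u t) \<le> norm_const * ?N" using norms_le[OF t] norm_le_dnorm(1)[of "u t"] norm_ge_zero[of "u' t"] by linarith
  then have "norm (u t) powr (1 + p) \<le> (norm_const * ?N) powr (1 + p)" using p by (intro powr_mono2) auto
  then have 1: "norm (u t) powr (1 + p) \<le> ?P * ?N powr (1 + p)" by (simp only: powr_mult)
  have "halfnorm K e lam (u t) \<le> norm_const * ?Y" using norms_le_positive[OF t] norm_ge_zero[of "u' t"] by linarith
  then have "halfnorm K e lam (u t) powr (1 + q) \<le> (norm_const * ?Y) powr (1 + q)" using q halfnorm_nonneg by (intro powr_mono2) auto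
  then have 2: "halfnorm K e lam (u t) powr (1 + q) \<le> ?Q * ?Y powr (1 + q)" by (simp only: powr_mult)
  have 3: "0 \<le> ?P * ?Y powr (1 + q)" "0 \<le> ?Q * ?N powr (1 + p)" by auto
  have "norm (u t) powr (1 + p) + halfnorm K e lam (u t) powr (1 + q) \<le> (?P + ?Q) * (?N powr (1 + p) + ?Y powr (1 + q))"
    unfolding distrib_left distrib_right using 1 2 3 by linarith
  then have "K0 * (norm (u t) powr (1 + p) + halfnorm K e lam (u t) powr (1 + q)) \<le> K0 * ((?P + ?Q) * (?N powr (1 + p) + ?Y powr (1 + q)))"
    using K0 by (intro mult_left_mono)
  then show ?thesis using g_le[OF t] by (simp add: force_const_def mult.assoc)
qed

lemma norm_u_tendsto: "((\<lambda>t. norm (u t)) \<longlongrightarrow> 0) at_top"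
  by (rule tendsto_sandwich[OF _ _ tendsto_const lim]) (auto intro!: always_eventually norm_le_dnorm)

lemma norm_g_tendsto: "((\<lambda>t. norm (g t)) \<longlongrightarrow> 0) at_top"
proof -
  have h: "((\<lambda>t. halfnorm K e lam (u t)) \<longlongrightarrow> 0) at_top"
    by (rule tendsto_sandwich[OF _ _ tendsto_const lim]) (auto intro!: always_eventually norm_le_dnorm halfnorm_nonneg)
  have 1: "((\<lambda>t. norm (u t) powr (1 + p)) \<longlongrightarrow> 0) at_top"
    using p by (intro tendsto_zero_powrI[OF norm_u_tendsto tendsto_const]) auto
  have 2: "((\<lambda>t. halfnorm K e lam (u t) powr (1 + q)) \<longlongrightarrow> 0) at_top"
    using q halfnorm_nonneg by (intro tendsto_zero_powrI[OF h tendsto_const]) auto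
  have "((\<lambda>t. K0 * (norm (u t) powr (1 + p) + halfnorm K e lam (u t) powr (1 + q))) \<longlongrightarrow> K0 * (0 + 0)) at_top"
    by (intro tendsto_intros 1 2)
  then have "((\<lambda>t. K0 * (norm (u t) powr (1 + p) + halfnorm K e lam (u t) powr (1 + q))) \<longlongrightarrow> 0) at_top" by simp
  then show ?thesis
  proof (rule tendsto_sandwich[OF _ _ tendsto_const, rotated 2])
    show "\<forall>\<^sub>F t in at_top. norm (g t) \<le> K0 * (norm (u t) powr (1 + p) + halfnorm K e lam (u t) powr (1 + q))"
      using eventually_ge_at_top[of 0] by eventually_elim (rule g_le)
  qed simp
qed

lemma comp_norm_tendsto:
  assumes "0 < r"
  shows "(comp_norm r \<longlongrightarrow> 0) at_top"
proof (rule tendsto_zero_of_upper_estimate[OF _ rate_const_nonneg _ comp_norm_nonneg norm_g_cont norm_g_tendsto])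
  show "exp (r / 2 * t) * comp_norm r t \<le> rate_const (r - r / 2) * (exp (r / 2 * s) * comp_norm r s + integral {s..t} (\<lambda>\<tau>. exp (r / 2 * \<tau>) * norm (g \<tau>)))"
    if "0 \<le> s" "s \<le> t" for s t
    unfolding comp_norm_def using assms by (intro exp_norm_upper_estimate[OF sol cont _ that]) simp
qed (use assms in simp)

lemma positive_exps: "r \<in> calD K lam \<delta> - {0} \<Longrightarrow> 0 < r"
  using exps_nonneg[of r] by auto

lemma positive_norm_tendsto: "(positive_norm \<longlongrightarrow> 0) at_top"
proof -
  have "((\<lambda>t. \<Sum>r\<in>calD K lam \<delta> - {0}. comp_norm r t) \<longlongrightarrow> (\<Sum>r\<in>calD K lam \<delta> - {0}. 0)) at_top"
    by (intro tendsto_sum comp_norm_tendsto positive_exps)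
  then show ?thesis by (simp add: positive_norm_def[abs_def])
qed

text \<open>The velocity in the comparison of norms is itself controlled by the positive exponents.
  The estimate serves to show that the neutral norm tends to 0 and to turn its lower bound into one
  for \<open>norm (u t)\<close>.\<close>

lemma neutral_le: "0 \<le> t \<Longrightarrow> comp_norm 0 t \<le> sqrt upper_const * norm (u t) + sqrt upper_const * norm_const * positive_norm t"
proof -
  assume t: "0 \<le> t"
  have "norm (u' t) \<le> norm_const * positive_norm t" using norms_le_positive[OF t] halfnorm_nonneg[of "u t"] by linarith
  then have "sqrt upper_const * norm (u' t) \<le> sqrt upper_const * (norm_const * positive_norm t)"
    using const_nonneg by (intro mult_left_mono) auto
  then show ?thesis using neutral_exp_norm_le[OF dom[OF t], of "u' t"] by (simp add: comp_norm_def algebra_simps)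
qed

lemma neutral_tendsto: "(comp_norm 0 \<longlongrightarrow> 0) at_top"
proof -
  have "((\<lambda>t. sqrt upper_const * norm (u t) + sqrt upper_const * norm_const * positive_norm t) \<longlongrightarrow> sqrt upper_const * 0 + sqrt upper_const * norm_const * 0) at_top"
    by (intro tendsto_intros norm_u_tendsto positive_norm_tendsto)
  then have "((\<lambda>t. sqrt upper_const * norm (u t) + sqrt upper_const * norm_const * positive_norm t) \<longlongrightarrow> 0) at_top" by simp
  then show ?thesis
  proof (rule tendsto_sandwich[OF _ _ tendsto_const, rotated 2])
    show "\<forall>\<^sub>F t in at_top. comp_norm 0 t \<le> sqrt upper_const * norm (u t) + sqrt upper_const * norm_const * positive_norm t"
      using eventually_ge_at_top[of 0] by eventually_elim (rule neutral_le)
  qed (simp add: comp_norm_nonneg)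
qed

lemma positive_norm_estimate:
  "\<exists>b>0. \<exists>C\<ge>0. \<forall>s t. 0 \<le> s \<longrightarrow> s \<le> t \<longrightarrow>
     positive_norm t \<le> C * (exp (- b * (t - s)) * positive_norm s + integral {s..t} (\<lambda>\<tau>. norm (g \<tau>)))"
proof -
  let ?P = "calD K lam \<delta> - {0}"
  \<comment> \<open>Half of the least positive exponent, so that every positive exponent exceeds it;
    inserting 1 covers the case in which there is none.\<close>
  define b where "b = Min (insert 1 ?P) / 2"
  have fin: "finite (insert 1 ?P)" using finite_exps by simp
  have min0: "0 < Min (insert 1 ?P)" using fin positive_exps by (subst Min_gr_iff) auto
  have b: "0 < b" "\<And>r. r \<in> ?P \<Longrightarrow> b < r"
  proof -
    show "0 < b" using min0 by (simp add: b_def)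
    fix r assume "r \<in> ?P"
    then have "Min (insert 1 ?P) \<le> r" using fin by (intro Min_le) auto
    then show "b < r" using min0 by (simp add: b_def)
  qed
  define C where "C = (\<Sum>r\<in>?P. rate_const (r - b))"
  have C: "0 \<le> C" by (simp add: C_def sum_nonneg rate_const_nonneg)
  have "positive_norm t \<le> C * (exp (- b * (t - s)) * positive_norm s + integral {s..t} (\<lambda>\<tau>. norm (g \<tau>)))"
    if st: "0 \<le> s" "s \<le> t" for s t
  proof -
    let ?I = "integral {s..t} (\<lambda>\<tau>. norm (g \<tau>))"
    have int1: "(\<lambda>\<tau>. norm (g \<tau>)) integrable_on {s..t}"
      by (rule integrable_continuous_real) (rule continuous_on_subset[OF norm_g_cont], use st in auto)
    have "integral {s..t} (\<lambda>\<tau>. exp (b * \<tau>) * norm (g \<tau>)) \<le> integral {s..t} (\<lambda>\<tau>. exp (b * t) * norm (g \<tau>))"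
    proof (rule integral_le)
      show "(\<lambda>\<tau>. exp (b * \<tau>) * norm (g \<tau>)) integrable_on {s..t}"
        using st by (intro integrable_continuous_real continuous_intros continuous_on_subset[OF cont]) auto
      show "(\<lambda>\<tau>. exp (b * t) * norm (g \<tau>)) integrable_on {s..t}" using int1 by (rule integrable_on_mult_right)
    qed (use b in \<open>auto intro!: mult_right_mono\<close>)
    then have J: "integral {s..t} (\<lambda>\<tau>. exp (b * \<tau>) * norm (g \<tau>)) \<le> exp (b * t) * ?I" by simp
    have r: "comp_norm r t \<le> rate_const (r - b) * (exp (- b * (t - s)) * positive_norm s + ?I)" if r: "r \<in> ?P" for r
    proof -
      have "comp_norm r s \<le> positive_norm s"
        unfolding positive_norm_def using r finite_exps comp_norm_nonneg by (intro member_le_sum) auto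
      then have "exp (b * s) * comp_norm r s + integral {s..t} (\<lambda>\<tau>. exp (b * \<tau>) * norm (g \<tau>)) \<le> exp (b * s) * positive_norm s + exp (b * t) * ?I"
        using J by (intro add_mono mult_left_mono) auto
      then have "rate_const (r - b) * (exp (b * s) * comp_norm r s + integral {s..t} (\<lambda>\<tau>. exp (b * \<tau>) * norm (g \<tau>)))
          \<le> rate_const (r - b) * (exp (b * s) * positive_norm s + exp (b * t) * ?I)"
        by (intro mult_left_mono rate_const_nonneg)
      then have "exp (b * t) * comp_norm r t \<le> rate_const (r - b) * (exp (b * s) * positive_norm s + exp (b * t) * ?I)"
        using exp_norm_upper_estimate[OF sol cont b(2)[OF r] st] unfolding comp_norm_def by linarith
      then have "comp_norm r t \<le> rate_const (r - b) * (exp (b * s) * positive_norm s + exp (b * t) * ?I) * exp (- b * t)"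
        unfolding exp_weight_le_iff .
      also have "\<dots> = rate_const (r - b) * ((exp (b * s) * exp (- b * t)) * positive_norm s + (exp (b * t) * exp (- b * t)) * ?I)"
        by (simp add: algebra_simps)
      also have "exp (b * s) * exp (- b * t) = exp (- b * (t - s))" by (simp add: algebra_simps flip: exp_add)
      also have "exp (b * t) * exp (- b * t) = 1" by (simp flip: exp_add)
      finally show ?thesis by simp
    qed
    have "positive_norm t \<le> (\<Sum>r\<in>?P. rate_const (r - b) * (exp (- b * (t - s)) * positive_norm s + ?I))"
      unfolding positive_norm_def[of t] by (intro sum_mono r)
    then show ?thesis by (simp add: C_def sum_distrib_right)
  qed
  then show ?thesis using b(1) C by blast
qed

lemma slow_or_exp_decay:
  "(\<exists>\<gamma>>0. exp_decay (\<lambda>t. \<Sum>r\<in>calD K lam \<delta>. comp_norm r t) \<gamma>) \<or>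
   (\<exists>T0\<ge>0. \<exists>M1>0. \<exists>M2>0. \<forall>t\<ge>T0. M1 / (1 + t) powr (1 / p) \<le> norm (u t) \<and>
      norm (u' t) + halfnorm K e lam (u t) \<le> M2 * norm (u t) powr (1 + p))"
proof -
  obtain b Y0 where b: "0 < b" "0 \<le> Y0" and Y0: "\<And>s t. \<lbrakk>0 \<le> s; s \<le> t\<rbrakk> \<Longrightarrow>
     positive_norm t \<le> Y0 * (exp (- b * (t - s)) * positive_norm s + integral {s..t} (\<lambda>\<tau>. norm (g \<tau>)))"
    using positive_norm_estimate by blast
  define C where "C = c + Y0 + force_const"
  have C: "1 \<le> C" "c \<le> C" "Y0 \<le> C" "force_const \<le> C" using c b force_const_nonneg by (auto simp: C_def)
  have I0: "0 \<le> integral {s..t} (\<lambda>\<tau>. norm (g \<tau>))" if "0 \<le> s" for s t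
    using that norm_g_cont by (intro integral_nonneg integrable_continuous_real continuous_on_subset[OF norm_g_cont]) auto
  interpret nd: neutral_vs_decaying "comp_norm 0" positive_norm "\<lambda>t. norm (g t)" C b p q
  \<comment> \<open>Cases 9, 10 and 11 are \<open>x_var\<close>, \<open>Y_dec\<close> and
    \<open>G_le\<close>, whose separate constants are replaced by the common
    \<open>C\<close>.\<close>
  proof (unfold_locales, goal_cases)
    case (9 s t)
    have "c * integral {s..t} (\<lambda>\<tau>. norm (g \<tau>)) \<le> C * integral {s..t} (\<lambda>\<tau>. norm (g \<tau>))" using C I0[OF 9(1)] by (intro mult_right_mono)
    then show ?case using neutral_exp_norm_variation[OF sol cont 9] by (simp add: comp_norm_def)
  next
    case (10 s t)
    have "Y0 * (exp (- b * (t - s)) * positive_norm s + integral {s..t} (\<lambda>\<tau>. norm (g \<tau>)))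
        \<le> C * (exp (- b * (t - s)) * positive_norm s + integral {s..t} (\<lambda>\<tau>. norm (g \<tau>)))"
      using C I0[OF 10(1)] positive_norm_nonneg by (intro mult_right_mono add_nonneg_nonneg mult_nonneg_nonneg) auto
    then show ?case using Y0[OF 10] by linarith
  next
    case (11 t)
    have "force_const * ((comp_norm 0 t + positive_norm t) powr (1 + p) + positive_norm t powr (1 + q))
        \<le> C * ((comp_norm 0 t + positive_norm t) powr (1 + p) + positive_norm t powr (1 + q))"
      using C by (intro mult_right_mono) auto
    then show ?case using norm_g_le[OF 11] by linarith
  qed (use C b p q comp_norm_nonneg positive_norm_nonneg norm_g_cont neutral_tendsto positive_norm_tendsto in auto)
  from nd.slow_or_exp_decay show ?thesis
  proof
    assume "\<exists>\<gamma>>0. \<exists>M. \<forall>t\<ge>0. nd.N t \<le> M * exp (- \<gamma> * t)"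
    then show ?thesis unfolding nd.N_def sum_comp_norm[symmetric] by (intro disjI1) (meson exp_decayI)
  next
    assume "\<exists>T\<ge>0. \<exists>M>0. \<exists>m>0. \<forall>t\<ge>T. m / (1 + t) powr (1 / p) \<le> comp_norm 0 t \<and> positive_norm t \<le> M * comp_norm 0 t powr (1 + p)"
    then obtain T M m where T: "0 \<le> T" "0 < M" "0 < m"
      "\<And>t. T \<le> t \<Longrightarrow> m / (1 + t) powr (1 / p) \<le> comp_norm 0 t"
      "\<And>t. T \<le> t \<Longrightarrow> positive_norm t \<le> M * comp_norm 0 t powr (1 + p)" by blast
    define s where "s = sqrt upper_const"
    have s: "0 < s" using c delta by (auto simp: s_def upper_const_def intro!: mult_pos_pos add_pos_nonneg)
    define A where "A = s * norm_const * M"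
    have A: "0 < A" using s norm_const_pos T by (simp add: A_def)
    have xp: "((\<lambda>t. comp_norm 0 t powr p) \<longlongrightarrow> 0) at_top"
      using p comp_norm_nonneg by (intro tendsto_zero_powrI[OF neutral_tendsto tendsto_const]) auto
    have "0 < 1 / (2 * A)" using A by simp
    from order_tendstoD(2)[OF xp this] obtain T1 where T1: "\<And>t. T1 \<le> t \<Longrightarrow> comp_norm 0 t powr p < 1 / (2 * A)"
      by (auto simp: eventually_at_top_linorder)
    define T2 where "T2 = max T T1"
    have T2: "0 \<le> T2" "T \<le> T2" "T1 \<le> T2" using T by (auto simp: T2_def)
    \<comment> \<open>The slaved positive part is \<open>comp_norm 0 t\<close> times a factor
      tending to 0. Once that factor is at most 1/2 it is absorbed, at the cost of doubling the
      constant.\<close>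
    have xu: "comp_norm 0 t \<le> 2 * s * norm (u t)" if t: "T2 \<le> t" for t
    proof -
      have x0: "0 \<le> comp_norm 0 t" by (rule comp_norm_nonneg)
      have "s * norm_const * positive_norm t \<le> s * norm_const * (M * comp_norm 0 t powr (1 + p))"
        using T(5)[of t] t T2 s norm_const_pos by (intro mult_left_mono) auto
      also have "\<dots> = comp_norm 0 t * (A * comp_norm 0 t powr p)"
        using x0 by (simp add: A_def powr_mult_base[symmetric])
      also have "\<dots> \<le> comp_norm 0 t * (1 / 2)"
      proof (rule mult_left_mono[OF _ x0])
        have "A * comp_norm 0 t powr p \<le> A * (1 / (2 * A))" using T1[of t] t T2 A by (intro mult_left_mono) auto
        then show "A * comp_norm 0 t powr p \<le> 1 / 2" using A by simp
      qed
      finally show ?thesis using neutral_le[of t] t T2 by (simp add: s_def)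
    qed
    define M1 M2 where "M1 = m / (2 * s)" and "M2 = norm_const * M * (2 * s) powr (1 + p)"
    have M12: "0 < M1" "0 < M2" using T s norm_const_pos by (auto simp: M1_def M2_def)
    have "M1 / (1 + t) powr (1 / p) \<le> norm (u t) \<and> norm (u' t) + halfnorm K e lam (u t) \<le> M2 * norm (u t) powr (1 + p)"
      if t: "T2 \<le> t" for t
    proof
      have t0: "0 \<le> t" "T \<le> t" using t T2 by auto
      have "m / (1 + t) powr (1 / p) \<le> 2 * s * norm (u t)" using T(4)[OF t0(2)] xu[OF t] by linarith
      then have "m / (1 + t) powr (1 / p) / (2 * s) \<le> norm (u t)"
        using s by (subst pos_divide_le_eq) (auto simp: mult_ac)
      then show "M1 / (1 + t) powr (1 / p) \<le> norm (u t)" by (simp add: M1_def mult.commute)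
      have "norm (u' t) + halfnorm K e lam (u t) \<le> norm_const * (M * comp_norm 0 t powr (1 + p))"
        using norms_le_positive[OF t0(1)] mult_left_mono[OF T(5)[OF t0(2)], of norm_const] norm_const_pos by linarith
      also have "\<dots> \<le> norm_const * (M * (2 * s * norm (u t)) powr (1 + p))"
        using xu[OF t] comp_norm_nonneg p T norm_const_pos by (intro mult_left_mono powr_mono2) auto
      also have "\<dots> = M2 * norm (u t) powr (1 + p)" by (simp add: M2_def powr_mult)
      finally show "norm (u' t) + halfnorm K e lam (u t) \<le> M2 * norm (u t) powr (1 + p)" .
    qed
    then show ?thesis using T2(1) M12 by (intro disjI2) blast
  qed
qed

lemma null_or_fast:
  assumes decay: "\<exists>\<gamma>>0. exp_decay (\<lambda>t. \<Sum>r\<in>calD K lam \<delta>. comp_norm r t) \<gamma>"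
  shows "(\<forall>t\<ge>0. u t = 0) \<or>
    (\<exists>r0\<in>calD K lam \<delta>. r0 > 0 \<and>
      (\<exists>v0 v0'. weak_sol K e lam \<delta> v0 v0' (\<lambda>_. 0) \<and> pure K e lam \<delta> v0 v0' r0 \<and>
         \<not> (\<forall>t\<ge>0. v0 t = 0) \<and>
         (\<forall>\<gamma>. ereal \<gamma> < min (beta0 K lam \<delta> r0) (ereal (min ((1 + p) * r0) ((1 + q) * r0))) \<longrightarrow>
            ((\<lambda>t. (norm (u' t - v0' t) + dnorm K e lam (u t - v0 t)) * exp (\<gamma> * t)) \<longlongrightarrow> 0) at_top)))"
proof -
  let ?D = "calD K lam \<delta>"
  interpret es: exponent_system ?D comp_norm "\<lambda>t. norm (g t)" force_const p q
  \<comment> \<open>Cases 5, 6 and 10 are \<open>upper\<close>, \<open>lower\<close> and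
    \<open>G_le\<close>. In the last one the full norm replaces \<open>positive_norm\<close>: here
    the exponent 0 is treated like any other.\<close>
  proof (unfold_locales, goal_cases)
    case (5 r b)
    show ?case unfolding comp_norm_def
      by (intro exI[of _ "rate_const (r - b)"] conjI rate_const_nonneg allI impI exp_norm_upper_estimate[OF sol cont 5(2)])
  next
    case (6 r a)
    show ?case unfolding comp_norm_def
      by (intro exI[of _ "rate_const (a - r)"] conjI rate_const_nonneg allI impI exp_norm_lower_estimate[OF sol cont 6(2)])
  next
    case (10 t)
    have "positive_norm t powr (1 + q) \<le> (comp_norm 0 t + positive_norm t) powr (1 + q)"
      using q comp_norm_nonneg positive_norm_nonneg by (intro powr_mono2) auto
    then have "force_const * ((comp_norm 0 t + positive_norm t) powr (1 + p) + positive_norm t powr (1 + q))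
        \<le> force_const * ((comp_norm 0 t + positive_norm t) powr (1 + p) + (comp_norm 0 t + positive_norm t) powr (1 + q))"
      using force_const_nonneg by (intro mult_left_mono) auto
    then show ?case using norm_g_le[OF 10] unfolding sum_comp_norm by linarith
  qed (use finite_exps comp_norm_nonneg norm_g_cont force_const_nonneg p q decay in auto)
  define m where "m = min p q"
  have m: "0 < m" using p q by (simp add: m_def)
  from es.null_or_sharp_rate show ?thesis
  proof
    assume N0: "\<forall>t\<ge>0. es.N t = 0"
    have "u t = 0" if t: "0 \<le> t" for t
    proof -
      have "comp_norm 0 t + positive_norm t = 0" using N0 t unfolding es.N_def sum_comp_norm by blast
      then have "norm (u' t) + dnorm K e lam (u t) \<le> 0" using norms_le[OF t] by simp
      then have "dnorm K e lam (u t) \<le> 0" using norm_ge_zero[of "u' t"] by linarith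
      then have "norm (u t) \<le> 0" using norm_le_dnorm(1)[of "u t"] by linarith
      then show ?thesis by simp
    qed
    then show ?thesis by blast
  next
    assume "\<exists>r0\<in>?D. 0 < r0 \<and> (\<forall>b>r0. \<not> exp_decay es.N b) \<and> (\<forall>c<(1 + min p q) * r0. exp_decay (\<lambda>t. norm (g t)) c) \<and>
      (\<forall>r\<in>?D. \<forall>b<(1 + min p q) * r0. r \<noteq> r0 \<longrightarrow> (r0 < r \<longrightarrow> b < r) \<longrightarrow> exp_decay (comp_norm r) b)"
    then obtain r0 where r0: "r0 \<in> ?D" "0 < r0" and sharp: "\<And>b. r0 < b \<Longrightarrow> \<not> exp_decay es.N b"
      and gd: "\<And>b. b < (1 + m) * r0 \<Longrightarrow> exp_decay (\<lambda>t. norm (g t)) b"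
      and yd: "\<And>r b. \<lbrakk>r \<in> ?D; b < (1 + m) * r0; r \<noteq> r0; r0 < r \<Longrightarrow> b < r\<rbrakk> \<Longrightarrow> exp_decay (comp_norm r) b"
      unfolding m_def by blast
    \<comment> \<open>A rate slightly above \<open>r0\<close> at which the forcing is already known
      to decay; it fixes the profile.\<close>
    obtain \<kappa> where \<kappa>: "r0 < \<kappa>" "\<kappa> < (1 + m) * r0" "\<And>r. \<lbrakk>r \<in> ?D; r0 < r\<rbrakk> \<Longrightarrow> \<kappa> < r"
      using exists_rate_above[OF r0(2) m] by blast
    obtain v v' where v: "weak_sol K e lam \<delta> v v' (\<lambda>_. 0)"
      and vz: "\<And>k t r. \<lbrakk>k \<in> K; 0 \<le> t; r \<noteq> r0\<rbrakk> \<Longrightarrow> mode_form \<delta> 1 r (lam k) (v t \<bullet> e k) (v' t \<bullet> e k) = 0"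
      and vd: "\<And>b. \<lbrakk>\<kappa> \<le> b; exp_decay (\<lambda>t. norm (g t)) b\<rbrakk> \<Longrightarrow> exp_decay (\<lambda>t. exp_norm r0 (u t - v t) (u' t - v' t)) b"
      using asymptotic_profile[OF sol cont r0(2) \<kappa>(1) gd[OF \<kappa>(2)]] by blast
    \<comment> \<open>The \<open>r0\<close>-component of the difference decays by the choice of the
      profile. The other components are those of \<open>u\<close>, since the profile has none, and
      decay at their improved rates.\<close>
    have total: "exp_decay (\<lambda>t. \<Sum>r\<in>?D. exp_norm r (u t - v t) (u' t - v' t)) b"
      if b: "\<kappa> \<le> b" "b < (1 + m) * r0" "\<And>r. \<lbrakk>r \<in> ?D; r0 < r\<rbrakk> \<Longrightarrow> b < r" for b
    proof (rule exp_decay_sum[OF finite_exps])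
      fix r assume r: "r \<in> ?D"
      show "exp_decay (\<lambda>t. exp_norm r (u t - v t) (u' t - v' t)) b"
      proof (cases "r = r0")
        case True
        then show ?thesis using vd[OF b(1) gd[OF b(2)]] by simp
      next
        case False
        have "exp_decay (comp_norm r) b" using yd[OF r b(2) False] b(3)[OF r] by blast
        then show ?thesis
          by (rule exp_decay_le[where c = 1]) (use vz False in \<open>auto simp: comp_norm_def exp_norm_diff_eq\<close>)
      qed
    qed
    \<comment> \<open>A zero profile would make \<open>u\<close> itself decay at the rate
      \<open>\<kappa>\<close>, against the sharpness of \<open>r0\<close>.\<close>
    have nontriv: "\<not> (\<forall>t\<ge>0. v t = 0)"
    proof
      assume v0: "\<forall>t\<ge>0. v t = 0"
      have v'0: "v' t = 0" if t: "0 \<le> t" for t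
      proof (rule halfline_zero_derivative[OF t])
        show "(v has_vector_derivative v' t) (at t within {0..})" using v t by (simp add: weak_sol_def)
      qed (use v0 in auto)
      have "exp_decay es.N \<kappa>"
        by (rule exp_decay_le[OF total[OF order_refl \<kappa>(2,3)], of _ 1]) (use v0 v'0 in \<open>auto simp: es.N_def comp_norm_def\<close>)
      then show False using sharp[OF \<kappa>(1)] by simp
    qed
    have conv: "((\<lambda>t. (norm (u' t - v' t) + dnorm K e lam (u t - v t)) * exp (\<gamma> * t)) \<longlongrightarrow> 0) at_top"
      if gam: "ereal \<gamma> < min (beta0 K lam \<delta> r0) (ereal (min ((1 + p) * r0) ((1 + q) * r0)))" for \<gamma>
    proof -
      have "min ((1 + p) * r0) ((1 + q) * r0) = (1 + m) * r0"
        using r0(2) by (auto simp: m_def min_def algebra_simps)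
      then have g1: "\<gamma> < (1 + m) * r0" "\<And>r. \<lbrakk>r \<in> ?D; r0 < r\<rbrakk> \<Longrightarrow> \<gamma> < r"
        using gam less_beta0_iff[OF finite_exps, of \<gamma> r0] r0(1) by auto
      let ?S = "insert ((1 + m) * r0) {r \<in> ?D. r0 < r}"
      have fin: "finite ?S" using finite_exps by simp
      \<comment> \<open>The estimates are available only from \<open>\<kappa>\<close> on, so a
        smaller \<open>\<gamma>\<close> is reached through a larger rate \<open>b\<close>.\<close>
      have "max \<gamma> \<kappa> < Min ?S" using fin g1 \<kappa> by (subst Min_gr_iff) auto
      then obtain b where "max \<gamma> \<kappa> < b" "b < Min ?S" using dense by blast
      then have b: "\<gamma> < b" "\<kappa> \<le> b" "b < (1 + m) * r0" "\<And>r. \<lbrakk>r \<in> ?D; r0 < r\<rbrakk> \<Longrightarrow> b < r"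
        using fin by (auto simp: Min_gr_iff)
      have "exp_decay (\<lambda>t. norm (u' t - v' t) + dnorm K e lam (u t - v t)) b"
        by (rule exp_decay_le[OF total[OF b(2-4)], of _ norm_const])
           (use norms_le_exp_norms domhalf_diff dom weak_sol_domhalf[OF v] norm_const_pos in auto)
      from exp_decay_tendsto[OF this b(1)] show ?thesis by (simp add: mult.commute dnorm_def)
    qed
    show ?thesis
    proof (rule disjI2, rule bexI[OF _ r0(1)], rule conjI[OF r0(2)], rule exI[of _ v], rule exI[of _ v'], intro conjI)
      show "pure K e lam \<delta> v v' r0" by (rule pureI) (rule vz)
      show "\<forall>\<gamma>. ereal \<gamma> < min (beta0 K lam \<delta> r0) (ereal (min ((1 + p) * r0) ((1 + q) * r0))) \<longrightarrow>
          ((\<lambda>t. (norm (u' t - v' t) + dnorm K e lam (u t - v t)) * exp (\<gamma> * t)) \<longlongrightarrow> 0) at_top"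
        using conv by (intro allI impI)
    qed (fact v nontriv)+
  qed
qed

end

theorem theorem3p1:
  fixes K :: "'k set" and e :: "'k \<Rightarrow> 'a::{real_inner,complete_space}"
    and lam :: "'k \<Rightarrow> real" and \<delta> K0 p q :: real
    and u u' :: "real \<Rightarrow> 'a"
  assumes op: "admissible_op K e lam"
    and delta: "\<delta> > 0" and K0: "K0 \<ge> 0" and p: "p > 0" and q: "q > 0"
    and sol: "diff_ineq_sol K e lam \<delta> K0 p q u u'"
    and lim: "((\<lambda>t. dnorm K e lam (u t)) \<longlongrightarrow> 0) at_top"
  defines "Null \<equiv> (\<forall>t\<ge>0. u t = 0)"
    and "Slow \<equiv> (\<exists>T0\<ge>0. \<exists>M1>0. \<exists>M2>0. \<forall>t\<ge>T0.
              norm (u t) \<ge> M1 / (1 + t) powr (1 / p) \<and>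
              norm (u' t) + halfnorm K e lam (u t) \<le> M2 * norm (u t) powr (1 + p))"
    and "Fast \<equiv> (\<exists>r0\<in>calD K lam \<delta>. r0 > 0 \<and>
              (\<exists>v0 v0'. weak_sol K e lam \<delta> v0 v0' (\<lambda>_. 0) \<and> pure K e lam \<delta> v0 v0' r0 \<and>
                 \<not> (\<forall>t\<ge>0. v0 t = 0) \<and>
                 (\<forall>\<gamma>. ereal \<gamma> < min (beta0 K lam \<delta> r0) (ereal (min ((1 + p) * r0) ((1 + q) * r0))) \<longrightarrow>
                    ((\<lambda>t. (norm (u' t - v0' t) + dnorm K e lam (u t - v0 t)) * exp (\<gamma> * t))
                       \<longlongrightarrow> 0) at_top)))"
  shows "(Null \<and> \<not> Slow \<and> \<not> Fast) \<or> (\<not> Null \<and> Slow \<and> \<not> Fast) \<or> (\<not> Null \<and> \<not> Slow \<and> Fast)"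
proof -
  obtain g where cont: "continuous_on {0..} g" and ws: "weak_sol K e lam \<delta> u u' g"
    and g: "\<And>t. 0 \<le> t \<Longrightarrow> norm (g t) \<le> K0 * (norm (u t) powr (1 + p) + halfnorm K e lam (u t) powr (1 + q))"
    using sol unfolding diff_ineq_sol_def by blast
  have onb: "onb K e" and lam: "\<And>k. k \<in> K \<Longrightarrow> 0 \<le> lam k" and fin: "finite (lam ` K \<inter> {..\<delta>\<^sup>2})"
    using op by (auto simp: admissible_op_def spec_def)
  obtain c where c: "1 \<le> c" "\<And>k. \<lbrakk>k \<in> K; lam k < \<delta>\<^sup>2\<rbrakk> \<Longrightarrow> 1 \<le> c * (2 * sqrt (\<delta>\<^sup>2 - lam k))"
    using exists_gap_constant[OF fin] by blast
  interpret inequality_solution K lam \<delta> c e u u' g K0 p q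
    by unfold_locales (use delta c lam finite_calD[OF fin] onb ws cont K0 p q g lim in auto)
  have some: "Null \<or> Slow \<or> Fast"
    using slow_or_exp_decay null_or_fast unfolding Null_def Slow_def Fast_def by blast
  have rates_below: "ereal \<gamma> < min (beta0 K lam \<delta> r0) (ereal (min ((1 + p) * r0) ((1 + q) * r0)))"
    if "r0 \<in> calD K lam \<delta>" "0 < r0" "\<gamma> < (1 + min p q) * r0" "\<And>r. \<lbrakk>r \<in> calD K lam \<delta>; r0 < r\<rbrakk> \<Longrightarrow> \<gamma> < r" for r0 \<gamma>
  proof -
    have "(1 + min p q) * r0 \<le> (1 + p) * r0" "(1 + min p q) * r0 \<le> (1 + q) * r0"
      using that(2) by (auto intro!: mult_right_mono)
    then have "\<gamma> < (1 + p) * r0" "\<gamma> < (1 + q) * r0" using that(3) by linarith+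
    then show ?thesis using that less_beta0_iff[OF finite_exps, of \<gamma> r0] by auto
  qed
  have not_null_slow: "\<not> (Null \<and> Slow)"
  proof
    assume "Null \<and> Slow"
    then obtain T0 M1 where T: "0 \<le> T0" "0 < M1" "M1 / (1 + T0) powr (1 / p) \<le> norm (u T0)" "u T0 = 0"
      unfolding Null_def Slow_def by blast
    moreover have "0 < M1 / (1 + T0) powr (1 / p)" using T by simp
    ultimately show False by simp
  qed
  \<comment> \<open>If \<open>u\<close> vanishes, the convergence statement is about the profile
    itself and says that it decays faster than its own rate \<open>r0\<close>.\<close>
  have not_null_fast: "\<not> (Null \<and> Fast)"
  proof
    assume nf: "Null \<and> Fast"
    then have u0: "\<And>t. 0 \<le> t \<Longrightarrow> u t = 0" by (simp add: Null_def)
    have u'0: "u' t = 0" if t: "0 \<le> t" for t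
      by (rule halfline_zero_derivative[OF t, of u]) (use ws t u0 in \<open>auto simp: weak_sol_def\<close>)
    obtain r0 v v' where r0: "r0 \<in> calD K lam \<delta>" "0 < r0" and v: "weak_sol K e lam \<delta> v v' (\<lambda>_. 0)" "pure K e lam \<delta> v v' r0"
      and nz: "\<not> (\<forall>t\<ge>0. v t = 0)"
      and conv: "\<And>\<gamma>. ereal \<gamma> < min (beta0 K lam \<delta> r0) (ereal (min ((1 + p) * r0) ((1 + q) * r0))) \<Longrightarrow>
        ((\<lambda>t. (norm (u' t - v' t) + dnorm K e lam (u t - v t)) * exp (\<gamma> * t)) \<longlongrightarrow> 0) at_top"
      using nf unfolding Fast_def by blast
    obtain \<gamma> where \<gamma>: "r0 < \<gamma>" "\<gamma> < (1 + min p q) * r0" "\<And>r. \<lbrakk>r \<in> calD K lam \<delta>; r0 < r\<rbrakk> \<Longrightarrow> \<gamma> < r"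
      using exists_rate_above[OF r0(2), of "min p q"] p q by auto
    have "dnorm K e lam (- x) = dnorm K e lam x" for x by (simp add: dnorm_def halfnorm_def)
    then have eq: "norm (u' t - v' t) + dnorm K e lam (u t - v t) = norm (v' t) + dnorm K e lam (v t)" if "0 \<le> t" for t
      using u0[OF that] u'0[OF that] by simp
    have "((\<lambda>t. (norm (v' t) + dnorm K e lam (v t)) * exp (\<gamma> * t)) \<longlongrightarrow> 0) at_top"
    proof (rule Lim_transform_eventually[OF conv[OF rates_below[OF r0 \<gamma>(2,3)]]])
      show "\<forall>\<^sub>F t in at_top. (norm (u' t - v' t) + dnorm K e lam (u t - v t)) * exp (\<gamma> * t) = (norm (v' t) + dnorm K e lam (v t)) * exp (\<gamma> * t)"
        using eventually_ge_at_top[of 0] by eventually_elim (simp add: eq)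
    qed
    then have "\<forall>t\<ge>0. v t = 0" using pure_zero_if_fast[OF v \<gamma>(1)] by blast
    then show False using nz by simp
  qed
  \<comment> \<open>A fast solution decays exponentially, because both its profile and its distance
    from the profile do.\<close>
  have not_slow_fast: "\<not> (Slow \<and> Fast)"
  proof
    assume sf: "Slow \<and> Fast"
    then obtain T0 M1 where T: "0 < M1" "\<And>t. T0 \<le> t \<Longrightarrow> M1 / (1 + t) powr (1 / p) \<le> norm (u t)"
      unfolding Slow_def by blast
    obtain r0 v v' where r0: "r0 \<in> calD K lam \<delta>" "0 < r0" and v: "weak_sol K e lam \<delta> v v' (\<lambda>_. 0)" "pure K e lam \<delta> v v' r0"
      and conv: "\<And>\<gamma>. ereal \<gamma> < min (beta0 K lam \<delta> r0) (ereal (min ((1 + p) * r0) ((1 + q) * r0))) \<Longrightarrow>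
        ((\<lambda>t. (norm (u' t - v' t) + dnorm K e lam (u t - v t)) * exp (\<gamma> * t)) \<longlongrightarrow> 0) at_top"
      using sf unfolding Fast_def by blast
    \<comment> \<open>Any rate below \<open>r0\<close> is admissible in the fast alternative. A
      third leaves a margin below \<open>r0 / 2\<close>, the rate at which the decay of the pure
      profile is invoked.\<close>
    define \<gamma> where "\<gamma> = r0 / 3"
    have \<gamma>: "0 < \<gamma>" "\<gamma> < r0 / 2" "\<gamma> < r0" using r0 by (auto simp: \<gamma>_def)
    have "r0 \<le> (1 + min p q) * r0" using r0 p q by (simp add: mult_le_cancel_right1)
    then have "\<gamma> < (1 + min p q) * r0" using \<gamma> by linarith
    then have 1: "((\<lambda>t. (norm (u' t - v' t) + dnorm K e lam (u t - v t)) * exp (\<gamma> * t)) \<longlongrightarrow> 0) at_top"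
      using \<gamma> by (intro conv rates_below r0) auto
    have "exp_decay (\<lambda>t. norm (v t)) (r0 / 2)" by (rule pure_exp_decay[OF v]) (use r0 in simp)
    from exp_decay_tendsto[OF this \<gamma>(2)] have 2: "((\<lambda>t. exp (\<gamma> * t) * norm (v t)) \<longlongrightarrow> 0) at_top" by simp
    have 3: "((\<lambda>t. (norm (u' t - v' t) + dnorm K e lam (u t - v t)) * exp (\<gamma> * t) + exp (\<gamma> * t) * norm (v t)) \<longlongrightarrow> 0) at_top"
      using tendsto_add[OF 1 2] by simp
    have lim_u: "((\<lambda>t. norm (u t) * exp (\<gamma> * t)) \<longlongrightarrow> 0) at_top"
    proof (rule tendsto_sandwich[OF _ _ tendsto_const 3])
      show "\<forall>\<^sub>F t in at_top. norm (u t) * exp (\<gamma> * t) \<le> (norm (u' t - v' t) + dnorm K e lam (u t - v t)) * exp (\<gamma> * t) + exp (\<gamma> * t) * norm (v t)"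
      proof (rule always_eventually, rule allI)
        fix t
        have "norm (u t) \<le> norm (u t - v t) + norm (v t)" using norm_triangle_sub[of "u t" "v t"] by simp
        then have "norm (u t) \<le> norm (u' t - v' t) + dnorm K e lam (u t - v t) + norm (v t)"
          using norm_le_dnorm(1)[of "u t - v t"] norm_ge_zero[of "u' t - v' t"] by linarith
        then have "norm (u t) * exp (\<gamma> * t) \<le> (norm (u' t - v' t) + dnorm K e lam (u t - v t) + norm (v t)) * exp (\<gamma> * t)"
          by (intro mult_right_mono) auto
        then show "norm (u t) * exp (\<gamma> * t) \<le> (norm (u' t - v' t) + dnorm K e lam (u t - v t)) * exp (\<gamma> * t) + exp (\<gamma> * t) * norm (v t)"
          by (simp add: algebra_simps)
      qed
    qed simp
    show False
    proof (rule polynomial_lower_bound_not_exp_decay[OF _ _ _ \<gamma>(1) lim_u])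
      show "M1 / (1 + t) powr (1 / p) \<le> norm (u t)" if "T0 \<le> t" for t by (rule T(2)[OF that])
    qed (fact p T(1))+
  qed
  show ?thesis using some not_null_slow not_null_fast not_slow_fast by blast
qed

end
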